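(* Let $\Omega \subset \mathbb{R}^n$ be a bounded convex domain (nonempty, open, bounded, convex). Let $M(\Omega) = \frac{1}{|\Omega|}\int_\Omega \|x - c_\Omega\|\,dx$, where $c_\Omega = \frac{1}{|\Omega|}\int_\Omega x\,dx$ is the center of gravity of $\Omega$. Then for every $u \in W^{1,1}(\Omega)$, $$\left\|u-\frac{1}{|\Omega|}\int_{\Omega}u(z)\,dz\right\|_{L^{1}(\Omega)} \leq \frac{2}{\log 2}\, M(\Omega)\, \left\|\nabla u\right\|_{L^{1}(\Omega)}.$$
   Context: $|\Omega|$ denotes Lebesgue measure; $\|\cdot\|$ is the Euclidean norm; $\|\nabla u\|_{L^1(\Omega)} = \int_\Omega |\nabla u|\,dx$. $M(\Omega)$ is the average distance from a point of $\Omega$ to the center of gravity of $\Omega$. *)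

theory Defs
  imports "HOL-Analysis.Analysis"
begin

fun iter_deriv :: "'a::euclidean_space list \<Rightarrow> ('a \<Rightarrow> real) \<Rightarrow> 'a \<Rightarrow> real" where
  "iter_deriv [] f = f"
| "iter_deriv (v # vs) f = (\<lambda>x. frechet_derivative (iter_deriv vs f) (at x) v)"

text \<open>C-infinity: all iterated partial derivatives (along basis directions) exist and are
  (Frechet) differentiable everywhere, hence continuous.\<close>
definition smooth_fun :: "('a::euclidean_space \<Rightarrow> real) \<Rightarrow> bool" where
  "smooth_fun f \<longleftrightarrow> (\<forall>ds. set ds \<subseteq> Basis \<longrightarrow> iter_deriv ds f differentiable_on UNIV)"

definition test_fun :: "'a::euclidean_space set \<Rightarrow> ('a \<Rightarrow> real) \<Rightarrow> bool" where
  "test_fun \<Omega> \<phi> \<longleftrightarrow> smooth_fun \<phi> \<and> compact (closure {x. \<phi> x \<noteq> 0})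
       \<and> closure {x. \<phi> x \<noteq> 0} \<subseteq> \<Omega>"

definition weak_gradient_W11 :: "'a::euclidean_space set \<Rightarrow> ('a \<Rightarrow> real) \<Rightarrow> ('a \<Rightarrow> 'a) \<Rightarrow> bool" where
  "weak_gradient_W11 \<Omega> u g \<longleftrightarrow>
     set_integrable lebesgue \<Omega> u \<and> set_integrable lebesgue \<Omega> g \<and>
     (\<forall>\<phi>. test_fun \<Omega> \<phi> \<longrightarrow> (\<forall>i\<in>Basis.
        (LINT x:\<Omega>|lebesgue. u x * frechet_derivative \<phi> (at x) i)
          = - (LINT x:\<Omega>|lebesgue. (g x \<bullet> i) * \<phi> x)))"

definition W11 :: "'a::euclidean_space set \<Rightarrow> ('a \<Rightarrow> real) set" where
  "W11 \<Omega> = {u. \<exists>g. weak_gradient_W11 \<Omega> u g}"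

definition centroid :: "'a::euclidean_space set \<Rightarrow> 'a" where
  "centroid \<Omega> = (1 / measure lebesgue \<Omega>) *\<^sub>R (LINT x:\<Omega>|lebesgue. x)"

definition mean_dist :: "'a::euclidean_space set \<Rightarrow> real" where
  "mean_dist \<Omega> = (1 / measure lebesgue \<Omega>) * (LINT x:\<Omega>|lebesgue. norm (x - centroid \<Omega>))"

end

theory Submission
  imports Defs "HOL-Probability.Probability"
begin

text \<open>The proof follows Kannan, Lovasz and Simonovits. Cutting the range of a smooth \<open>u\<close> into
  unit bands reduces the inequality to a product inequality between four integrals over \<open>\<Omega>\<close>. A
  violation of the latter survives repeated bisection by hyperplanes, hence it occurs on a convex
  piece so thin that all functions involved depend only on the coordinate along a line. By
  Brunn-Minkowski, the distribution function \<open>F\<close> of this coordinate and \<open>1 - F\<close> are both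
  log-concave; this alone makes \<open>F\<close> differentiable with
  \<open>F' * (\<integral> min F (1 - F)) \<ge> ln 2 * F * (1 - F)\<close>, while \<open>\<integral> min F (1 - F)\<close> is a lower bound for the
  mean distance to any point. Since the centre is arbitrary throughout, the passage from smooth
  to Sobolev functions by mollifying inside \<open>\<Omega>\<close> keeps the centroid of \<open>\<Omega>\<close> fixed.\<close>

section \<open>Log-concave functions on the line\<close>

text \<open>The exponential law explains \<open>ln 2\<close>: at unit rate \<open>F' = 1 - F\<close>
  and the integral of \<open>min F (1 - F)\<close> is \<open>ln 2\<close>, so the differential
  inequality is asymptotically sharp as \<open>F\<close> tends to 1. The factor 2 arises because the
  deviation from the mean is bounded by an integral of \<bar>w x - w y\<bar> over pairs, in which
  each pair is met in both orders.

  A mean value is not inherited by the pieces of a bisection. This forces the shape of the product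
  inequality: its four integrals are all additive over pieces, and the centre \<open>c\<close> is
  fixed from outside. For a band around an integer \<open>i\<close>, \<open>f1\<close> and
  \<open>f2\<close> live where the function exceeds \<open>i + 1\<close> and where it is below
  \<open>i - 1\<close>, while \<open>f3\<close> is the length of the gradient, cut off by a tent
  supported on the band. A line joining a point of the first kind to one of the second must cross
  the band, and the crossing uses up at least one unit of the integral of \<open>f3\<close>. This is
  the only link between the three functions and it is a statement about lines, so it restricts to
  needles unchanged. Counting whole bands loses a bounded amount per pair of points, which scaling
  the function makes negligible.\<close>

text \<open>As \<open>0 powr a = 0\<close> even for \<open>a = 0\<close>, the inequality says nothing where \<open>\<phi>\<close> vanishes.\<close>

definition log_concave :: "(real \<Rightarrow> real) \<Rightarrow> bool" where
  "log_concave \<phi> \<longleftrightarrow> (\<forall>x. 0 \<le> \<phi> x) \<and>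
     (\<forall>x y. \<forall>l\<in>{0..1}. \<phi> x powr (1 - l) * \<phi> y powr l \<le> \<phi> ((1 - l) * x + l * y))"

lemma log_concave_nonneg: "log_concave \<phi> \<Longrightarrow> 0 \<le> \<phi> x"
  by (simp add: log_concave_def)

lemma log_concaveD:
  "log_concave \<phi> \<Longrightarrow> 0 \<le> l \<Longrightarrow> l \<le> 1 \<Longrightarrow> \<phi> x powr (1 - l) * \<phi> y powr l \<le> \<phi> ((1 - l) * x + l * y)"
  by (simp add: log_concave_def)

lemma log_concave_pos_combination:
  assumes "log_concave \<phi>" "0 < \<phi> x" "0 < \<phi> y" "0 \<le> l" "l \<le> 1"
  shows "0 < \<phi> ((1 - l) * x + l * y)"
  using log_concaveD[OF assms(1,4,5), of x y] assms(2,3)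
  by (smt (verit) mult_pos_pos powr_gt_zero)

lemma log_concave_convex_support:
  assumes "log_concave \<phi>"
  shows "convex {x. 0 < \<phi> x}"
  unfolding convex_alt using log_concave_pos_combination[OF assms] by auto

text \<open>The bound is a supporting line of the convex function \<open>- ln \<phi>\<close>,
  exponentiated. Continuity places \<open>t\<close> in the interior of the support, where a
  subgradient exists; outside the support the left side is 0.\<close>

lemma log_concave_tangent:
  assumes lc: "log_concave \<phi>" and cont: "isCont \<phi> t" and pos: "0 < \<phi> t"
  obtains k where "\<And>s. \<phi> s \<le> \<phi> t * exp (k * (s - t))"
proof -
  define I where "I = {x. 0 < \<phi> x}"
  have conv: "convex_on I (\<lambda>x. - ln (\<phi> x))"
  proof
    show "convex I" unfolding I_def by (rule log_concave_convex_support[OF lc])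
    fix l x y :: real
    assume l: "0 < l" "l < 1" and xy: "x \<in> I" "y \<in> I"
    have "ln (\<phi> x powr (1 - l) * \<phi> y powr l) \<le> ln (\<phi> ((1 - l) * x + l * y))"
      using log_concaveD[OF lc, of l x y] log_concave_pos_combination[OF lc, of x y l] l xy
      by (intro ln_mono) (auto simp: I_def)
    then show "- ln (\<phi> ((1 - l) *\<^sub>R x + l *\<^sub>R y)) \<le> (1 - l) * - ln (\<phi> x) + l * - ln (\<phi> y)"
      using xy by (simp add: I_def ln_mult ln_powr)
  qed
  have "eventually (\<lambda>x. 0 < \<phi> x) (nhds t)"
    using cont pos by (intro order_tendstoD(1)[of \<phi> "\<phi> t"]) (auto simp: isCont_def tendsto_at_iff_tendsto_nhds)
  then have tI: "t \<in> interior I"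
    by (auto simp: eventually_nhds interior_def I_def)
  \<comment> \<open>The infimum is the right derivative of \<open>- ln \<phi>\<close> at
    \<open>t\<close>, which is a subgradient there.\<close>
  define k where "k = - Inf ((\<lambda>x. (- ln (\<phi> t) - - ln (\<phi> x)) / (t - x)) ` ({t<..} \<inter> I))"
  have "\<phi> s \<le> \<phi> t * exp (k * (s - t))" for s
  proof (cases "s \<in> I")
    case True
    have "- ln (\<phi> t) + (- k) * (s - t) \<le> - ln (\<phi> s)"
      unfolding k_def using convex_le_Inf_differential[OF conv tI True] by simp
    then have "ln (\<phi> s) \<le> ln (\<phi> t) + k * (s - t)" by simp
    then have "exp (ln (\<phi> s)) \<le> exp (ln (\<phi> t) + k * (s - t))" by simp
    then show ?thesis using True pos by (simp add: I_def exp_add)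
  next
    case False
    then show ?thesis using pos log_concave_nonneg[OF lc, of s]
      by (smt (verit, ccfv_SIG) I_def mem_Collect_eq mult_nonneg_nonneg exp_ge_zero)
  qed
  then show ?thesis using that by blast
qed

text \<open>The gap \<open>up - lo\<close> is nonnegative and vanishes at \<open>t\<close>, so its
  derivative there is 0 and the two slopes agree. The difference quotients of \<open>f\<close> are
  then squeezed, in reversed order for negative increments.\<close>

lemma squeeze_has_real_derivative:
  fixes f lo up :: "real \<Rightarrow> real"
  assumes "\<And>s. lo s \<le> f s" "\<And>s. f s \<le> up s" "lo t = f t" "up t = f t"
    and lo: "(lo has_real_derivative d) (at t)" and up: "(up has_real_derivative e) (at t)"
  shows "d = e" "(f has_real_derivative d) (at t)"
proof -
  have "((\<lambda>s. up s - lo s) has_real_derivative e - d) (at t)"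
    by (intro derivative_intros lo up)
  then show de: "d = e"
    using DERIV_local_min[of "\<lambda>s. up s - lo s" "e - d" t 1] assms(1-4)
    by (smt (verit) )
  have "(\<lambda>h. (lo (t + h) - lo t) / h) \<midarrow>0\<rightarrow> d" "(\<lambda>h. (up (t + h) - up t) / h) \<midarrow>0\<rightarrow> d"
    using lo up de by (simp_all add: DERIV_def)
  then have "(\<lambda>h. (f (t + h) - f t) / h) \<midarrow>0\<rightarrow> d"
    unfolding LIM_eq
  proof safe
    fix r :: real assume r: "0 < r"
    assume a: "\<forall>r>0. \<exists>s>0. \<forall>x. x \<noteq> 0 \<and> norm (x - 0) < s \<longrightarrow> norm ((lo (t + x) - lo t) / x - d) < r"
    assume b: "\<forall>r>0. \<exists>s>0. \<forall>x. x \<noteq> 0 \<and> norm (x - 0) < s \<longrightarrow> norm ((up (t + x) - up t) / x - d) < r"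
    from a r obtain s1 where s1: "s1 > 0" "\<And>x. x \<noteq> 0 \<and> norm (x - 0) < s1 \<longrightarrow> norm ((lo (t + x) - lo t) / x - d) < r" by blast
    from b r obtain s2 where s2: "s2 > 0" "\<And>x. x \<noteq> 0 \<and> norm (x - 0) < s2 \<longrightarrow> norm ((up (t + x) - up t) / x - d) < r" by blast
    have "norm ((f (t + x) - f t) / x - d) < r" if "x \<noteq> 0" "norm (x - 0) < min s1 s2" for x
    proof -
      have l: "\<bar>(lo (t + x) - lo t) / x - d\<bar> < r" and u: "\<bar>(up (t + x) - up t) / x - d\<bar> < r"
        using s1(2) s2(2) that by auto
      have le: "lo (t+x) - lo t \<le> f (t + x) - f t" "f (t + x) - f t \<le> up (t + x) - up t"
        using assms(1-4) by auto
      show ?thesis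
      proof (cases "x > 0")
        case True
        then have "(lo (t+x) - lo t) / x \<le> (f (t + x) - f t) / x" "(f (t + x) - f t) / x \<le> (up (t + x) - up t) / x"
          using le by (auto intro: divide_right_mono)
        then show ?thesis using l u by auto
      next
        case False
        then have "(lo (t+x) - lo t) / x \<ge> (f (t + x) - f t) / x" "(f (t + x) - f t) / x \<ge> (up (t + x) - up t) / x"
          using le by (auto intro: divide_right_mono_neg)
        then show ?thesis using l u by auto
      qed
    qed
    then show "\<exists>s>0. \<forall>x. x \<noteq> 0 \<and> norm (x - 0) < s \<longrightarrow> norm ((f (t + x) - f t) / x - d) < r"
      using s1(1) s2(1) by (intro exI[of _ "min s1 s2"]) auto
  qed
  then show "(f has_real_derivative d) (at t)" by (simp add: DERIV_def)
qed

text \<open>The exponential tangents of \<open>F\<close> and of \<open>1 - F\<close> at \<open>t\<close> enclose \<open>F\<close>, so they agree to first order and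
  \<open>F\<close> is differentiable there.\<close>

lemma log_concave_cdf_tangent:
  fixes F :: "real \<Rightarrow> real"
  assumes F: "log_concave F" and G: "log_concave (\<lambda>s. 1 - F s)" and cont: "isCont F t"
    and t: "0 < F t" "F t < 1" and lim: "(F \<longlongrightarrow> 1) at_top"
  obtains r where "0 < r" "(F has_real_derivative r) (at t)"
    "\<And>s. F s \<le> F t * exp (r / F t * (s - t))"
    "\<And>s. 1 - F s \<le> (1 - F t) * exp (- (r / (1 - F t)) * (s - t))"
proof -
  obtain k where k: "\<And>s. F s \<le> F t * exp (k * (s - t))"
    using log_concave_tangent[OF F cont t(1)] by blast
  have "isCont (\<lambda>s. 1 - F s) t" using cont by (intro continuous_intros)
  then obtain h where h: "\<And>s. 1 - F s \<le> (1 - F t) * exp (h * (s - t))"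
    using log_concave_tangent[OF G, of t] t by auto
  have d1: "((\<lambda>s. F t * exp (k * (s - t))) has_real_derivative F t * k) (at t)"
    by (auto intro!: derivative_eq_intros)
  have d2: "((\<lambda>s. 1 - (1 - F t) * exp (h * (s - t))) has_real_derivative - (1 - F t) * h) (at t)"
    by (auto intro!: derivative_eq_intros simp: algebra_simps)
  have lo: "1 - (1 - F t) * exp (h * (s - t)) \<le> F s" for s
    using h[of s] by simp
  note sq = squeeze_has_real_derivative[of "\<lambda>s. 1 - (1 - F t) * exp (h * (s - t))" F "\<lambda>s. F t * exp (k * (s - t))" t, OF lo k _ _ d2 d1]
  have e: "- (1 - F t) * h = F t * k" by (rule sq(1)) simp_all
  have d: "(F has_real_derivative F t * k) (at t)"
    using sq(2) unfolding e by simp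
  \<comment> \<open>With a nonpositive exponent, \<open>F\<close> could never exceed
    \<open>F t < 1\<close> to the right of \<open>t\<close>, against its limit 1.\<close>
  have "k > 0"
  proof (rule ccontr)
    assume "\<not> k > 0"
    have "F s \<le> F t" if "s \<ge> t" for s
    proof -
      have "exp (k * (s - t)) \<le> 1" using \<open>\<not> k > 0\<close> that by (simp add: mult_nonpos_nonneg)
      then have "F t * exp (k * (s - t)) \<le> F t * 1" using t by (intro mult_left_mono) auto
      then show ?thesis using k[of s] by linarith
    qed
    then have "eventually (\<lambda>s. F s \<le> F t) at_top" by (auto simp: eventually_at_top_linorder)
    then have "1 \<le> F t" using lim by (intro tendsto_upperbound[OF lim]) auto
    then show False using t by simp
  qed
  have hk: "h = - (F t * k / (1 - F t))" using e t by (simp add: field_simps)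
  show ?thesis
  proof (rule that[of "F t * k"])
    show "0 < F t * k" using t \<open>k > 0\<close> by simp
    show "(F has_real_derivative F t * k) (at t)" by (rule d)
    show "F s \<le> F t * exp (F t * k / F t * (s - t))" for s using k[of s] t by simp
    show "1 - F s \<le> (1 - F t) * exp (- (F t * k / (1 - F t)) * (s - t))" for s
      using h[of s] unfolding hk .
  qed
qed

text \<open>The right side exceeds the third Taylor polynomial because the difference vanishes at 0
  and has derivative \<open>x ^ 3 / (1 - x)\<close>.\<close>

lemma neg_ln_one_minus_lower:
  fixes p :: real
  assumes "0 \<le> p" "p < 1"
  shows "p + p\<^sup>2 / 2 + p ^ 3 / 3 \<le> - ln (1 - p)"
proof -
  have "- ln (1 - 0) - (0 + 0\<^sup>2 / 2 + 0 ^ 3 / 3) \<le> - ln (1 - p) - (p + p\<^sup>2 / 2 + p ^ 3 / (3::real))"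
  proof (rule DERIV_nonneg_imp_nondecreasing[OF assms(1)])
    fix x :: real assume x: "0 \<le> x" "x \<le> p"
    then have x1: "x < 1" using assms by simp
    have "((\<lambda>p. - ln (1 - p) - (p + p\<^sup>2 / 2 + p ^ 3 / 3)) has_real_derivative 1 / (1 - x) - (1 + x + x\<^sup>2)) (at x)"
      using x1 by (auto intro!: derivative_eq_intros simp: power2_eq_square field_simps)
    moreover have "1 / (1 - x) - (1 + x + x\<^sup>2) = x ^ 3 / (1 - x)"
      using x1 by (simp add: field_simps power2_eq_square power3_eq_cube)
    ultimately show "\<exists>y. ((\<lambda>p. - ln (1 - p) - (p + p\<^sup>2 / 2 + p ^ 3 / 3)) has_real_derivative y) (at x) \<and> 0 \<le> y"
      using x x1 by auto
  qed
  then show ?thesis by simp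
qed

text \<open>This is what remains of the differential inequality once the three parts of the integral
  are added up, with \<open>p\<close> the mass of the tail. The cubic Taylor bound leaves the factor
  \<open>(1 - p) * (1 / 2 + p / 3)\<close>, which is at least 1/3 up to \<open>p = 1 / 2\<close>,
  and \<open>1 - ln 2\<close> is at most 1/3.\<close>

lemma half_mass_numeric:
  fixes p :: real
  assumes "0 < p" "p \<le> 1 / 2"
  shows "p\<^sup>2 * (1 - ln 2) \<le> (1 - p) * (- ln (1 - p) - p)"
proof -
  have a: "1 / 3 \<le> (1 - p) * (1 / 2 + p / 3)"
  proof -
    have "(1 - p) * (1 / 2 + p / 3) - 1 / 3 = (1 / 2 - p) * (p + 1) / 3"
      by (simp add: field_simps)
    moreover have "0 \<le> (1 / 2 - p) * (p + 1) / 3" using assms by simp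
    ultimately show ?thesis by linarith
  qed
  have "p\<^sup>2 * (1 - ln 2) \<le> p\<^sup>2 * (1 / 3)"
    using ln2_ge_two_thirds by (intro mult_left_mono) auto
  also have "\<dots> \<le> p\<^sup>2 * ((1 - p) * (1 / 2 + p / 3))"
    using a by (intro mult_left_mono) auto
  also have "\<dots> = (1 - p) * (p\<^sup>2 / 2 + p ^ 3 / 3)"
    by (simp add: field_simps power2_eq_square power3_eq_cube)
  also have "\<dots> \<le> (1 - p) * (- ln (1 - p) - p)"
    using neg_ln_one_minus_lower[of p] assms by (intro mult_left_mono) auto
  finally show ?thesis .
qed

text \<open>The integral is bounded below on three intervals around the median \<open>m\<close> and
  the point \<open>t\<close>. Left of \<open>m\<close> the minimum is \<open>F\<close>, and the
  tangent of \<open>1 - F\<close> at \<open>m\<close>, taken with the larger rate \<open>h\<close>,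
  bounds it below. Between \<open>m\<close> and \<open>t\<close> it is \<open>1 - F\<close>, which
  is at least \<open>F' / h\<close>. Right of \<open>t\<close> the tangent of \<open>F\<close>
  bounds \<open>1 - F\<close> below. Multiplied by \<open>r = h * p = k * q\<close>, the sum depends
  on \<open>p\<close> alone.\<close>

lemma min_tail_integral_upper_half:
  fixes F :: "real \<Rightarrow> real"
  assumes F: "log_concave F" and G: "log_concave (\<lambda>s. 1 - F s)" and cont: "continuous_on UNIV F"
    and mono: "mono F" and lim: "(F \<longlongrightarrow> 1) at_top" "(F \<longlongrightarrow> 0) at_bot"
    and t: "1 / 2 \<le> F t" "F t < 1"
  obtains a b r where "a \<le> b" "0 < r" "(F has_real_derivative r) (at t)"
    "ln 2 * (F t * (1 - F t)) \<le> r * integral {a..b} (\<lambda>s. min (F s) (1 - F s))"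
proof -
  define p q where "p = 1 - F t" and "q = F t"
  have pq: "0 < p" "p \<le> 1 / 2" "1 / 2 \<le> q" "q < 1" "q = 1 - p" using t by (auto simp: p_def q_def)
  have cF: "isCont F s" for s using cont by (simp add: continuous_on_eq_continuous_at)
  obtain r where r: "0 < r" "(F has_real_derivative r) (at t)"
      "\<And>s. F s \<le> F t * exp (r / F t * (s - t))"
      "\<And>s. 1 - F s \<le> (1 - F t) * exp (- (r / (1 - F t)) * (s - t))"
    using log_concave_cdf_tangent[OF F G cF _ t(2) lim(1)] t by auto
  \<comment> \<open>\<open>h\<close> is the hazard rate at \<open>t\<close>; log-concavity of \<open>1 - F\<close> makes it a bound for all earlier hazard rates.\<close>
  define h k where "h = r / p" and "k = r / q"
  have hk: "h > 0" "k > 0" using r(1) pq by (auto simp: h_def k_def)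
  have "\<forall>\<^sub>F s in at_bot. F s < 1 / 2" using lim(2) by (rule order_tendstoD) simp
  then obtain s0 where s0: "\<And>s. s \<le> s0 \<Longrightarrow> F s < 1 / 2" by (auto simp: eventually_at_bot_linorder)
  have "s0 \<le> t" using s0[of t] t by linarith
  then obtain m where m: "m \<le> t" "F m = 1 / 2"
    using IVT[of F s0 "1/2" t] s0[of s0] t cF by auto
  have haz: "deriv F s \<le> h * (1 - F s) \<and> (F has_real_derivative deriv F s) (at s) \<and>
      (\<forall>x\<le>s. 1 - F x \<le> (1 - F s) * exp (h * (s - x)))" if "m \<le> s" "s \<le> t" for s
  proof -
    have Fs: "0 < F s" "F s < 1" "F s \<le> F t"
      using monoD[OF mono that(1)] monoD[OF mono that(2)] m(2) t by auto
    obtain r' where r': "0 < r'" "(F has_real_derivative r') (at s)"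
      "\<And>x. 1 - F x \<le> (1 - F s) * exp (- (r' / (1 - F s)) * (x - s))"
      using log_concave_cdf_tangent[OF F G cF Fs(1,2) lim(1)] by metis
    have d: "deriv F s = r'" using r'(2) by (rule DERIV_imp_deriv)
    have le: "r' / (1 - F s) \<le> h"
    proof (cases "s = t")
      case True
      then show ?thesis using r'(2) r(2) DERIV_unique by (force simp: h_def p_def)
    next
      case False
      then have "s < t" using that by simp
      have "1 - F t \<le> (1 - F s) * exp (- (r' / (1 - F s)) * (t - s))" by (rule r'(3))
      \<comment> \<open>The tangent at \<open>s\<close> is evaluated at \<open>t\<close> and the
        tangent at \<open>t\<close> at \<open>s\<close>. Chaining the two estimates compares the
        rates.\<close>
      also have "\<dots> \<le> ((1 - F t) * exp (- h * (s - t))) * exp (- (r' / (1 - F s)) * (t - s))"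
        using r(4)[of s] by (intro mult_right_mono) (auto simp: h_def p_def)
      also have "\<dots> = (1 - F t) * exp ((h - r' / (1 - F s)) * (t - s))"
        by (simp add: exp_add[symmetric] algebra_simps)
      finally have "0 \<le> (h - r' / (1 - F s)) * (t - s)" using t by simp
      then show ?thesis using \<open>s < t\<close> by (simp add: zero_le_mult_iff)
    qed
    have "1 - F x \<le> (1 - F s) * exp (h * (s - x))" if "x \<le> s" for x
    proof -
      have "- w * (x - s) = w * (s - x)" for w :: real by (simp add: algebra_simps)
      then have "- (r' / (1 - F s)) * (x - s) = r' / (1 - F s) * (s - x)" .
      also have "\<dots> \<le> h * (s - x)" using le that by (intro mult_right_mono) auto
      finally have "(1 - F s) * exp (- (r' / (1 - F s)) * (x - s)) \<le> (1 - F s) * exp (h * (s - x))"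
        using Fs by (intro mult_left_mono) auto
      then show ?thesis using r'(3)[of x] by linarith
    qed
    moreover have "r' \<le> h * (1 - F s)" using le Fs by (simp add: field_simps)
    ultimately show ?thesis using r'(2) d by auto
  qed
  \<comment> \<open>At \<open>a\<close> and \<open>b\<close> the two exponential lower bounds for
    the minimum reach 0; beyond them they carry no information.\<close>
  define a where "a = m - ln 2 / h"
  define b where "b = t - ln q / k"
  define \<mu> where "\<mu> = (\<lambda>s. min (F s) (1 - F s))"
  have ab: "a \<le> m" "t \<le> b" using hk pq by (auto simp: a_def b_def divide_nonpos_pos)
  have int: "\<mu> integrable_on {x..y}" for x y
    unfolding \<mu>_def by (intro integrable_continuous_interval continuous_intros continuous_on_subset[OF cont]) auto
  have I1: "(ln 2 - 1 / 2) / h \<le> integral {a..m} \<mu>"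
  proof -
    have "((\<lambda>s. 1 - exp (h * (m - s)) / 2) has_integral
        (m + exp (h * (m - m)) / (2 * h)) - (a + exp (h * (m - a)) / (2 * h))) {a..m}"
      using hk ab by (intro fundamental_theorem_of_calculus)
        (auto intro!: derivative_eq_intros simp flip: has_real_derivative_iff_has_vector_derivative)
    moreover have "(m + exp (h * (m - m)) / (2 * h)) - (a + exp (h * (m - a)) / (2 * h)) = (ln 2 - 1 / 2) / h"
      using hk by (simp add: a_def field_simps)
    ultimately have "((\<lambda>s. 1 - exp (h * (m - s)) / 2) has_integral (ln 2 - 1 / 2) / h) {a..m}" by simp
    moreover have "1 - exp (h * (m - s)) / 2 \<le> \<mu> s" if "s \<in> {a..m}" for s
    proof -
      have "1 - F s \<le> (1 - F m) * exp (h * (m - s))" using haz[of m, THEN conjunct2, THEN conjunct2] m(1) that by simp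
      moreover have "F s \<le> 1 / 2" using monoD[OF mono, of s m] that m by auto
      moreover have "1 \<le> exp (h * (m - s))" using hk that by auto
      ultimately show ?thesis using m by (auto simp: \<mu>_def)
    qed
    ultimately show ?thesis by (rule has_integral_le[OF _ integrable_integral[OF int]])
  qed
  have I2: "(1 / 2 - p) / h \<le> integral {m..t} \<mu>"
  proof -
    have "(deriv F has_integral F t - F m) {m..t}"
      using m haz by (intro fundamental_theorem_of_calculus)
        (auto simp flip: has_real_derivative_iff_has_vector_derivative intro: has_field_derivative_at_within)
    then have "((\<lambda>s. deriv F s / h) has_integral (F t - F m) / h) {m..t}"
      by (rule has_integral_divide)
    moreover have "deriv F s / h \<le> \<mu> s" if "s \<in> {m..t}" for s
    proof -
      have "1 / 2 \<le> F s" using monoD[OF mono, of m s] that m by auto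
      then have "\<mu> s = 1 - F s" by (auto simp: \<mu>_def)
      then have "deriv F s \<le> \<mu> s * h" using haz[of s] that by (simp add: mult.commute)
      then show ?thesis using hk by (simp add: divide_le_eq)
    qed
    ultimately have "(F t - F m) / h \<le> integral {m..t} \<mu>" by (rule has_integral_le[OF _ integrable_integral[OF int]])
    then show ?thesis using m by (simp add: p_def)
  qed
  have I3: "(- ln q - p) / k \<le> integral {t..b} \<mu>"
  proof -
    have "((\<lambda>s. 1 - q * exp (k * (s - t))) has_integral
        (b - q * exp (k * (b - t)) / k) - (t - q * exp (k * (t - t)) / k)) {t..b}"
      using hk ab by (intro fundamental_theorem_of_calculus)
        (auto intro!: derivative_eq_intros simp flip: has_real_derivative_iff_has_vector_derivative)
    moreover have "(b - q * exp (k * (b - t)) / k) - (t - q * exp (k * (t - t)) / k) = (- ln q - p) / k"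
    proof -
      have "exp (k * (b - t)) = 1 / q" using hk pq by (simp add: b_def exp_minus inverse_eq_divide)
      moreover have "1 - q = p" using pq by simp
      then have "p / k = 1 / k - q / k" by (metis diff_divide_distrib)
      ultimately show ?thesis using pq by (simp add: b_def diff_divide_distrib)
    qed
    ultimately have "((\<lambda>s. 1 - q * exp (k * (s - t))) has_integral (- ln q - p) / k) {t..b}" by simp
    moreover have "1 - q * exp (k * (s - t)) \<le> \<mu> s" if "s \<in> {t..b}" for s
    proof -
      have "F s \<le> q * exp (k * (s - t))" using r(3)[of s] by (simp add: k_def q_def)
      moreover have "q \<le> F s" using monoD[OF mono, of t s] that by (auto simp: q_def)
      moreover have "q * 1 \<le> q * exp (k * (s - t))" using hk pq that by (intro mult_left_mono) auto
      ultimately show ?thesis using pq by (auto simp: \<mu>_def)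
    qed
    ultimately show ?thesis by (rule has_integral_le[OF _ integrable_integral[OF int]])
  qed
  have "integral {a..b} \<mu> = integral {a..m} \<mu> + integral {m..t} \<mu> + integral {t..b} \<mu>"
    using Henstock_Kurzweil_Integration.integral_combine[OF _ _ int, of a m b]
      Henstock_Kurzweil_Integration.integral_combine[OF _ _ int, of m t b] ab m by auto
  then have I: "(ln 2 - 1 / 2) / h + (1 / 2 - p) / h + (- ln q - p) / k \<le> integral {a..b} \<mu>"
    using I1 I2 I3 by linarith
  have "ln 2 * (q * p) = p * (ln 2 - p) + p\<^sup>2 * (1 - ln 2)"
    by (simp add: pq(5) algebra_simps power2_eq_square)
  also have "\<dots> \<le> p * (ln 2 - p) + q * (- ln q - p)"
    using half_mass_numeric[OF pq(1,2)] pq(5) by simp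
  also have "\<dots> = r * ((ln 2 - 1 / 2) / h + (1 / 2 - p) / h + (- ln q - p) / k)"
    using r(1) pq by (simp add: h_def k_def field_simps)
  also have "\<dots> \<le> r * integral {a..b} \<mu>" using I r(1) by (intro mult_left_mono) auto
  finally have "ln 2 * (F t * (1 - F t)) \<le> r * integral {a..b} \<mu>" by (simp add: p_def q_def)
  then show ?thesis using that[of a b r] ab m r(1,2) by (auto simp: \<mu>_def)
qed

lemma log_concave_reflect: "log_concave \<phi> \<Longrightarrow> log_concave (\<lambda>s. \<phi> (- s))"
proof (unfold log_concave_def, safe)
  fix x y l :: real
  assume "\<forall>x y. \<forall>l\<in>{0..1}. \<phi> x powr (1 - l) * \<phi> y powr l \<le> \<phi> ((1 - l) * x + l * y)" "l \<in> {0..1}"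
  then have "\<phi> (-x) powr (1 - l) * \<phi> (-y) powr l \<le> \<phi> ((1 - l) * (-x) + l * (-y))" by blast
  then show "\<phi> (-x) powr (1 - l) * \<phi> (-y) powr l \<le> \<phi> (- ((1 - l) * x + l * y))"
    by (simp add: algebra_simps)
qed simp

text \<open>Below the median the argument is applied to the reflected distribution \<open>H\<close>:
  reflection exchanges the two tails, hence also the two log-concavity hypotheses.\<close>

lemma min_tail_integral:
  fixes F :: "real \<Rightarrow> real"
  assumes F: "log_concave F" and G: "log_concave (\<lambda>s. 1 - F s)" and cont: "continuous_on UNIV F"
    and mono: "mono F" and lim: "(F \<longlongrightarrow> 1) at_top" "(F \<longlongrightarrow> 0) at_bot"
    and t: "0 < F t" "F t < 1"
  obtains a b r where "a \<le> b" "0 < r" "(F has_real_derivative r) (at t)"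
    "ln 2 * (F t * (1 - F t)) \<le> r * integral {a..b} (\<lambda>s. min (F s) (1 - F s))"
proof (cases "1 / 2 \<le> F t")
  case True
  then show ?thesis using min_tail_integral_upper_half[OF F G cont mono lim True t(2)] that by metis
next
  case False
  define H where "H = (\<lambda>s. 1 - F (- s))"
  have H: "log_concave H" "log_concave (\<lambda>s. 1 - H s)" "continuous_on UNIV H"
    unfolding H_def using log_concave_reflect[OF G] log_concave_reflect[OF F]
    by (auto intro!: continuous_intros continuous_on_compose2[OF cont])
  have H2: "mono H" using mono by (auto simp: H_def mono_def)
  have "((\<lambda>s. F (- s)) \<longlongrightarrow> 0) at_top" "((\<lambda>s. F (- s)) \<longlongrightarrow> 1) at_bot"
    using lim by (auto intro: filterlim_compose filterlim_uminus_at_bot_at_top filterlim_uminus_at_top_at_bot)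
  then have H3: "(H \<longlongrightarrow> 1) at_top" "(H \<longlongrightarrow> 0) at_bot"
    unfolding H_def by (auto intro!: tendsto_eq_intros)
  obtain a b r where r: "a \<le> b" "0 < r" "(H has_real_derivative r) (at (- t))"
    "ln 2 * (H (- t) * (1 - H (- t))) \<le> r * integral {a..b} (\<lambda>s. min (H s) (1 - H s))"
    using min_tail_integral_upper_half[OF H H2 H3, of "- t"] False t by (auto simp: H_def)
  have "((\<lambda>s. 1 - H (- s)) has_real_derivative r) (at t)"
    using r(3) by (auto intro!: derivative_eq_intros DERIV_chain'[of uminus _ _ _ H])
  then have d: "(F has_real_derivative r) (at t)" by (simp add: H_def)
  have "integral {- b..- a} (\<lambda>s. min (F s) (1 - F s)) = integral {a..b} (\<lambda>s. min (F (- s)) (1 - F (- s)))"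
    using Henstock_Kurzweil_Integration.integral_reflect_real[of b a "\<lambda>s. min (F (- s)) (1 - F (- s))"] by simp
  also have "\<dots> = integral {a..b} (\<lambda>s. min (H s) (1 - H s))"
    by (intro integral_cong) (auto simp: H_def)
  finally show ?thesis using that[of "-b" "-a" r] r d by (auto simp: H_def mult.commute)
qed

section \<open>The one-dimensional inequality\<close>

context finite_borel_measure
begin

text \<open>Layer cake: \<bar>x - c\<bar> is the length of the set of \<open>t\<close> between
  \<open>c\<close> and \<open>x\<close>. For \<open>t\<close> beyond \<open>c\<close> on either
  side, the points \<open>x\<close> that count form the whole tail cut off at \<open>t\<close>,
  which has at least the smaller of the two masses.\<close>

lemma nn_integral_dist_ge_tails:
  "(\<integral>\<^sup>+t. min (emeasure M {..t}) (emeasure M {t..}) \<partial>lborel) \<le> (\<integral>\<^sup>+x. ennreal \<bar>x - c\<bar> \<partial>M)"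
proof -
  interpret P: pair_sigma_finite M lborel ..
  have [measurable_cong]: "sets M = sets borel" by (rule M_is_borel)
  have "(\<integral>\<^sup>+t. min (emeasure M {..t}) (emeasure M {t..}) \<partial>lborel)
      \<le> (\<integral>\<^sup>+t. (\<integral>\<^sup>+x. (if c \<le> t \<and> t \<le> x \<or> x \<le> t \<and> t \<le> c then 1 else 0) \<partial>M) \<partial>lborel)"
  proof (rule nn_integral_mono)
    fix t
    show "min (emeasure M {..t}) (emeasure M {t..}) \<le> (\<integral>\<^sup>+x. (if c \<le> t \<and> t \<le> x \<or> x \<le> t \<and> t \<le> c then 1 else 0) \<partial>M)"
    proof (cases "c \<le> t")
      case True
      have "emeasure M {t..} = (\<integral>\<^sup>+x. indicator {t..} x \<partial>M)" by (simp add: M_is_borel)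
      also have "\<dots> \<le> (\<integral>\<^sup>+x. (if c \<le> t \<and> t \<le> x \<or> x \<le> t \<and> t \<le> c then 1 else 0) \<partial>M)"
        using True by (intro nn_integral_mono) (auto simp: indicator_def)
      finally show ?thesis by (simp add: min.coboundedI2)
    next
      case False
      have "emeasure M {..t} = (\<integral>\<^sup>+x. indicator {..t} x \<partial>M)" by (simp add: M_is_borel)
      also have "\<dots> \<le> (\<integral>\<^sup>+x. (if c \<le> t \<and> t \<le> x \<or> x \<le> t \<and> t \<le> c then 1 else 0) \<partial>M)"
        using False by (intro nn_integral_mono) (auto simp: indicator_def)
      finally show ?thesis by (simp add: min.coboundedI1)
    qed
  qed
  also have "\<dots> = (\<integral>\<^sup>+x. (\<integral>\<^sup>+t. (if c \<le> t \<and> t \<le> x \<or> x \<le> t \<and> t \<le> c then 1 else 0) \<partial>lborel) \<partial>M)"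
    by (rule P.Fubini') measurable
  also have "\<dots> = (\<integral>\<^sup>+x. ennreal \<bar>x - c\<bar> \<partial>M)"
  proof (rule nn_integral_cong)
    fix x
    have "(\<integral>\<^sup>+t. (if c \<le> t \<and> t \<le> x \<or> x \<le> t \<and> t \<le> c then 1 else 0) \<partial>lborel)
        = (\<integral>\<^sup>+t. indicator {min c x..max c x} t \<partial>lborel)"
      by (intro nn_integral_cong) (auto simp: indicator_def)
    also have "\<dots> = ennreal (max c x - min c x)" by simp
    also have "max c x - min c x = \<bar>x - c\<bar>" by auto
    finally show "(\<integral>\<^sup>+t. (if c \<le> t \<and> t \<le> x \<or> x \<le> t \<and> t \<le> c then 1 else 0) \<partial>lborel) = ennreal \<bar>x - c\<bar>" .
  qed
  finally show ?thesis .
qed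

text \<open>For fixed \<open>t\<close>, the conditions on \<open>x\<close> and \<open>y\<close> are
  independent, so the double integral over pairs factors into the two tails. This is the source of
  the weight \<open>F * (1 - F)\<close>.\<close>

lemma nn_integral_pair_between:
  assumes [measurable]: "f \<in> borel_measurable borel"
  shows "(\<integral>\<^sup>+x. \<integral>\<^sup>+y. \<integral>\<^sup>+t. (if x \<le> t \<and> t \<le> y then f t else 0) \<partial>lborel \<partial>M \<partial>M)
       = (\<integral>\<^sup>+t. f t * (emeasure M {..t} * emeasure M {t..}) \<partial>lborel)"
proof -
  interpret P: pair_sigma_finite M lborel ..
  have [measurable_cong]: "sets M = sets borel" by (rule M_is_borel)
  have "(\<integral>\<^sup>+x. \<integral>\<^sup>+y. \<integral>\<^sup>+t. (if x \<le> t \<and> t \<le> y then f t else 0) \<partial>lborel \<partial>M \<partial>M)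
     = (\<integral>\<^sup>+x. \<integral>\<^sup>+t. \<integral>\<^sup>+y. (if x \<le> t \<and> t \<le> y then f t else 0) \<partial>M \<partial>lborel \<partial>M)"
    by (intro nn_integral_cong P.Fubini'[symmetric]) measurable
  also have "\<dots> = (\<integral>\<^sup>+t. \<integral>\<^sup>+x. \<integral>\<^sup>+y. (if x \<le> t \<and> t \<le> y then f t else 0) \<partial>M \<partial>M \<partial>lborel)"
    by (intro P.Fubini'[symmetric]) measurable
  also have "\<dots> = (\<integral>\<^sup>+t. f t * (emeasure M {..t} * emeasure M {t..}) \<partial>lborel)"
  proof (rule nn_integral_cong)
    fix t
    have "(\<integral>\<^sup>+x. \<integral>\<^sup>+y. (if x \<le> t \<and> t \<le> y then f t else 0) \<partial>M \<partial>M)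
      = (\<integral>\<^sup>+x. \<integral>\<^sup>+y. (f t * indicator {..t} x) * indicator {t..} y \<partial>M \<partial>M)"
      by (intro nn_integral_cong) (auto simp: indicator_def)
    also have "\<dots> = (\<integral>\<^sup>+x. (f t * emeasure M {t..}) * indicator {..t} x \<partial>M)"
      by (intro nn_integral_cong) (subst nn_integral_cmult, simp_all add: M_is_borel mult_ac)
    also have "\<dots> = f t * (emeasure M {..t} * emeasure M {t..})"
      by (subst nn_integral_cmult) (simp_all add: M_is_borel mult_ac)
    finally show "(\<integral>\<^sup>+x. \<integral>\<^sup>+y. (if x \<le> t \<and> t \<le> y then f t else 0) \<partial>M \<partial>M)
       = f t * (emeasure M {..t} * emeasure M {t..})" .
  qed
  finally show ?thesis .
qed

end

text \<open>The estimate with slack \<open>e\<close> adds up over adjacent intervals and holds on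
  short intervals around each point, so the bisection principle \<open>Bolzano\<close> extends it to
  the whole interval. The one-sided local condition also covers points where the function has no
  derivative.\<close>

lemma nondecreasing_of_lower_slope:
  fixes \<phi> :: "real \<Rightarrow> real"
  assumes ab: "a \<le> b"
    and slope: "\<And>x e. a \<le> x \<Longrightarrow> x \<le> b \<Longrightarrow> 0 < e \<Longrightarrow>
      \<exists>d>0. \<forall>u v. a \<le> u \<and> u \<le> x \<and> x \<le> v \<and> v \<le> b \<and> v - u < d \<longrightarrow> - e * (v - u) \<le> \<phi> v - \<phi> u"
  shows "\<phi> a \<le> \<phi> b"
proof (rule field_le_epsilon)
  fix e0 :: real assume "0 < e0"
  define e where "e = e0 / (b - a + 1)"
  have e: "0 < e" using \<open>0 < e0\<close> ab by (simp add: e_def)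
  have "a \<le> a \<and> b \<le> b \<longrightarrow> - e * (b - a) \<le> \<phi> b - \<phi> a"
    using ab
  proof (induction rule: Bolzano[where P = "\<lambda>u v. a \<le> u \<and> v \<le> b \<longrightarrow> - e * (v - u) \<le> \<phi> v - \<phi> u"])
    case (trans x y z)
    then show ?case by (auto simp: algebra_simps)
  next
    case (local x)
    obtain d where "0 < d" "\<And>u v. a \<le> u \<and> u \<le> x \<and> x \<le> v \<and> v \<le> b \<and> v - u < d \<Longrightarrow> - e * (v - u) \<le> \<phi> v - \<phi> u"
      using slope[OF local e] by blast
    then show ?case by (intro exI[of _ d]) auto
  qed
  then have "\<phi> a \<le> \<phi> b + e * (b - a)" by simp
  also have "e * (b - a) \<le> e * (b - a + 1)" using e by (intro mult_left_mono) auto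
  also have "e * (b - a + 1) = e0" using ab by (simp add: e_def)
  finally show "\<phi> a \<le> \<phi> b + e0" by simp
qed

lemma has_real_derivative_straddle:
  fixes \<phi> :: "real \<Rightarrow> real"
  assumes "(\<phi> has_real_derivative D) (at x within {a..b})" "0 < e"
  shows "\<exists>d>0. \<forall>u v. a \<le> u \<and> u \<le> x \<and> x \<le> v \<and> v \<le> b \<and> v - u < d \<longrightarrow>
    \<bar>\<phi> v - \<phi> u - D * (v - u)\<bar> \<le> e * (v - u)"
proof -
  obtain d where d: "d > 0"
    "\<And>y. y \<in> {a..b} \<Longrightarrow> \<bar>y - x\<bar> < d \<Longrightarrow> \<bar>\<phi> y - \<phi> x - D * (y - x)\<bar> \<le> e * \<bar>y - x\<bar>"
    using assms unfolding has_field_derivative_def has_derivative_within_alt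
    by (auto simp: real_norm_def)
  have "\<bar>\<phi> v - \<phi> u - D * (v - u)\<bar> \<le> e * (v - u)"
    if "a \<le> u" "u \<le> x" "x \<le> v" "v \<le> b" "v - u < d" for u v
  proof -
    have "\<bar>\<phi> v - \<phi> x - D * (v - x)\<bar> \<le> e * \<bar>v - x\<bar>"
      by (rule d(2)) (use that in auto)
    moreover have "\<bar>\<phi> u - \<phi> x - D * (u - x)\<bar> \<le> e * \<bar>u - x\<bar>"
      by (rule d(2)) (use that in auto)
    moreover have "\<bar>v - x\<bar> = v - x" "\<bar>u - x\<bar> = x - u" using that by auto
    ultimately have "\<bar>\<phi> v - \<phi> x - D * (v - x)\<bar> \<le> e * (v - x)" "\<bar>\<phi> u - \<phi> x - D * (u - x)\<bar> \<le> e * (x - u)"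
      by simp_all
    moreover have "D * (v - u) = D * (v - x) - D * (u - x)" "e * (v - u) = e * (v - x) + e * (x - u)"
      by (simp_all add: algebra_simps)
    ultimately show ?thesis by linarith
  qed
  then show ?thesis using d(1) by blast
qed

lemma nn_integral_interval_continuous:
  fixes f :: "real \<Rightarrow> real"
  assumes "continuous_on UNIV f" "\<And>x. 0 \<le> f x"
  shows "(\<integral>\<^sup>+x. ennreal (f x) * indicator {a..b} x \<partial>lborel) = ennreal (integral {a..b} f)"
  using assms
  by (intro nn_integral_has_integral_lebesgue' integrable_integral integrable_continuous_interval)
    (auto intro: continuous_on_subset)

text \<open>An abstraction of the distribution of a linear coordinate on a convex body.
  Log-concavity is demanded of the two tails, the form in which Brunn-Minkowski delivers it; no
  density appears.\<close>

locale log_concave_needle = finite_borel_measure M for M :: "real measure" +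
  fixes R :: real
  assumes total: "measure M UNIV = 1"
    and atomless: "measure M {x} = 0"
    and lower: "log_concave (\<lambda>t. measure M {..t})"
    and upper: "log_concave (\<lambda>t. measure M {t..})"
    and supp: "AE x in M. x \<in> {- R..R}"
begin

lemma cdf_upper: "measure M {t..} = 1 - cdf M t"
proof -
  have "measure M {..t} = measure M ({..<t} \<union> {t})" by (simp only: ivl_disj_un)
  also have "\<dots> = measure M {..<t} + measure M {t}"
    using M_is_borel by (intro finite_measure_Union) auto
  finally have "measure M {..<t} = cdf M t" by (simp add: atomless cdf_def)
  moreover have "measure M {t..} = measure M (space M - {..<t})"
    by (rule arg_cong[where f = "measure M"]) (auto simp: borel_UNIV)
  ultimately show ?thesis using total M_is_borel
    by (subst (asm) finite_measure_compl) (auto simp: borel_UNIV)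
qed

lemma isCont_cdf': "isCont (cdf M) x"
  by (simp add: isCont_cdf atomless)

lemma continuous_on_cdf: "continuous_on A (cdf M)"
  by (simp add: isCont_cdf' continuous_at_imp_continuous_on)

lemma integrable_continuous:
  fixes f :: "real \<Rightarrow> real"
  assumes f: "continuous_on UNIV f"
  shows "integrable M f"
proof -
  have "compact (f ` {- R..R})" using f by (intro compact_continuous_image) (auto intro: continuous_on_subset)
  then obtain B where B: "\<And>x. x \<in> {- R..R} \<Longrightarrow> norm (f x) \<le> B"
    using compact_imp_bounded bounded_iff by (metis imageI)
  show ?thesis
  proof (rule integrable_const_bound)
    show "AE x in M. norm (f x) \<le> B" using supp by eventually_elim (rule B)
    show "f \<in> borel_measurable M"
      using borel_measurable_continuous_onI[OF f] M_is_borel by (simp cong: measurable_cong_sets)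
  qed
qed

lemma cdf_01: "0 \<le> cdf M t" "cdf M t \<le> 1"
  using cdf_nonneg[of t] cdf_bounded[of t] total by (auto simp: borel_UNIV)

lemma emeasure_tails: "emeasure M {..t} = ennreal (cdf M t)" "emeasure M {t..} = ennreal (1 - cdf M t)"
  using cdf_upper[of t] by (simp_all add: emeasure_eq_measure cdf_def)

lemma integral_min_tails_le: "integral {a..b} (\<lambda>s. min (cdf M s) (1 - cdf M s)) \<le> (\<integral>x. \<bar>x - c\<bar> \<partial>M)"
proof -
  have "ennreal (integral {a..b} (\<lambda>s. min (cdf M s) (1 - cdf M s)))
     = (\<integral>\<^sup>+x. ennreal (min (cdf M x) (1 - cdf M x)) * indicator {a..b} x \<partial>lborel)"
    using cdf_01 by (intro nn_integral_interval_continuous[symmetric])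
      (auto intro!: continuous_intros continuous_on_cdf)
  also have "\<dots> \<le> (\<integral>\<^sup>+t. min (emeasure M {..t}) (emeasure M {t..}) \<partial>lborel)"
    using cdf_01 by (intro nn_integral_mono) (auto simp: emeasure_tails indicator_def min_def)
  also have "\<dots> \<le> (\<integral>\<^sup>+x. ennreal \<bar>x - c\<bar> \<partial>M)" by (rule nn_integral_dist_ge_tails)
  also have "\<dots> = ennreal (\<integral>x. \<bar>x - c\<bar> \<partial>M)"
    by (intro nn_integral_eq_integral integrable_continuous) (auto intro!: continuous_intros)
  finally show ?thesis by (simp add: ennreal_le_iff)
qed

text \<open>With \<open>D\<close> the mean distance and \<open>W\<close> the primitive of
  \<open>F * (1 - F)\<close>, the function \<open>D * F - ln 2 * W\<close> is nondecreasing. Arguing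
  by monotonicity avoids having to recover the cdf as the integral of its derivative.\<close>

lemma cdf_interval_lower:
  assumes "s \<le> t"
  shows "ln 2 * integral {s..t} (\<lambda>x. cdf M x * (1 - cdf M x)) \<le> (\<integral>x. \<bar>x - c\<bar> \<partial>M) * (cdf M t - cdf M s)"
proof -
  define D where "D = (\<integral>x. \<bar>x - c\<bar> \<partial>M)"
  have D: "0 \<le> D" by (simp add: D_def)
  define w where "w = (\<lambda>x. cdf M x * (1 - cdf M x))"
  define W where "W = (\<lambda>x. integral {s..x} w)"
  have w: "continuous_on A w" for A unfolding w_def by (intro continuous_intros continuous_on_cdf)
  have W: "(W has_real_derivative w x) (at x within {s..t})" if "s \<le> x" "x \<le> t" for x
    unfolding W_def using that by (intro integral_has_real_derivative w) auto
  have upper': "log_concave (\<lambda>s. 1 - cdf M s)" using upper by (simp add: cdf_upper)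
  have lower': "log_concave (cdf M)" using lower by (simp add: cdf_def)
  have mono: "mono (cdf M)" by (simp add: mono_def cdf_nondecreasing)
  have "D * cdf M s - ln 2 * W s \<le> D * cdf M t - ln 2 * W t"
  proof (rule nondecreasing_of_lower_slope[OF assms])
    fix x e :: real assume x: "s \<le> x" "x \<le> t" and e: "0 < e"
    show "\<exists>d>0. \<forall>u v. s \<le> u \<and> u \<le> x \<and> x \<le> v \<and> v \<le> t \<and> v - u < d \<longrightarrow>
      - e * (v - u) \<le> D * cdf M v - ln 2 * W v - (D * cdf M u - ln 2 * W u)"
    proof (cases "0 < cdf M x \<and> cdf M x < 1")
      case True
      obtain a b r where abr: "0 < r" "(cdf M has_real_derivative r) (at x)"
          "ln 2 * (cdf M x * (1 - cdf M x)) \<le> r * integral {a..b} (\<lambda>s. min (cdf M s) (1 - cdf M s))"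
        using min_tail_integral[OF lower' upper' continuous_on_cdf mono _ cdf_lim_at_bot] True cdf_lim_at_top total
        by (metis borel_UNIV)
      have "r * integral {a..b} (\<lambda>s. min (cdf M s) (1 - cdf M s)) \<le> r * D"
        unfolding D_def using abr(1) by (intro mult_left_mono integral_min_tails_le) auto
      then have r: "0 \<le> D * r - ln 2 * w x" using abr(3) by (simp add: w_def mult.commute)
      have "((\<lambda>x. D * cdf M x - ln 2 * W x) has_real_derivative D * r - ln 2 * w x) (at x within {s..t})"
        by (intro DERIV_diff DERIV_cmult W[OF x] has_field_derivative_at_within[OF abr(2)])
      from has_real_derivative_straddle[OF this e] obtain d where d: "0 < d"
        "\<And>u v. s \<le> u \<and> u \<le> x \<and> x \<le> v \<and> v \<le> t \<and> v - u < d \<Longrightarrow>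
          \<bar>D * cdf M v - ln 2 * W v - (D * cdf M u - ln 2 * W u) - (D * r - ln 2 * w x) * (v - u)\<bar> \<le> e * (v - u)"
        by blast
      have "- e * (v - u) \<le> D * cdf M v - ln 2 * W v - (D * cdf M u - ln 2 * W u)"
        if "s \<le> u \<and> u \<le> x \<and> x \<le> v \<and> v \<le> t \<and> v - u < d" for u v
      proof -
        have "0 \<le> (D * r - ln 2 * w x) * (v - u)" using r that by (intro mult_nonneg_nonneg) auto
        then show ?thesis using d(2)[OF that] by (simp only: abs_le_iff) linarith
      qed
      then show ?thesis using d(1) by blast
    next
      case False
      \<comment> \<open>The cdf may fail to be differentiable here, as at an end of the support. The
        weight vanishes, however, so \<open>W\<close> is flat to first order and monotonicity of the
        cdf suffices.\<close>
      then have "w x = 0" using cdf_01[of x] by (auto simp: w_def)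
      from has_real_derivative_straddle[OF W[OF x] e] obtain d where d: "0 < d"
        "\<And>u v. s \<le> u \<and> u \<le> x \<and> x \<le> v \<and> v \<le> t \<and> v - u < d \<Longrightarrow> \<bar>W v - W u\<bar> \<le> e * (v - u)"
        unfolding \<open>w x = 0\<close> by auto
      have "- e * (v - u) \<le> D * cdf M v - ln 2 * W v - (D * cdf M u - ln 2 * W u)"
        if uv: "s \<le> u \<and> u \<le> x \<and> x \<le> v \<and> v \<le> t \<and> v - u < d" for u v
      proof -
        have "D * cdf M u \<le> D * cdf M v" using uv D by (intro mult_left_mono cdf_nondecreasing) auto
        moreover have "ln 2 * (W v - W u) \<le> ln 2 * \<bar>W v - W u\<bar>"
          by (intro mult_left_mono) auto
        moreover have "ln 2 * \<bar>W v - W u\<bar> \<le> 1 * \<bar>W v - W u\<bar>"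
          using ln_2_less_1 by (intro mult_right_mono) auto
        ultimately show ?thesis using d(2)[OF uv] by (simp add: algebra_simps)
      qed
      then show ?thesis using d(1) by blast
    qed
  qed
  moreover have "W s = 0" by (simp add: W_def)
  ultimately have "ln 2 * W t \<le> D * cdf M t - D * cdf M s" by simp
  then show ?thesis by (simp only: D_def W_def w_def right_diff_distrib)
qed

text \<open>A Riemann-Stieltjes argument passes from intervals to a continuous weight: on short
  intervals \<open>f\<close> is nearly constant and the interval estimate applies, and both sides
  add up over adjacent intervals.\<close>

lemma integral_cdf_weight_le:
  assumes f: "continuous_on UNIV f" "\<And>x. 0 \<le> f x"
  shows "ln 2 * integral {- R..R} (\<lambda>x. f x * (cdf M x * (1 - cdf M x)))
    \<le> (\<integral>x. \<bar>x - c\<bar> \<partial>M) * (\<integral>x. f x \<partial>M)"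
proof (cases "- R \<le> R")
  case False
  then show ?thesis using f by simp
next
  case R: True
  define D where "D = (\<integral>x. \<bar>x - c\<bar> \<partial>M)"
  have D: "0 \<le> D" by (simp add: D_def)
  define w where "w = (\<lambda>x. cdf M x * (1 - cdf M x))"
  have w: "continuous_on A w" for A unfolding w_def by (intro continuous_intros continuous_on_cdf)
  have w0: "0 \<le> w x" for x using cdf_01[of x] by (simp add: w_def)
  have fw: "(\<lambda>x. f x * w x) integrable_on {u..v}" for u v
    by (intro integrable_continuous_interval continuous_intros w continuous_on_subset[OF f(1)]) auto
  have "ln 2 * integral {- R..R} (\<lambda>x. f x * w x) \<le> D * (\<integral>x. f x \<partial>M) + e" if "0 < e" for e
  proof -
    define e' where "e' = e / (D + 1)"
    have e': "0 < e'" using that D by (simp add: e'_def)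
    \<comment> \<open>Half-open intervals abut without overlap, and their measure is a difference of
      two values of the cdf.\<close>
    have fi: "integrable M (\<lambda>x. (f x + e') * indicator {u<..v} x)" for u v
      using M_is_borel by (intro integrable_real_mult_indicator integrable_continuous continuous_intros f) auto
    have "ln 2 * integral {- R..R} (\<lambda>x. f x * w x) \<le> D * (\<integral>x. (f x + e') * indicator {- R<..R} x \<partial>M)"
      using R
    proof (induction rule: Bolzano)
      case (trans u v z)
      have "integral {u..z} (\<lambda>x. f x * w x) = integral {u..v} (\<lambda>x. f x * w x) + integral {v..z} (\<lambda>x. f x * w x)"
        using trans fw by (intro Henstock_Kurzweil_Integration.integral_combine[symmetric]) auto
      moreover have "(\<integral>x. (f x + e') * indicator {u<..z} x \<partial>M) =
          (\<integral>x. (f x + e') * indicator {u<..v} x + (f x + e') * indicator {v<..z} x \<partial>M)"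
        using trans by (intro Bochner_Integration.integral_cong) (auto simp: indicator_def)
      moreover have "\<dots> = (\<integral>x. (f x + e') * indicator {u<..v} x \<partial>M) + (\<integral>x. (f x + e') * indicator {v<..z} x \<partial>M)"
        by (intro Bochner_Integration.integral_add fi)
      ultimately show ?case using trans by (simp add: algebra_simps)
    next
      case (local x)
      have "isCont f x" using f(1) by (simp add: continuous_on_eq_continuous_at)
      then obtain d where d: "d > 0" "\<And>y. \<bar>y - x\<bar> < d \<Longrightarrow> \<bar>f y - f x\<bar> < e' / 2"
        using e' unfolding isCont_def LIM_eq by (metis diff_self abs_zero half_gt_zero real_norm_def)
      have "ln 2 * integral {u..v} (\<lambda>x. f x * w x) \<le> D * (\<integral>x. (f x + e') * indicator {u<..v} x \<partial>M)"
        if uv: "u \<le> x" "x \<le> v" "v - u < d" for u v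
      proof -
        \<comment> \<open>On the whole short interval this constant lies between \<open>f\<close>
          and \<open>f + e'\<close>, since \<open>f\<close> differs there from \<open>f x\<close> by
          less than \<open>e' / 2\<close>.\<close>
        define B where "B = f x + e' / 2"
        have B: "0 \<le> B" using f(2)[of x] e' by (simp add: B_def)
        have fB: "f y \<le> B" "B \<le> f y + e'" if "y \<in> {u..v}" for y
        proof -
          have "\<bar>y - x\<bar> < d" using that uv by (simp add: abs_less_iff)
          from d(2)[OF this] show "f y \<le> B" "B \<le> f y + e'" unfolding B_def by linarith+
        qed
        have "integral {u..v} (\<lambda>x. f x * w x) \<le> integral {u..v} (\<lambda>x. B * w x)"
          using fB w0 by (intro integral_le fw integrable_continuous_interval continuous_intros w mult_right_mono) auto
        then have "ln 2 * integral {u..v} (\<lambda>x. f x * w x) \<le> B * (ln 2 * integral {u..v} w)"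
          by simp
        also have "\<dots> \<le> B * (D * (cdf M v - cdf M u))"
          using cdf_interval_lower[of u v c] uv B unfolding D_def w_def by (intro mult_left_mono) auto
        also have "cdf M v - cdf M u = measure M {u<..v}"
          using uv cdf_diff_eq[of u v] by (cases "u = v") auto
        also have "B * (D * measure M {u<..v}) = D * (\<integral>x. B * indicator {u<..v} x \<partial>M)"
          by (simp add: M_is_borel)
        also have "\<dots> \<le> D * (\<integral>x. (f x + e') * indicator {u<..v} x \<partial>M)"
          using fB D M_is_borel
          by (intro mult_left_mono integral_mono fi integrable_real_mult_indicator) (auto simp: indicator_def)
        finally show ?thesis .
      qed
      then show ?case using d(1) by blast
    qed
    also have "\<dots> \<le> D * (\<integral>x. f x + e' \<partial>M)"
      using D f(2) e' by (intro mult_left_mono integral_mono fi integrable_continuous continuous_intros f(1))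
        (auto simp: indicator_def)
    also have "(\<integral>x. f x + e' \<partial>M) = (\<integral>x. f x \<partial>M) + e'"
      using total by (subst Bochner_Integration.integral_add) (auto intro!: integrable_continuous f simp: borel_UNIV)
    also have "D * ((\<integral>x. f x \<partial>M) + e') \<le> D * (\<integral>x. f x \<partial>M) + e"
      using D that by (simp add: e'_def field_simps)
    finally show ?thesis .
  qed
  then show ?thesis unfolding D_def w_def using field_le_epsilon by blast
qed

text \<open>In the application at most one of the two products on the left of \<open>between\<close> is nonzero, so the
  symmetrisation costs no factor 2.\<close>

lemma pair_integral_le:
  assumes f: "continuous_on UNIV f1" "continuous_on UNIV f2" "continuous_on UNIV f3"
    and nonneg: "\<And>x. 0 \<le> f1 x" "\<And>x. 0 \<le> f2 x" "\<And>x. 0 \<le> f3 x"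
    and between: "\<And>x y. x \<le> y \<Longrightarrow> f1 x * f2 y + f1 y * f2 x \<le> integral {x..y} f3"
  shows "(\<integral>x. f1 x \<partial>M) * (\<integral>x. f2 x \<partial>M) \<le> integral {- R..R} (\<lambda>x. f3 x * (cdf M x * (1 - cdf M x)))"
proof -
  define I1 I2 where "I1 = (\<integral>x. f1 x \<partial>M)" and "I2 = (\<integral>x. f2 x \<partial>M)"
  have I: "0 \<le> I1" "0 \<le> I2" using nonneg by (auto simp: I1_def I2_def)
  define w where "w = (\<lambda>x. cdf M x * (1 - cdf M x))"
  have w0: "0 \<le> w x" for x using cdf_01[of x] by (simp add: w_def)
  have w: "continuous_on A w" for A unfolding w_def by (intro continuous_intros continuous_on_cdf)
  have [measurable_cong]: "sets M = sets borel" by (rule M_is_borel)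
  define f where "f = (\<lambda>t. ennreal (f3 t) * indicator {- R..R} t)"
  have f3m[measurable]: "f3 \<in> borel_measurable borel" by (rule borel_measurable_continuous_onI[OF f(3)])
  have fm[measurable]: "f \<in> borel_measurable borel" unfolding f_def by measurable
  \<comment> \<open>\<open>K x y\<close> vanishes for \<open>y < x\<close>, so the sum
    \<open>K x y + K y x\<close> is the integral of \<open>f\<close> over the segment between the
    two points in whichever order they come.\<close>
  define K where "K = (\<lambda>x y. \<integral>\<^sup>+t. (if x \<le> t \<and> t \<le> y then f t else 0) \<partial>lborel)"
  have Km[measurable]: "case_prod K \<in> borel_measurable (M \<Otimes>\<^sub>M M)" unfolding K_def by measurable
  have K: "ennreal (f1 x * f2 y + f1 y * f2 x) \<le> K x y + K y x" if "x \<in> {- R..R}" "y \<in> {- R..R}" for x y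
  proof -
    have *: "ennreal (f1 x * f2 y + f1 y * f2 x) \<le> K x y" if "x \<in> {- R..R}" "y \<in> {- R..R}" "x \<le> y" for x y
    proof -
      have "K x y = (\<integral>\<^sup>+t. ennreal (f3 t) * indicator {x..y} t \<partial>lborel)"
        unfolding K_def f_def using that by (intro nn_integral_cong) (auto simp: indicator_def)
      also have "\<dots> = ennreal (integral {x..y} f3)"
        by (intro nn_integral_interval_continuous f nonneg)
      finally show ?thesis using between[OF that(3)] by (simp add: ennreal_leI)
    qed
    show ?thesis
    proof (cases "x \<le> y")
      case True
      then show ?thesis using *[of x y] that by (meson add_increasing2 order_trans zero_le)
    next
      case False
      then have "ennreal (f1 x * f2 y + f1 y * f2 x) \<le> K y x" using *[of y x] that by (simp add: add.commute)
      then show ?thesis by (meson add_increasing order_trans zero_le)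
    qed
  qed
  have inner: "(\<integral>\<^sup>+y. ennreal (f1 x * f2 y + f1 y * f2 x) \<partial>M) = ennreal (f1 x * I2 + I1 * f2 x)" for x
  proof -
    have "(\<integral>y. f1 x * f2 y + f1 y * f2 x \<partial>M) = f1 x * I2 + I1 * f2 x"
      unfolding I1_def I2_def
      by (subst Bochner_Integration.integral_add) (auto intro!: integrable_continuous continuous_intros f)
    then show ?thesis using nonneg
      by (subst nn_integral_eq_integral) (auto intro!: integrable_continuous continuous_intros f)
  qed
  have "ennreal (2 * (I1 * I2)) = (\<integral>\<^sup>+x. ennreal (f1 x * I2 + I1 * f2 x) \<partial>M)"
  proof -
    have "(\<integral>x. f1 x * I2 + I1 * f2 x \<partial>M) = 2 * (I1 * I2)"
      unfolding I1_def I2_def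
      by (subst Bochner_Integration.integral_add) (auto intro!: integrable_continuous continuous_intros f)
    then show ?thesis using nonneg I
      by (subst nn_integral_eq_integral) (auto intro!: integrable_continuous continuous_intros f)
  qed
  also have "\<dots> = (\<integral>\<^sup>+x. \<integral>\<^sup>+y. ennreal (f1 x * f2 y + f1 y * f2 x) \<partial>M \<partial>M)" by (simp add: inner)
  also have "\<dots> \<le> (\<integral>\<^sup>+x. \<integral>\<^sup>+y. K x y + K y x \<partial>M \<partial>M)"
  proof (rule nn_integral_mono_AE)
    show "AE x in M. (\<integral>\<^sup>+y. ennreal (f1 x * f2 y + f1 y * f2 x) \<partial>M) \<le> (\<integral>\<^sup>+y. K x y + K y x \<partial>M)"
      using supp
    proof eventually_elim
      case (elim x)
      show ?case using supp by (intro nn_integral_mono_AE) (rule eventually_mono, assumption, rule K[OF elim])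
    qed
  qed
  also have "\<dots> = (\<integral>\<^sup>+x. (\<integral>\<^sup>+y. K x y \<partial>M) + (\<integral>\<^sup>+y. K y x \<partial>M) \<partial>M)"
    by (intro nn_integral_cong nn_integral_add) measurable
  also have "\<dots> = (\<integral>\<^sup>+x. \<integral>\<^sup>+y. K x y \<partial>M \<partial>M) + (\<integral>\<^sup>+x. \<integral>\<^sup>+y. K y x \<partial>M \<partial>M)"
    by (intro nn_integral_add) measurable
  also have "(\<integral>\<^sup>+x. \<integral>\<^sup>+y. K y x \<partial>M \<partial>M) = (\<integral>\<^sup>+x. \<integral>\<^sup>+y. K x y \<partial>M \<partial>M)"
  proof -
    interpret P: pair_sigma_finite M M ..
    show ?thesis by (rule P.Fubini'[of K, OF Km])
  qed
  also have "(\<integral>\<^sup>+x. \<integral>\<^sup>+y. K x y \<partial>M \<partial>M) = (\<integral>\<^sup>+t. f t * (emeasure M {..t} * emeasure M {t..}) \<partial>lborel)"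
    unfolding K_def by (rule nn_integral_pair_between) measurable
  also have "\<dots> = (\<integral>\<^sup>+t. ennreal (f3 t * w t) * indicator {- R..R} t \<partial>lborel)"
    using nonneg cdf_01
    by (intro nn_integral_cong) (auto simp: emeasure_tails f_def w_def ennreal_mult indicator_def)
  also have "\<dots> = ennreal (integral {- R..R} (\<lambda>t. f3 t * w t))"
    using nonneg w0 by (intro nn_integral_interval_continuous continuous_intros f w) auto
  also have "\<dots> + \<dots> = ennreal (2 * integral {- R..R} (\<lambda>t. f3 t * w t))"
    using nonneg w0 by (subst ennreal_plus[symmetric])
      (auto intro!: Henstock_Kurzweil_Integration.integral_nonneg integrable_continuous_interval continuous_intros continuous_on_subset[OF f(3)] w)
  finally have "2 * (I1 * I2) \<le> 2 * integral {- R..R} (\<lambda>t. f3 t * w t)"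
    using nonneg w0 by (subst (asm) ennreal_le_iff)
      (auto intro!: Henstock_Kurzweil_Integration.integral_nonneg integrable_continuous_interval continuous_intros continuous_on_subset[OF f(3)] w)
  then show ?thesis by (simp add: I1_def I2_def w_def)
qed

text \<open>The integral of \<open>f3\<close> against \<open>F * (1 - F)\<close> is the intermediate
  quantity: integrating \<open>between\<close> over pairs bounds the left side by it, and the
  differential inequality for the cdf bounds it by the right side.\<close>

theorem needle_inequality:
  assumes "continuous_on UNIV f1" "continuous_on UNIV f2" "continuous_on UNIV f3"
    and "\<And>x. 0 \<le> f1 x" "\<And>x. 0 \<le> f2 x" "\<And>x. 0 \<le> f3 x"
    and "\<And>x y. x \<le> y \<Longrightarrow> f1 x * f2 y + f1 y * f2 x \<le> integral {x..y} f3"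
  shows "ln 2 * ((\<integral>x. f1 x \<partial>M) * (\<integral>x. f2 x \<partial>M)) \<le> (\<integral>x. f3 x \<partial>M) * (\<integral>x. \<bar>x - c\<bar> \<partial>M)"
proof -
  have "ln 2 * ((\<integral>x. f1 x \<partial>M) * (\<integral>x. f2 x \<partial>M))
      \<le> ln 2 * integral {- R..R} (\<lambda>x. f3 x * (cdf M x * (1 - cdf M x)))"
    by (intro mult_left_mono pair_integral_le assms) auto
  also have "\<dots> \<le> (\<integral>x. \<bar>x - c\<bar> \<partial>M) * (\<integral>x. f3 x \<partial>M)"
    by (rule integral_cdf_weight_le[OF assms(3,6)])
  finally show ?thesis by (simp add: mult.commute)
qed

end

section \<open>The Brunn-Minkowski inequality\<close>

definition proj_measure :: "'a::euclidean_space set \<Rightarrow> 'a \<Rightarrow> real measure" where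
  "proj_measure S e = distr (restrict_space lborel S) borel (\<lambda>x. x \<bullet> e)"

lemma hyperplane_null_lborel:
  fixes e :: "'a::euclidean_space"
  assumes "e \<noteq> 0"
  shows "{x. x \<bullet> e = t} \<in> null_sets lborel"
proof -
  have "closed {x. x \<bullet> e = t}" by (intro closed_Collect_eq continuous_intros)
  then show ?thesis
    using negligible_hyperplane[of e t] assms
    by (simp add: negligible_iff_null_sets null_sets_completion_iff inner_commute borel_closed)
qed

lemma emeasure_proj_measure:
  fixes e :: "'a::euclidean_space"
  assumes [measurable]: "S \<in> sets borel" "T \<in> sets borel"
  shows "emeasure (proj_measure S e) T = emeasure lborel {x \<in> S. x \<bullet> e \<in> T}"
proof -
  have "emeasure (proj_measure S e) T = emeasure (restrict_space lborel S) ((\<lambda>x. x \<bullet> e) -` T \<inter> space (restrict_space lborel S))"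
    unfolding proj_measure_def by (intro emeasure_distr measurable_restrict_space1) measurable
  also have "(\<lambda>x. x \<bullet> e) -` T \<inter> space (restrict_space lborel S) = {x \<in> S. x \<bullet> e \<in> T}"
    by (auto simp: space_restrict_space)
  finally show ?thesis by (simp add: emeasure_restrict_space)
qed

lemma measure_proj_measure:
  fixes e :: "'a::euclidean_space"
  assumes "S \<in> sets borel" "T \<in> sets borel"
  shows "measure (proj_measure S e) T = measure lborel {x \<in> S. x \<bullet> e \<in> T}"
  by (simp add: measure_def emeasure_proj_measure assms)

lemma finite_borel_proj_measure:
  fixes e :: "'a::euclidean_space"
  assumes "S \<in> sets borel" "emeasure lborel S < \<infinity>"
  shows "finite_borel_measure (proj_measure S e)"
proof -
  have "space (proj_measure S e) = UNIV" by (simp add: proj_measure_def)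
  then have "finite_measure (proj_measure S e)"
    using assms by (intro finite_measureI) (simp add: emeasure_proj_measure)
  moreover have "sets (proj_measure S e) = sets borel" by (simp add: proj_measure_def)
  ultimately show ?thesis
    by (simp add: finite_borel_measure_def finite_borel_measure_axioms_def)
qed

lemma proj_measure_atomless:
  fixes e :: "'a::euclidean_space"
  assumes "S \<in> sets borel" "e \<noteq> 0"
  shows "measure (proj_measure S e) {t} = 0"
proof -
  have "emeasure lborel {x \<in> S. x \<bullet> e \<in> {t}} \<le> emeasure lborel {x. x \<bullet> e = t}"
    using hyperplane_null_lborel[OF assms(2), of t] by (intro emeasure_mono) auto
  also have "\<dots> = 0" using hyperplane_null_lborel[OF assms(2), of t] by auto
  finally have "emeasure (proj_measure S e) {t} = 0" using assms by (simp add: emeasure_proj_measure)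
  then show ?thesis by (simp add: measure_def)
qed

lemma measure_halfspace_split:
  fixes e :: "'a::euclidean_space"
  assumes S: "S \<in> sets borel" "emeasure lborel S < \<infinity>" and e: "e \<noteq> 0"
  shows "measure lborel S = measure lborel {x \<in> S. x \<bullet> e < t} + measure lborel {x \<in> S. t < x \<bullet> e}"
    and "measure lborel {x \<in> S. x \<bullet> e < t} = measure lborel {x \<in> S. x \<bullet> e \<le> t}"
    and "measure lborel {x \<in> S. t < x \<bullet> e} = measure lborel {x \<in> S. t \<le> x \<bullet> e}"
proof -
  interpret P: finite_borel_measure "proj_measure S e" by (rule finite_borel_proj_measure[OF S])
  have *: "measure (proj_measure S e) (A \<union> B) = measure (proj_measure S e) A + measure (proj_measure S e) B"
    if "A \<in> sets borel" "B \<in> sets borel" "A \<inter> B = {}" for A B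
    using that P.M_is_borel by (intro P.finite_measure_Union) auto
  have 0: "measure (proj_measure S e) {t} = 0" by (rule proj_measure_atomless[OF S(1) e])
  show 2: "measure lborel {x \<in> S. x \<bullet> e < t} = measure lborel {x \<in> S. x \<bullet> e \<le> t}"
    using *[of "{..<t}" "{t}"] 0 unfolding ivl_disj_un by (simp add: measure_proj_measure S(1))
  show "measure lborel {x \<in> S. t < x \<bullet> e} = measure lborel {x \<in> S. t \<le> x \<bullet> e}"
    using *[of "{t}" "{t<..}"] 0 unfolding ivl_disj_un by (simp add: measure_proj_measure S(1))
  have "{..t} \<union> {t<..} = UNIV" "{..t} \<inter> {t<..} = {}" by auto
  then show "measure lborel S = measure lborel {x \<in> S. x \<bullet> e < t} + measure lborel {x \<in> S. t < x \<bullet> e}"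
    using *[of "{..t}" "{t<..}"] by (simp add: measure_proj_measure S(1) 2)
qed

text \<open>Hyperplanes are null, so the distribution function of the coordinate has no jumps and
  takes every intermediate value.\<close>

lemma halfspace_measure_ivt:
  fixes e :: "'a::euclidean_space"
  assumes S: "S \<in> sets borel" "emeasure lborel S < \<infinity>" and e: "e \<noteq> 0"
    and v: "0 < v" "v < measure lborel S"
  obtains t where "measure lborel {x \<in> S. x \<bullet> e < t} = v"
proof -
  interpret P: finite_borel_measure "proj_measure S e" by (rule finite_borel_proj_measure[OF S])
  have tot: "measure (proj_measure S e) (space (proj_measure S e)) = measure lborel S"
    using S(1) by (simp add: P.borel_UNIV measure_proj_measure)
  have c: "isCont (cdf (proj_measure S e)) t" for t
    by (simp add: P.isCont_cdf proj_measure_atomless S e)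
  have "\<forall>\<^sub>F t in at_top. v < cdf (proj_measure S e) t"
    using P.cdf_lim_at_top v by (intro order_tendstoD(1)) (auto simp: tot)
  then obtain b where b: "\<And>t. t \<ge> b \<Longrightarrow> v < cdf (proj_measure S e) t" by (auto simp: eventually_at_top_linorder)
  have "\<forall>\<^sub>F t in at_bot. cdf (proj_measure S e) t < v"
    using P.cdf_lim_at_bot v by (intro order_tendstoD(2)) auto
  then obtain a where a: "\<And>t. t \<le> a \<Longrightarrow> cdf (proj_measure S e) t < v" by (auto simp: eventually_at_bot_linorder)
  have "a \<le> b" using a[of "min a b"] b[of b] P.cdf_nondecreasing[of b a] a[of a] by linarith
  then obtain t where "cdf (proj_measure S e) t = v"
    using IVT[of "cdf (proj_measure S e)" a v b] a[of a] b[of b] c by auto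
  then have "measure lborel {x \<in> S. x \<bullet> e \<le> t} = v" by (simp add: cdf_def measure_proj_measure S)
  then show ?thesis using that measure_halfspace_split(2)[OF S e, of t] by simp
qed

section \<open>Minkowski combinations and families of disjoint boxes\<close>

definition convex_comb :: "real \<Rightarrow> 'a::euclidean_space set \<Rightarrow> 'a set \<Rightarrow> 'a set" where
  "convex_comb l A B = {(1 - l) *\<^sub>R x + l *\<^sub>R y | x y. x \<in> A \<and> y \<in> B}"

lemma convex_comb_commute: "convex_comb l A B = convex_comb (1 - l) B A"
  unfolding convex_comb_def by (auto simp: add.commute)

lemma convex_comb_mono: "A \<subseteq> A' \<Longrightarrow> B \<subseteq> B' \<Longrightarrow> convex_comb l A B \<subseteq> convex_comb l A' B'"
  unfolding convex_comb_def by blast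

lemma open_convex_comb:
  assumes "open A" "l < 1"
  shows "open (convex_comb l A B)"
proof -
  have "convex_comb l A B = (\<Union>y\<in>B. (+) (l *\<^sub>R y) ` ((*\<^sub>R) (1 - l) ` A))"
    unfolding convex_comb_def by (auto simp: image_iff add.commute) (metis add.commute)+
  also have "open \<dots>" using assms by (intro open_UN ballI open_translation open_scaling) auto
  finally show ?thesis .
qed

lemma bounded_convex_comb:
  assumes "bounded A" "bounded B"
  shows "bounded (convex_comb l A B)"
proof -
  have "bounded ((\<lambda>(x, y). x + y) ` (((*\<^sub>R) (1 - l) ` A) \<times> ((*\<^sub>R) l ` B)))"
    using bounded_plus[OF bounded_scaling[OF assms(1)] bounded_scaling[OF assms(2)]]
    by (rule bounded_subset) auto
  then show ?thesis by (rule bounded_subset) (auto simp: convex_comb_def)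
qed

lemma emeasure_lborel_bounded: "bounded S \<Longrightarrow> emeasure lborel S < \<infinity>"
  by (rule emeasure_bounded_finite)

text \<open>Members are nonempty so that a hyperplane separating two of them leaves positive volume
  on both sides. The cardinality serves as the induction measure.\<close>

definition box_family :: "'a::euclidean_space set set \<Rightarrow> bool" where
  "box_family \<D> \<longleftrightarrow> finite \<D> \<and> \<D> \<noteq> {} \<and> disjoint \<D> \<and> (\<forall>D\<in>\<D>. D \<noteq> {} \<and> (\<exists>a b. D = box a b))"

lemma box_family_open: "box_family \<D> \<Longrightarrow> open (\<Union>\<D>)"
  unfolding box_family_def using open_box by (metis open_Union)

lemma box_family_bounded: "box_family \<D> \<Longrightarrow> bounded (\<Union>\<D>)"
  unfolding box_family_def using bounded_box by (metis bounded_Union)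

lemma measure_pos_open:
  fixes S :: "'a::euclidean_space set"
  assumes "open S" "S \<noteq> {}" "bounded S"
  shows "0 < measure lborel S"
proof -
  have "emeasure lborel S \<noteq> 0"
    using assms open_not_negligible[of S] by (auto simp: negligible_iff_null_sets null_sets_completion_iff)
  then show ?thesis using emeasure_lborel_bounded[OF assms(3)]
    by (simp add: measure_def enn2real_positive_iff zero_less_iff_neq_zero)
qed

lemma box_halfspace:
  fixes a b i :: "'a::euclidean_space"
  assumes i: "i \<in> Basis"
  shows "\<exists>c d. box a b \<inter> {x. x \<bullet> i < t} = box c d" "\<exists>c d. box a b \<inter> {x. t < x \<bullet> i} = box c d"
proof -
  have "box a b \<inter> {x. x \<bullet> i < t} = box a (\<Sum>j\<in>Basis. (if j = i then min (b \<bullet> i) t else b \<bullet> j) *\<^sub>R j)"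
    using i by (auto simp: mem_box split: if_splits)
  then show "\<exists>c d. box a b \<inter> {x. x \<bullet> i < t} = box c d" by blast
  have "box a b \<inter> {x. t < x \<bullet> i} = box (\<Sum>j\<in>Basis. (if j = i then max (a \<bullet> i) t else a \<bullet> j) *\<^sub>R j) b"
    using i by (auto simp: mem_box split: if_splits)
  then show "\<exists>c d. box a b \<inter> {x. t < x \<bullet> i} = box c d" by blast
qed

text \<open>Boxes that miss \<open>H\<close> disappear from the family. This strict drop in
  cardinality drives the induction for Brunn-Minkowski.\<close>

lemma box_family_cut:
  assumes D: "box_family \<D>" and H: "\<And>a b. \<exists>c d. box a b \<inter> H = box c d" and ne: "\<Union>\<D> \<inter> H \<noteq> {}"
  obtains \<D>' where "box_family \<D>'" "\<Union>\<D>' = \<Union>\<D> \<inter> H" "card \<D>' \<le> card \<D>"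
    "\<And>D. D \<in> \<D> \<Longrightarrow> D \<inter> H = {} \<Longrightarrow> card \<D>' < card \<D>"
proof
  define \<E> where "\<E> = {D \<in> \<D>. D \<inter> H \<noteq> {}}"
  define \<D>' where "\<D>' = (\<lambda>D. D \<inter> H) ` \<E>"
  have fin: "finite \<D>" using D by (simp add: box_family_def)
  have sub: "\<E> \<subseteq> \<D>" by (auto simp: \<E>_def)
  have "disjoint \<D>'"
  proof (rule disjointI)
    fix X Y assume "X \<in> \<D>'" "Y \<in> \<D>'" "X \<noteq> Y"
    then obtain D1 D2 where "D1 \<in> \<D>" "D2 \<in> \<D>" "D1 \<noteq> D2" "X = D1 \<inter> H" "Y = D2 \<inter> H"
      using sub by (auto simp: \<D>'_def)
    then show "X \<inter> Y = {}" using D by (auto simp: box_family_def dest: disjointD)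
  qed
  moreover have "\<D>' \<noteq> {}" using ne by (auto simp: \<D>'_def \<E>_def)
  moreover have "X \<noteq> {} \<and> (\<exists>a b. X = box a b)" if "X \<in> \<D>'" for X
  proof -
    obtain D0 where D0: "D0 \<in> \<D>" "D0 \<inter> H \<noteq> {}" "X = D0 \<inter> H" using \<open>X \<in> \<D>'\<close> unfolding \<D>'_def \<E>_def by blast
    moreover from D0(1) obtain a b where "D0 = box a b" using D unfolding box_family_def by metis
    ultimately show ?thesis using H by metis
  qed
  ultimately show "box_family \<D>'"
    using finite_subset[OF sub fin] by (auto simp: box_family_def \<D>'_def)
  show "\<Union>\<D>' = \<Union>\<D> \<inter> H" by (auto simp: \<D>'_def \<E>_def)
  have c: "card \<D>' \<le> card \<E>" unfolding \<D>'_def using finite_subset[OF sub fin] by (rule card_image_le)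
  then show "card \<D>' \<le> card \<D>" using card_mono[OF fin sub] by linarith
  show "card \<D>' < card \<D>" if "D0 \<in> \<D>" "D0 \<inter> H = {}" for D0
  proof -
    have "\<E> \<subset> \<D>" using that by (auto simp: \<E>_def)
    then show ?thesis using c psubset_card_mono[OF fin] by (meson le_less_trans)
  qed
qed

text \<open>The combination contains the box whose side lengths are the weighted arithmetic means of
  the given ones. In each coordinate the weighted geometric mean is at most the arithmetic one, and
  volumes are products of sides.\<close>

lemma brunn_minkowski_box:
  fixes a b c d :: "'a::euclidean_space"
  assumes l: "0 < l" "l < 1" and ne: "box a b \<noteq> {}" "box c d \<noteq> {}"
  shows "measure lborel (box a b) powr (1 - l) * measure lborel (box c d) powr l
    \<le> measure lborel (convex_comb l (box a b) (box c d))"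
proof -
  have ab: "a \<bullet> i < b \<bullet> i" "c \<bullet> i < d \<bullet> i" if "i \<in> Basis" for i using ne that by (auto simp: box_ne_empty)
  define p q where "p = (1 - l) *\<^sub>R a + l *\<^sub>R c" and "q = (1 - l) *\<^sub>R b + l *\<^sub>R d"
  have qp: "(q - p) \<bullet> i = (1 - l) * ((b - a) \<bullet> i) + l * ((d - c) \<bullet> i)" for i
    by (simp add: p_def q_def algebra_simps inner_simps)
  have pos: "0 < (b - a) \<bullet> i" "0 < (d - c) \<bullet> i" "0 < (q - p) \<bullet> i" if "i \<in> Basis" for i
    using ab[OF that] l unfolding qp by (auto simp: inner_simps intro!: add_pos_pos mult_pos_pos)
  have sub: "box p q \<subseteq> convex_comb l (box a b) (box c d)"
  proof
    fix z assume z: "z \<in> box p q"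
    \<comment> \<open>The relative position of \<open>z\<close> along each side. Taking the points
      \<open>x\<close> and \<open>y\<close> with the same relative position in their own boxes makes
      \<open>z\<close> their combination.\<close>
    define \<tau> where "\<tau> = (\<lambda>i. (z \<bullet> i - p \<bullet> i) / ((q - p) \<bullet> i))"
    have \<tau>: "0 < \<tau> i" "\<tau> i < 1" "z \<bullet> i = p \<bullet> i + \<tau> i * ((q - p) \<bullet> i)" if "i \<in> Basis" for i
      using z that pos(3)[OF that] by (auto simp: \<tau>_def mem_box inner_simps)
    define x where "x = (\<Sum>i\<in>Basis. (a \<bullet> i + \<tau> i * ((b - a) \<bullet> i)) *\<^sub>R i)"
    define y where "y = (\<Sum>i\<in>Basis. (c \<bullet> i + \<tau> i * ((d - c) \<bullet> i)) *\<^sub>R i)"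
    have strict: "u < u + t * w \<and> u + t * w < u + w" if "0 < t" "t < 1" "0 < w" for u t w :: real
      using that by simp
    have "x \<in> box a b"
      using strict[OF \<tau>(1,2) pos(1)] by (force simp: mem_box x_def inner_simps)
    moreover have "y \<in> box c d"
      using strict[OF \<tau>(1,2) pos(2)] by (force simp: mem_box y_def inner_simps)
    moreover have "z = (1 - l) *\<^sub>R x + l *\<^sub>R y"
    proof (rule euclidean_eqI)
      fix i :: 'a assume i: "i \<in> Basis"
      show "z \<bullet> i = ((1 - l) *\<^sub>R x + l *\<^sub>R y) \<bullet> i"
      proof -
        have "x \<bullet> i = a \<bullet> i + \<tau> i * ((b - a) \<bullet> i)" "y \<bullet> i = c \<bullet> i + \<tau> i * ((d - c) \<bullet> i)"
          using i by (simp_all add: x_def y_def)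
        moreover have "p \<bullet> i = (1 - l) * (a \<bullet> i) + l * (c \<bullet> i)" by (simp add: p_def inner_simps)
        moreover have "P + t * ((1 - l) * u + l * w) = (1 - l) * (a' + t * u) + l * (c' + t * w)"
          if "P = (1 - l) * a' + l * c'" for P t u w a' c' by (simp add: that algebra_simps)
        ultimately show ?thesis
          unfolding \<tau>(3)[OF i] qp inner_add_left inner_scaleR_left by presburger
      qed
    qed
    ultimately show "z \<in> convex_comb l (box a b) (box c d)" by (auto simp: convex_comb_def)
  qed
  have "measure lborel (box a b) powr (1 - l) * measure lborel (box c d) powr l
     = (\<Prod>i\<in>Basis. ((b - a) \<bullet> i) powr (1 - l) * ((d - c) \<bullet> i) powr l)"
  proof -
    have "measure lborel (box a b) = (\<Prod>i\<in>Basis. (b - a) \<bullet> i)" "measure lborel (box c d) = (\<Prod>i\<in>Basis. (d - c) \<bullet> i)"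
      using ab by (auto intro!: measure_lborel_box less_imp_le)
    then show ?thesis using pos by (simp add: prod_powr_distrib prod.distrib less_imp_le)
  qed
  also have "\<dots> \<le> (\<Prod>i\<in>Basis. (q - p) \<bullet> i)"
    unfolding qp using l pos by (intro prod_mono conjI Youngs_inequality_0 mult_nonneg_nonneg) (auto intro: less_imp_le)
  also have "\<dots> = measure lborel (box p q)"
    using pos(3) by (intro measure_lborel_box[symmetric]) (auto simp: inner_simps intro: less_imp_le)
  also have "\<dots> \<le> measure lborel (convex_comb l (box a b) (box c d))"
    using sub emeasure_lborel_bounded[OF bounded_convex_comb[OF bounded_box bounded_box]] l
    by (intro measure_mono_fmeasurable) (auto simp: fmeasurable_def intro!: borel_open open_convex_comb)
  finally show ?thesis .
qed


lemma bounded_open_fmeasurable: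
  fixes S :: "'a::euclidean_space set"
  shows "open S \<Longrightarrow> bounded S \<Longrightarrow> S \<in> fmeasurable lborel"
  using emeasure_lborel_bounded by (auto simp: fmeasurable_def borel_open)

text \<open>Disjoint nonempty boxes have disjoint projections onto some axis, and the end of the
  left projection provides the separating hyperplane.\<close>

lemma box_family_split:
  assumes D: "box_family \<D>" and card: "2 \<le> card \<D>"
  obtains i t D1 D2 where "i \<in> Basis" "D1 \<in> \<D>" "D2 \<in> \<D>"
    "D1 \<subseteq> {x. x \<bullet> i < t}" "D2 \<subseteq> {x. t < x \<bullet> i}"
proof -
  obtain D1 D2 where D12: "D1 \<in> \<D>" "D2 \<in> \<D>" "D1 \<noteq> D2"
    using card by (metis One_nat_def Suc_1 card_le_Suc0_iff_eq card_eq_0_iff le_zero_eq not_less_eq_eq zero_neq_numeral)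
  then obtain a b c d where eq: "D1 = box a b" "D2 = box c d" and ne: "D1 \<noteq> {}" "D2 \<noteq> {}"
    using D by (metis box_family_def)
  have "box a b \<inter> box c d = {}" using D D12 eq by (auto simp: box_family_def dest: disjointD)
  then obtain i where i: "i \<in> Basis" "b \<bullet> i \<le> a \<bullet> i \<or> d \<bullet> i \<le> c \<bullet> i \<or> b \<bullet> i \<le> c \<bullet> i \<or> d \<bullet> i \<le> a \<bullet> i"
    unfolding disjoint_interval by blast
  then consider "b \<bullet> i \<le> c \<bullet> i" | "d \<bullet> i \<le> a \<bullet> i"
    using ne unfolding eq box_ne_empty by force
  then show ?thesis
  proof cases
    case 1
    show ?thesis by (rule that[OF i(1) D12(1,2), of "b \<bullet> i"]) (use 1 i(1) in \<open>force simp: eq mem_box\<close>)+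
  next
    case 2
    show ?thesis by (rule that[OF i(1) D12(2,1), of "d \<bullet> i"]) (use 2 i(1) in \<open>force simp: eq mem_box\<close>)+
  qed
qed

text \<open>The two lower parts combine to a set below the hyperplane at height
  \<open>(1 - l) * s + l * t\<close>, the two upper parts to a set above it, so the volumes of these
  combinations add. The bound is homogeneous of degree 1, and the common ratio
  \<open>\<theta>\<close> lets the contributions \<open>\<theta>\<close> and
  \<open>1 - \<theta>\<close> add up to the whole.\<close>

lemma brunn_minkowski_cut:
  fixes A B :: "'a::euclidean_space set"
  assumes l: "0 < l" "l < 1" and A: "open A" "bounded A" and B: "open B" "bounded B" and e: "e \<noteq> 0"
    and lower: "measure lborel (A \<inter> {x. x \<bullet> e < s}) powr (1 - l) * measure lborel (B \<inter> {x. x \<bullet> e < t}) powr l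
       \<le> measure lborel (convex_comb l (A \<inter> {x. x \<bullet> e < s}) (B \<inter> {x. x \<bullet> e < t}))"
    and upper: "measure lborel (A \<inter> {x. s < x \<bullet> e}) powr (1 - l) * measure lborel (B \<inter> {x. t < x \<bullet> e}) powr l
       \<le> measure lborel (convex_comb l (A \<inter> {x. s < x \<bullet> e}) (B \<inter> {x. t < x \<bullet> e}))"
    and \<theta>: "0 < \<theta>" "\<theta> < 1" "measure lborel (A \<inter> {x. x \<bullet> e < s}) = \<theta> * measure lborel A"
      "measure lborel (B \<inter> {x. x \<bullet> e < t}) = \<theta> * measure lborel B"
  shows "measure lborel A powr (1 - l) * measure lborel B powr l \<le> measure lborel (convex_comb l A B)"
proof -
  have op: "open {x. x \<bullet> e < r}" "open {x. r < x \<bullet> e}" for r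
    by (intro open_Collect_less continuous_intros)+
  have eq: "A \<inter> {x. P x} = {x \<in> A. P x}" for P and A :: "'a set" by auto
  have up: "measure lborel (A \<inter> {x. s < x \<bullet> e}) = (1 - \<theta>) * measure lborel A"
    "measure lborel (B \<inter> {x. t < x \<bullet> e}) = (1 - \<theta>) * measure lborel B"
    using measure_halfspace_split(1)[OF borel_open[OF A(1)] emeasure_lborel_bounded[OF A(2)] e, of s]
      measure_halfspace_split(1)[OF borel_open[OF B(1)] emeasure_lborel_bounded[OF B(2)] e, of t] \<theta>
    by (simp_all add: eq algebra_simps)
  define C1 C2 where "C1 = convex_comb l (A \<inter> {x. x \<bullet> e < s}) (B \<inter> {x. x \<bullet> e < t})"
    and "C2 = convex_comb l (A \<inter> {x. s < x \<bullet> e}) (B \<inter> {x. t < x \<bullet> e})"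
  have C: "C1 \<in> fmeasurable lborel" "C2 \<in> fmeasurable lborel" "convex_comb l A B \<in> fmeasurable lborel"
    unfolding C1_def C2_def using l A B op
    by (auto intro!: bounded_open_fmeasurable open_convex_comb bounded_convex_comb)
  have "x \<bullet> e < (1 - l) * s + l * t" if mem: "x \<in> C1" for x
  proof -
    obtain a b where "x = (1 - l) *\<^sub>R a + l *\<^sub>R b" "a \<bullet> e < s" "b \<bullet> e < t"
      using mem unfolding C1_def convex_comb_def by blast
    then show ?thesis using l by (simp add: inner_simps add_strict_mono)
  qed
  moreover have "(1 - l) * s + l * t < x \<bullet> e" if mem: "x \<in> C2" for x
  proof -
    obtain a b where "x = (1 - l) *\<^sub>R a + l *\<^sub>R b" "s < a \<bullet> e" "t < b \<bullet> e"
      using mem unfolding C2_def convex_comb_def by blast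
    then show ?thesis using l by (simp add: inner_simps add_strict_mono)
  qed
  ultimately have disj: "C1 \<inter> C2 = {}" by force
  have split: "(\<theta> * a) powr (1 - l) * (\<theta> * b) powr l = \<theta> * (a powr (1 - l) * b powr l)"
    if "0 < \<theta>" "0 \<le> a" "0 \<le> b" for \<theta> a b :: real
  proof -
    have "\<theta> powr (1 - l) * \<theta> powr l = \<theta>" using that by (simp flip: powr_add)
    then show ?thesis using that by (simp add: powr_mult)
  qed
  define m where "m = measure lborel A powr (1 - l) * measure lborel B powr l"
  have "m = \<theta> * m + (1 - \<theta>) * m" by (simp add: algebra_simps)
  also have "\<dots> \<le> measure lborel C1 + measure lborel C2"
    using lower upper unfolding up \<theta>(3,4) C1_def[symmetric] C2_def[symmetric] m_def
    using split[of \<theta>] split[of "1 - \<theta>"] \<theta>(1,2) by (intro add_mono) auto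
  also have "\<dots> = measure lborel (C1 \<union> C2)"
    using C disj by (intro measure_Union[symmetric]) (auto simp: fmeasurable_def)
  also have "\<dots> \<le> measure lborel (convex_comb l A B)"
    using C by (intro measure_mono_fmeasurable) (auto simp: C1_def C2_def convex_comb_def fmeasurable_def)
  finally show ?thesis by (simp add: m_def)
qed

text \<open>Hadwiger--Ohmann induction: a coordinate hyperplane separating two boxes of \<open>\<A>\<close> cuts \<open>\<A>\<close> in some
  volume ratio, and \<open>\<B>\<close> is cut by a parallel hyperplane in the same ratio.\<close>

lemma brunn_minkowski_box_family:
  fixes \<A> \<B> :: "'a::euclidean_space set set"
  assumes "box_family \<A>" "box_family \<B>" "0 < l" "l < 1"
  shows "measure lborel (\<Union>\<A>) powr (1 - l) * measure lborel (\<Union>\<B>) powr l \<le> measure lborel (convex_comb l (\<Union>\<A>) (\<Union>\<B>))"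
  using assms
proof (induction "card \<A> + card \<B>" arbitrary: \<A> \<B> l rule: less_induct)
  case less
  \<comment> \<open>Stated for arbitrary families and arbitrary \<open>l\<close>, since it is
    applied a second time with the families exchanged and \<open>1 - l\<close> in place of
    \<open>l\<close>.\<close>
  have step: "measure lborel (\<Union>\<A>) powr (1 - l) * measure lborel (\<Union>\<B>) powr l \<le> measure lborel (convex_comb l (\<Union>\<A>) (\<Union>\<B>))"
    if A: "box_family \<A>" and B: "box_family \<B>" and l: "0 < l" "l < 1" and c: "2 \<le> card \<A>"
    and IH: "\<And>\<A>' \<B>' :: 'a set set. card \<A>' + card \<B>' < card \<A> + card \<B> \<Longrightarrow> box_family \<A>' \<Longrightarrow> box_family \<B>' \<Longrightarrow>
      measure lborel (\<Union>\<A>') powr (1 - l) * measure lborel (\<Union>\<B>') powr l \<le> measure lborel (convex_comb l (\<Union>\<A>') (\<Union>\<B>'))"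
    for \<A> \<B> :: "'a set set" and l
  proof -
    obtain i s D1 D2 where i: "i \<in> Basis" and D: "D1 \<in> \<A>" "D2 \<in> \<A>"
      "D1 \<subseteq> {x. x \<bullet> i < s}" "D2 \<subseteq> {x. s < x \<bullet> i}" using box_family_split[OF A c] .
    have i0: "i \<noteq> 0" using i by auto
    note oA = box_family_open[OF A] and bA = box_family_bounded[OF A]
    note oB = box_family_open[OF B] and bB = box_family_bounded[OF B]
    have ne: "D1 \<noteq> {}" "D2 \<noteq> {}" using D A by (auto simp: box_family_def)
    have op: "open {x. x \<bullet> i < r}" "open {x. r < x \<bullet> i}" for r
      by (intro open_Collect_less continuous_intros)+
    have eq: "A \<inter> {x. P x} = {x \<in> A. P x}" for P and A :: "'a set" by auto
    have posA: "0 < measure lborel (\<Union>\<A> \<inter> {x. x \<bullet> i < s})" "0 < measure lborel (\<Union>\<A> \<inter> {x. s < x \<bullet> i})"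
      using D ne oA bA op by (auto intro!: measure_pos_open)
    have "\<Union>\<B> \<noteq> {}" using B by (auto simp: box_family_def)
    then have posB: "0 < measure lborel (\<Union>\<B>)" using oB bB by (intro measure_pos_open)
    define \<theta> where "\<theta> = measure lborel (\<Union>\<A> \<inter> {x. x \<bullet> i < s}) / measure lborel (\<Union>\<A>)"
    have sp: "measure lborel (\<Union>\<A>) = measure lborel (\<Union>\<A> \<inter> {x. x \<bullet> i < s}) + measure lborel (\<Union>\<A> \<inter> {x. s < x \<bullet> i})"
      using measure_halfspace_split(1)[OF borel_open[OF oA] emeasure_lborel_bounded[OF bA] i0] by (simp add: eq)
    then have th: "0 < \<theta>" "\<theta> < 1" "measure lborel (\<Union>\<A> \<inter> {x. x \<bullet> i < s}) = \<theta> * measure lborel (\<Union>\<A>)"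
      using posA by (auto simp: \<theta>_def)
    obtain t where t: "measure lborel (\<Union>\<B> \<inter> {x. x \<bullet> i < t}) = \<theta> * measure lborel (\<Union>\<B>)"
      using halfspace_measure_ivt[OF borel_open[OF oB] emeasure_lborel_bounded[OF bB] i0, of "\<theta> * measure lborel (\<Union>\<B>)"]
        th posB by (auto simp: eq)
    have "measure lborel (\<Union>\<B>) = measure lborel (\<Union>\<B> \<inter> {x. x \<bullet> i < t}) + measure lborel (\<Union>\<B> \<inter> {x. t < x \<bullet> i})"
      using measure_halfspace_split(1)[OF borel_open[OF oB] emeasure_lborel_bounded[OF bB] i0] by (simp add: eq)
    then have "measure lborel (\<Union>\<B> \<inter> {x. t < x \<bullet> i}) = (1 - \<theta>) * measure lborel (\<Union>\<B>)"
      using t by (simp add: algebra_simps)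
    then have neB: "\<Union>\<B> \<inter> {x. x \<bullet> i < t} \<noteq> {}" "\<Union>\<B> \<inter> {x. t < x \<bullet> i} \<noteq> {}"
      using t th posB by (metis measure_empty mult_eq_0_iff order_less_irrefl diff_gt_0_iff_gt)+
    have neA: "\<Union>\<A> \<inter> {x. x \<bullet> i < s} \<noteq> {}" "\<Union>\<A> \<inter> {x. s < x \<bullet> i} \<noteq> {}" using D ne by auto
    \<comment> \<open>Each side of the cut loses one of the two separated boxes of the first family,
      while cutting the second family does not increase its cardinality; the sum of cardinalities
      therefore drops.\<close>
    have emp: "D2 \<inter> {x. x \<bullet> i < s} = {}" "D1 \<inter> {x. s < x \<bullet> i} = {}" using D by force+
    show ?thesis
    proof (rule brunn_minkowski_cut[OF l oA bA oB bB i0 _ _ th t])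
      obtain \<A>' where A': "box_family \<A>'" "\<Union>\<A>' = \<Union>\<A> \<inter> {x. x \<bullet> i < s}" "card \<A>' < card \<A>"
        using box_family_cut[OF A box_halfspace(1)[OF i] neA(1)] D(2) emp(1) by metis
      obtain \<B>' where B': "box_family \<B>'" "\<Union>\<B>' = \<Union>\<B> \<inter> {x. x \<bullet> i < t}" "card \<B>' \<le> card \<B>"
        using box_family_cut[OF B box_halfspace(1)[OF i] neB(1)] by metis
      show "measure lborel (\<Union>\<A> \<inter> {x. x \<bullet> i < s}) powr (1 - l) * measure lborel (\<Union>\<B> \<inter> {x. x \<bullet> i < t}) powr l
       \<le> measure lborel (convex_comb l (\<Union>\<A> \<inter> {x. x \<bullet> i < s}) (\<Union>\<B> \<inter> {x. x \<bullet> i < t}))"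
        using IH[OF _ A'(1) B'(1)] A' B' by simp
    next
      obtain \<A>' where A': "box_family \<A>'" "\<Union>\<A>' = \<Union>\<A> \<inter> {x. s < x \<bullet> i}" "card \<A>' < card \<A>"
        using box_family_cut[OF A box_halfspace(2)[OF i] neA(2)] D(1) emp(2) by metis
      obtain \<B>' where B': "box_family \<B>'" "\<Union>\<B>' = \<Union>\<B> \<inter> {x. t < x \<bullet> i}" "card \<B>' \<le> card \<B>"
        using box_family_cut[OF B box_halfspace(2)[OF i] neB(2)] by metis
      show "measure lborel (\<Union>\<A> \<inter> {x. s < x \<bullet> i}) powr (1 - l) * measure lborel (\<Union>\<B> \<inter> {x. t < x \<bullet> i}) powr l
       \<le> measure lborel (convex_comb l (\<Union>\<A> \<inter> {x. s < x \<bullet> i}) (\<Union>\<B> \<inter> {x. t < x \<bullet> i}))"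
        using IH[OF _ A'(1) B'(1)] A' B' by simp
    qed
  qed
  show ?case
  proof (cases "2 \<le> card \<A>")
    case True
    show ?thesis by (rule step) (use less True in auto)
  next
    case F1: False
    show ?thesis
    proof (cases "2 \<le> card \<B>")
      case True
      have "measure lborel (\<Union>\<B>) powr (1 - (1 - l)) * measure lborel (\<Union>\<A>) powr (1 - l)
         \<le> measure lborel (convex_comb (1 - l) (\<Union>\<B>) (\<Union>\<A>))"
      proof (rule step)
        fix \<B>' \<A>' :: "'a set set"
        assume "card \<B>' + card \<A>' < card \<B> + card \<A>" "box_family \<B>'" "box_family \<A>'"
        then show "measure lborel (\<Union>\<B>') powr (1 - (1 - l)) * measure lborel (\<Union>\<A>') powr (1 - l)
         \<le> measure lborel (convex_comb (1 - l) (\<Union>\<B>') (\<Union>\<A>'))"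
          using less(1)[of \<A>' \<B>' l] less.prems convex_comb_commute[of l "\<Union>\<A>'" "\<Union>\<B>'"]
          by (simp add: add.commute mult.commute)
      qed (use less.prems True in auto)
      then show ?thesis using convex_comb_commute[of l "\<Union>\<A>" "\<Union>\<B>"] by (simp add: mult.commute)
    next
      case F2: False
      have "card \<A> \<noteq> 0" "card \<B> \<noteq> 0" using less.prems by (auto simp: box_family_def)
      then have "card \<A> = 1" "card \<B> = 1" using F1 F2 by auto
      then obtain D1 D2 where D: "\<A> = {D1}" "\<B> = {D2}" by (auto simp: card_1_singleton_iff)
      have "D1 \<noteq> {}" "D2 \<noteq> {}" "\<exists>a b. D1 = box a b" "\<exists>c d. D2 = box c d"
        using less.prems(1,2) unfolding D box_family_def by auto
      then obtain a b c d where "D1 = box a b" "D2 = box c d" "D1 \<noteq> {}" "D2 \<noteq> {}" by blast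
      then show ?thesis using brunn_minkowski_box[OF less.prems(3,4), of a b c d] unfolding D by simp
    qed
  qed
qed


lemma cbox_diff_box_null: "cbox a b - box a b \<in> null_sets lborel"
  for a b :: "'a::euclidean_space"
proof -
  have "negligible (cbox a b - box a b)" by (rule negligible_frontier_interval)
  then show ?thesis by (simp add: negligible_iff_null_sets null_sets_completion_iff borel_closed borel_open)
qed

text \<open>A finite union of closed boxes has a division into nonoverlapping boxes. Passing to
  interiors removes only faces, which are null, and degenerate boxes are dropped.\<close>

lemma finite_cboxes_box_family:
  fixes \<C> :: "'a::euclidean_space set set"
  assumes fin: "finite \<C>" and box: "\<And>C. C \<in> \<C> \<Longrightarrow> \<exists>a b. C = cbox a b" and pos: "0 < measure lborel (\<Union>\<C>)"
  obtains \<D> where "box_family \<D>" "\<Union>\<D> \<subseteq> \<Union>\<C>" "measure lborel (\<Union>\<D>) = measure lborel (\<Union>\<C>)"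
proof -
  obtain p where p: "p division_of \<Union>\<C>" using elementary_unions_intervals[OF fin box] by metis
  note pD = division_ofD[OF p]
  define \<D> where "\<D> = interior ` p - {{}}"
  have null: "\<Union>\<C> - \<Union>\<D> \<in> null_sets lborel"
  proof -
    have "(\<Union>D\<in>p. D - interior D) \<in> null_sets lborel"
    proof (intro null_sets.finite_UN pD(1))
      fix D assume "D \<in> p"
      then obtain a b where "D = cbox a b" using pD(4) by blast
      then show "D - interior D \<in> null_sets lborel" using cbox_diff_box_null by (simp add: interior_cbox)
    qed
    moreover have "\<Union>\<C> - \<Union>\<D> \<subseteq> (\<Union>D\<in>p. D - interior D)"
      unfolding pD(6)[symmetric] \<D>_def by auto
    moreover have "\<Union>\<C> \<in> sets lborel" using fin box by (intro sets.finite_Union) (auto, metis borel_closed closed_cbox)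
    moreover have "\<Union>\<D> \<in> sets lborel" by (auto simp: \<D>_def intro!: borel_open)
    ultimately show ?thesis by (auto intro: null_sets_subset)
  qed
  have sub: "\<Union>\<D> \<subseteq> \<Union>\<C>" using interior_subset pD(2) by (fastforce simp: \<D>_def)
  have eq: "measure lborel (\<Union>\<D>) = measure lborel (\<Union>\<C>)"
  proof -
    have "\<Union>\<C> = \<Union>\<D> \<union> (\<Union>\<C> - \<Union>\<D>)" using sub by auto
    moreover have "\<Union>\<D> \<in> sets lborel" by (auto simp: \<D>_def intro!: borel_open)
    ultimately show ?thesis using null by (metis measure_Un_null_set)
  qed
  have "box_family \<D>"
    unfolding box_family_def
  proof (intro conjI ballI)
    show "finite \<D>" using pD(1) by (simp add: \<D>_def)
    show "\<D> \<noteq> {}" using pos eq by auto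
    show "disjoint \<D>"
    proof (rule disjointI)
      fix X Y assume "X \<in> \<D>" "Y \<in> \<D>" "X \<noteq> Y"
      then show "X \<inter> Y = {}" using pD(5) by (auto simp: \<D>_def)
    qed
    fix D assume "D \<in> \<D>"
    then show "D \<noteq> {}" by (simp add: \<D>_def)
    from \<open>D \<in> \<D>\<close> obtain C where C: "C \<in> p" "D = interior C" by (auto simp: \<D>_def)
    then obtain a b where "C = cbox a b" using pD(4) by blast
    then show "\<exists>a b. D = box a b" using C by (auto simp: interior_cbox)
  qed
  then show ?thesis using that sub eq by blast
qed

lemma open_box_family_approx:
  fixes A :: "'a::euclidean_space set"
  assumes A: "open A" "A \<noteq> {}" "bounded A"
  obtains \<D> where "\<And>n :: nat. box_family (\<D> n)" "\<And>n. \<Union>(\<D> n) \<subseteq> A"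
    "(\<lambda>n. measure lborel (\<Union>(\<D> n))) \<longlonglongrightarrow> measure lborel A"
proof -
  obtain \<C> where C: "countable \<C>" "\<C> \<subseteq> Pow A" "\<And>X. X \<in> \<C> \<Longrightarrow> \<exists>a b. X = cbox a b" "\<Union>\<C> = A"
    using open_countable_Union_open_cbox[OF A(1)] by metis
  have "\<C> \<noteq> {}" using C(4) A(2) by auto
  define c where "c = from_nat_into \<C>"
  have c: "range c = \<C>" using range_from_nat_into[OF \<open>\<C> \<noteq> {}\<close> C(1)] by (simp add: c_def)
  define U where "U = (\<lambda>n. \<Union>(c ` {..n}))"
  have cc: "\<exists>a b. c n = cbox a b" for n using C(3) c by auto
  have Us: "U n \<in> sets lborel" for n
    unfolding U_def using cc by (intro sets.finite_Union) (auto, metis borel_closed closed_cbox)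
  have "(\<lambda>n. measure lborel (U n)) \<longlonglongrightarrow> measure lborel (\<Union>n. U n)"
  proof (rule Lim_measure_incseq)
    show "range U \<subseteq> sets lborel" using Us by auto
    show "incseq U" by (fastforce simp: incseq_def U_def)
    have "(\<Union>n. U n) \<subseteq> A" using C(2) c by (auto simp: U_def)
    then show "emeasure lborel (\<Union>n. U n) \<noteq> \<infinity>"
      using emeasure_lborel_bounded[OF bounded_subset[OF A(3)]] by (metis less_irrefl)
  qed
  moreover have UA: "(\<Union>n. U n) = A" using c C(4) by (fastforce simp: U_def)
  ultimately have lim: "(\<lambda>n. measure lborel (U n)) \<longlonglongrightarrow> measure lborel A" by simp
  \<comment> \<open>The first finite unions may be null and then contain no box family; the sequence
    is started where the volume is positive.\<close>
  then have "\<forall>\<^sub>F n in sequentially. 0 < measure lborel (U n)"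
    using measure_pos_open[OF A] by (intro order_tendstoD(1)) auto
  then obtain N where N: "\<And>n. n \<ge> N \<Longrightarrow> 0 < measure lborel (U n)" by (auto simp: eventually_sequentially)
  have "\<exists>\<D>. box_family \<D> \<and> \<Union>\<D> \<subseteq> U (n + N) \<and> measure lborel (\<Union>\<D>) = measure lborel (U (n + N))" for n
    unfolding U_def
    by (rule finite_cboxes_box_family[of "c ` {..n + N}"]) (use cc N[of "n + N"] in \<open>auto simp: U_def\<close>)
  then obtain \<D> where D: "\<And>n. box_family (\<D> n)" "\<And>n. \<Union>(\<D> n) \<subseteq> U (n + N)"
    "\<And>n. measure lborel (\<Union>(\<D> n)) = measure lborel (U (n + N))" by metis
  show ?thesis
  proof (rule that[of \<D>])
    show "box_family (\<D> n)" for n by (rule D(1))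
    show "\<Union>(\<D> n) \<subseteq> A" for n using D(2)[of n] UA by blast
    show "(\<lambda>n. measure lborel (\<Union>(\<D> n))) \<longlonglongrightarrow> measure lborel A"
      unfolding D(3) by (rule LIMSEQ_ignore_initial_segment[OF lim])
  qed
qed

text \<open>The limit is taken on the left side only: inner approximations by box families have
  their combinations inside the combination of \<open>A\<close> and \<open>B\<close>.\<close>

theorem brunn_minkowski_open:
  fixes A B :: "'a::euclidean_space set"
  assumes A: "open A" "A \<noteq> {}" "bounded A" and B: "open B" "B \<noteq> {}" "bounded B" and l: "0 < l" "l < 1"
  shows "measure lborel A powr (1 - l) * measure lborel B powr l \<le> measure lborel (convex_comb l A B)"
proof -
  obtain \<A> where \<A>: "\<And>n :: nat. box_family (\<A> n)" "\<And>n. \<Union>(\<A> n) \<subseteq> A"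
    "(\<lambda>n. measure lborel (\<Union>(\<A> n))) \<longlonglongrightarrow> measure lborel A" using open_box_family_approx[OF A] by blast
  obtain \<B> where \<B>: "\<And>n :: nat. box_family (\<B> n)" "\<And>n. \<Union>(\<B> n) \<subseteq> B"
    "(\<lambda>n. measure lborel (\<Union>(\<B> n))) \<longlonglongrightarrow> measure lborel B" using open_box_family_approx[OF B] by blast
  have "(\<lambda>n. measure lborel (\<Union>(\<A> n)) powr (1 - l) * measure lborel (\<Union>(\<B> n)) powr l)
      \<longlonglongrightarrow> measure lborel A powr (1 - l) * measure lborel B powr l"
    using measure_pos_open[OF A] measure_pos_open[OF B]
    by (intro tendsto_mult tendsto_powr \<A>(3) \<B>(3) tendsto_const) auto
  moreover have "measure lborel (\<Union>(\<A> n)) powr (1 - l) * measure lborel (\<Union>(\<B> n)) powr l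
      \<le> measure lborel (convex_comb l A B)" for n
  proof -
    have "measure lborel (convex_comb l (\<Union>(\<A> n)) (\<Union>(\<B> n))) \<le> measure lborel (convex_comb l A B)"
      using A B l box_family_open[OF \<A>(1)] convex_comb_mono[OF \<A>(2) \<B>(2)]
      by (intro measure_mono_fmeasurable bounded_open_fmeasurable)
        (auto intro!: open_convex_comb bounded_convex_comb borel_open)
    then show ?thesis using brunn_minkowski_box_family[OF \<A>(1) \<B>(1) l, of n n] by linarith
  qed
  ultimately show ?thesis by (blast intro: LIMSEQ_le_const2)
qed

text \<open>Both directions of half-spaces are treated at once through \<open>J\<close>. The
  condition \<open>comb\<close> places the Minkowski combination of two sections inside the
  intermediate section, whose volume is then bounded by Brunn-Minkowski.\<close>

lemma log_concave_halfspace: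
  fixes K :: "'a::euclidean_space set" and J :: "real \<Rightarrow> 'a set"
  assumes K: "open K" "bounded K" and J: "\<And>t. open (J t)"
    and comb: "\<And>l s t. 0 < l \<Longrightarrow> l < 1 \<Longrightarrow>
      convex_comb l (K \<inter> J s) (K \<inter> J t) \<subseteq> K \<inter> J ((1 - l) * s + l * t)"
  shows "log_concave (\<lambda>t. measure lborel (K \<inter> J t))"
  unfolding log_concave_def
proof (intro conjI allI ballI)
  fix s t l :: real assume l: "l \<in> {0..1}"
  show "measure lborel (K \<inter> J s) powr (1 - l) * measure lborel (K \<inter> J t) powr l
     \<le> measure lborel (K \<inter> J ((1 - l) * s + l * t))"
  proof (cases "l = 0 \<or> l = 1 \<or> K \<inter> J s = {} \<or> K \<inter> J t = {}")
    case True
    then show ?thesis by auto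
  next
    case False
    then have l: "0 < l" "l < 1" using l by auto
    have "measure lborel (K \<inter> J s) powr (1 - l) * measure lborel (K \<inter> J t) powr l
      \<le> measure lborel (convex_comb l (K \<inter> J s) (K \<inter> J t))"
      using K J False l by (intro brunn_minkowski_open) auto
    also have "\<dots> \<le> measure lborel (K \<inter> J ((1 - l) * s + l * t))"
      using comb[OF l] K J l
      by (intro measure_mono_fmeasurable bounded_open_fmeasurable) (auto intro!: borel_open open_convex_comb)
    finally show ?thesis .
  qed
qed simp

lemma log_concave_proj_measure:
  fixes K :: "'a::euclidean_space set"
  assumes K: "open K" "bounded K" "convex K" and e: "e \<noteq> 0"
  shows "log_concave (\<lambda>t. measure (proj_measure K e) {..t})" "log_concave (\<lambda>t. measure (proj_measure K e) {t..})"
proof -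
  have sub: "convex_comb l (K \<inter> A) (K \<inter> B) \<subseteq> K \<inter> C" if "0 < l" "l < 1"
    "\<And>x y. x \<in> A \<Longrightarrow> y \<in> B \<Longrightarrow> (1 - l) *\<^sub>R x + l *\<^sub>R y \<in> C" for l A B C
    using that K(3) by (force simp: convex_comb_def convex_alt)
  \<comment> \<open>Closed half-lines are traded for open half-spaces, because Brunn-Minkowski is at
    hand for open sets; the bounding hyperplanes are null.\<close>
  have eq: "measure (proj_measure K e) {..t} = measure lborel (K \<inter> {x. x \<bullet> e < t})"
    "measure (proj_measure K e) {t..} = measure lborel (K \<inter> {x. t < x \<bullet> e})" for t
    using measure_halfspace_split(2,3)[OF borel_open[OF K(1)] emeasure_lborel_bounded[OF K(2)] e, of t] K(1)
    by (simp_all add: measure_proj_measure borel_open Int_def)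
  show "log_concave (\<lambda>t. measure (proj_measure K e) {..t})"
    unfolding eq
  proof (rule log_concave_halfspace[OF K(1,2)])
    show "open {x. x \<bullet> e < t}" for t by (intro open_Collect_less continuous_intros)
    show "convex_comb l (K \<inter> {x. x \<bullet> e < s}) (K \<inter> {x. x \<bullet> e < t}) \<subseteq> K \<inter> {x. x \<bullet> e < (1 - l) * s + l * t}"
      if "0 < l" "l < 1" for l s t
      using that by (intro sub) (auto simp: inner_simps intro: add_strict_mono)
  qed
  show "log_concave (\<lambda>t. measure (proj_measure K e) {t..})"
    unfolding eq
  proof (rule log_concave_halfspace[OF K(1,2)])
    show "open {x. t < x \<bullet> e}" for t by (intro open_Collect_less continuous_intros)
    show "convex_comb l (K \<inter> {x. s < x \<bullet> e}) (K \<inter> {x. t < x \<bullet> e}) \<subseteq> K \<inter> {x. (1 - l) * s + l * t < x \<bullet> e}"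
      if "0 < l" "l < 1" for l s t
      using that by (intro sub) (auto simp: inner_simps intro: add_strict_mono)
  qed
qed

section \<open>Localization\<close>

lemma set_integrable_continuous_bounded:
  fixes f :: "'a::euclidean_space \<Rightarrow> 'b::{banach, second_countable_topology}"
  assumes f: "continuous_on UNIV f" and S: "S \<in> sets borel" "bounded S"
  shows "set_integrable lborel S f"
proof -
  have "compact (closure S)" using S by (simp add: compact_eq_bounded_closed bounded_closure)
  then have "set_integrable lborel (closure S) f"
    unfolding set_integrable_def
    by (intro borel_integrable_compact continuous_on_subset[OF f]) auto
  then show ?thesis by (rule set_integrable_subset) (use S closure_subset in auto)
qed

text \<open>For independent \<open>v\<close> and \<open>w\<close> this runs through an ellipse in
  their plane. What is used is continuity, and that adding \<open>pi\<close> to the angle reverses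
  the sign and so exchanges the two sides of the hyperplane.\<close>

definition rotating_normal :: "'a::euclidean_space \<Rightarrow> 'a \<Rightarrow> real \<Rightarrow> 'a" where
  "rotating_normal v w t = cos t *\<^sub>R v + sin t *\<^sub>R w"

definition half_space :: "'a::euclidean_space \<Rightarrow> 'a \<Rightarrow> 'a set" where
  "half_space p m = {x. 0 < (x - p) \<bullet> m}"

lemma open_half_space: "open (half_space p m)"
  unfolding half_space_def by (intro open_Collect_less continuous_intros)

lemma convex_half_space: "convex (half_space p m)"
proof -
  have "half_space p m = {x. p \<bullet> m < m \<bullet> x}" by (auto simp: half_space_def inner_simps inner_commute)
  then show ?thesis by (simp add: convex_halfspace_gt)
qed

lemma AE_not_on_hyperplane:
  fixes m :: "'a::euclidean_space"
  assumes "m \<noteq> 0"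
  shows "AE x in lborel. (x - p) \<bullet> m \<noteq> 0"
  using hyperplane_null_lborel[OF assms, of "p \<bullet> m"]
  by (intro AE_I'[where N = "{x. x \<bullet> m = p \<bullet> m}"]) (auto simp: inner_diff_left)

lemma integral_half_space_complement:
  fixes g :: "'a::euclidean_space \<Rightarrow> real"
  assumes g: "continuous_on UNIV g" and K: "open K" "bounded K" and m: "m \<noteq> 0"
  shows "(LINT x:K \<inter> half_space p m|lborel. g x) + (LINT x:K \<inter> half_space p (- m)|lborel. g x) = (LINT x:K|lborel. g x)"
proof -
  have i: "set_integrable lborel (K \<inter> half_space p n) g" for n
    using K open_half_space by (intro set_integrable_continuous_bounded g) (auto intro: borel_open)
  have "(LINT x:K \<inter> half_space p m|lborel. g x) + (LINT x:K \<inter> half_space p (- m)|lborel. g x)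
      = (LINT x:(K \<inter> half_space p m) \<union> (K \<inter> half_space p (- m))|lborel. g x)"
    by (rule set_integral_Un[symmetric]) (auto simp: i, auto simp: half_space_def)
  also have "\<dots> = (LINT x:K|lborel. g x)"
  proof (rule set_integral_cong_set)
    show "AE x in lborel. x \<in> K \<longleftrightarrow> x \<in> (K \<inter> half_space p m) \<union> (K \<inter> half_space p (- m))"
      using AE_not_on_hyperplane[OF m, of p] by eventually_elim (auto simp: half_space_def)
    show "set_borel_measurable lborel K g" "set_borel_measurable lborel (K \<inter> half_space p m \<union> K \<inter> half_space p (- m)) g"
      using K open_half_space borel_measurable_continuous_onI[OF g] unfolding set_borel_measurable_def
      by (intro borel_measurable_scaleR borel_measurable_indicator; auto intro!: borel_open open_Un open_Int)+
  qed
  finally show ?thesis .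
qed


text \<open>Dominated convergence: off the limiting hyperplane, a null set, membership in the
  half-space is eventually constant along the sequence.\<close>

lemma continuous_integral_half_space:
  fixes g :: "'a::euclidean_space \<Rightarrow> real" and n :: "real \<Rightarrow> 'a"
  assumes g: "continuous_on UNIV g" and K: "open K" "bounded K" and n: "continuous_on UNIV n" "\<And>t. n t \<noteq> 0"
  shows "continuous_on UNIV (\<lambda>t. LINT x:K \<inter> half_space p (n t)|lborel. g x)"
proof (rule continuous_on_sequentiallyI)
  fix T :: "nat \<Rightarrow> real" and t assume T: "T \<longlonglongrightarrow> t"
  have [measurable]: "g \<in> borel_measurable lborel" using g by (simp add: borel_measurable_continuous_onI)
  have [measurable]: "K \<inter> half_space p m \<in> sets lborel" for m using borel_open[OF open_Int[OF K(1) open_half_space]] by simp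
  show "(\<lambda>k. LINT x:K \<inter> half_space p (n (T k))|lborel. g x) \<longlonglongrightarrow> (LINT x:K \<inter> half_space p (n t)|lborel. g x)"
    unfolding set_lebesgue_integral_def
  proof (rule integral_dominated_convergence)
    show "integrable lborel (\<lambda>x. norm (indicat_real K x *\<^sub>R g x))"
      using set_integrable_continuous_bounded[OF g borel_open[OF K(1)] K(2)]
      unfolding set_integrable_def by (rule integrable_norm)
    show "AE x in lborel. norm (indicat_real (K \<inter> half_space p (n (T k))) x *\<^sub>R g x) \<le> norm (indicat_real K x *\<^sub>R g x)" for k
      by (auto simp: indicator_def)
    show "AE x in lborel. (\<lambda>k. indicat_real (K \<inter> half_space p (n (T k))) x *\<^sub>R g x) \<longlonglongrightarrow> indicat_real (K \<inter> half_space p (n t)) x *\<^sub>R g x"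
      using AE_not_on_hyperplane[OF n(2)[of t], of p]
    proof eventually_elim
      case (elim x)
      have "isCont n t" using n(1) by (simp add: continuous_on_eq_continuous_at)
      then have lim: "(\<lambda>k. (x - p) \<bullet> n (T k)) \<longlonglongrightarrow> (x - p) \<bullet> n t"
        using T by (intro tendsto_intros isCont_tendsto_compose[of t n])
      have "\<forall>\<^sub>F k in sequentially. (0 < (x - p) \<bullet> n (T k)) = (0 < (x - p) \<bullet> n t)"
      proof (cases "0 < (x - p) \<bullet> n t")
        case True
        then show ?thesis using order_tendstoD(1)[OF lim True] by (auto elim: eventually_mono)
      next
        case False
        then have "(x - p) \<bullet> n t < 0" using elim by simp
        from order_tendstoD(2)[OF lim this] False show ?thesis by (auto elim: eventually_mono)
      qed
      then have "\<forall>\<^sub>F k in sequentially. indicat_real (K \<inter> half_space p (n (T k))) x *\<^sub>R g x = indicat_real (K \<inter> half_space p (n t)) x *\<^sub>R g x"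
        by eventually_elim (auto simp: half_space_def indicator_def)
      then show ?case by (rule tendsto_eventually)
    qed
  qed measurable
qed

text \<open>A half turn of the normal exchanges the two sides, so by the intermediate value theorem
  some position splits the integral of \<open>g1\<close> evenly. The integral of \<open>g2\<close>
  is positive on at least one of the two sides, and that side is kept.\<close>

lemma bisect_by_half_space:
  fixes g1 g2 :: "'a::euclidean_space \<Rightarrow> real"
  assumes g: "continuous_on UNIV g1" "continuous_on UNIV g2" and K: "open K" "bounded K"
    and indep: "\<And>t. rotating_normal v w t \<noteq> 0"
    and pos: "0 < (LINT x:K|lborel. g1 x)" "0 < (LINT x:K|lborel. g2 x)"
  obtains t where "0 < (LINT x:K \<inter> half_space p (rotating_normal v w t)|lborel. g1 x)"
    "0 < (LINT x:K \<inter> half_space p (rotating_normal v w t)|lborel. g2 x)"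
proof -
  define \<psi> where "\<psi> = (\<lambda>t. LINT x:K \<inter> half_space p (rotating_normal v w t)|lborel. g1 x)"
  define I where "I = (LINT x:K|lborel. g1 x)"
  have opp: "rotating_normal v w (t + pi) = - rotating_normal v w t" for t
    by (simp add: rotating_normal_def)
  have sum: "\<psi> t + \<psi> (t + pi) = I" for t
    unfolding \<psi>_def I_def opp by (rule integral_half_space_complement[OF g(1) K indep])
  have "continuous_on UNIV (rotating_normal v w)"
    unfolding rotating_normal_def by (intro continuous_intros)
  then have cont: "continuous_on UNIV \<psi>"
    unfolding \<psi>_def by (intro continuous_integral_half_space g K indep)
  have "\<exists>t. \<psi> t = I / 2"
  proof (cases "\<psi> 0 \<le> I / 2")
    case True
    then have "I / 2 \<le> \<psi> pi" using sum[of 0] by simp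
    then show ?thesis using IVT'[of \<psi> 0 "I / 2" pi] True continuous_on_subset[OF cont] by auto
  next
    case False
    then have "\<psi> pi \<le> I / 2" using sum[of 0] by simp
    then show ?thesis using IVT2'[of \<psi> pi "I / 2" 0] False continuous_on_subset[OF cont] by auto
  qed
  then obtain t where t: "\<psi> t = I / 2" by blast
  have t': "\<psi> (t + pi) = I / 2" using sum[of t] t by simp
  have "(LINT x:K \<inter> half_space p (rotating_normal v w t)|lborel. g2 x)
     + (LINT x:K \<inter> half_space p (rotating_normal v w (t + pi))|lborel. g2 x) = (LINT x:K|lborel. g2 x)"
    unfolding opp by (rule integral_half_space_complement[OF g(2) K indep])
  then have "0 < (LINT x:K \<inter> half_space p (rotating_normal v w t)|lborel. g2 x) \<or>
     0 < (LINT x:K \<inter> half_space p (rotating_normal v w (t + pi))|lborel. g2 x)" using pos(2) by linarith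
  then show ?thesis using that[of t] that[of "t + pi"] t t' pos(1) unfolding \<psi>_def I_def by auto
qed

text \<open>If \<open>x\<close>, \<open>y\<close>, \<open>z\<close> were not collinear, some \<open>(p, v, w)\<close> in the dense set would have the property that
  \<open>p\<close> agrees modulo the orthogonal complement of \<open>v\<close>, \<open>w\<close> with an interior point of the triangle; the
  triangle cannot then lie on one side of a hyperplane through \<open>p\<close> with normal in the span of \<open>v\<close>, \<open>w\<close>.
  The barycentric coordinates \<open>s\<close>, \<open>t\<close> of that point come from Cramer's rule.\<close>

lemma collinear_of_cuts:
  fixes L :: "'a::euclidean_space set" and D :: "('a \<times> 'a \<times> 'a) set"
  assumes dense: "\<And>U. open U \<Longrightarrow> U \<noteq> {} \<Longrightarrow> \<exists>d\<in>D. d \<in> U"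
    and side: "\<And>p v w. (p, v, w) \<in> D \<Longrightarrow> (\<And>t. rotating_normal v w t \<noteq> 0) \<Longrightarrow>
      \<exists>t. \<forall>x\<in>L. 0 \<le> (x - p) \<bullet> rotating_normal v w t"
    and xyz: "x \<in> L" "y \<in> L" "z \<in> L"
  shows "((y - x) \<bullet> (z - x))\<^sup>2 = ((y - x) \<bullet> (y - x)) * ((z - x) \<bullet> (z - x))"
proof (rule ccontr)
  assume ne: "((y - x) \<bullet> (z - x))\<^sup>2 \<noteq> ((y - x) \<bullet> (y - x)) * ((z - x) \<bullet> (z - x))"
  define V W where "V = y - x" and "W = z - x"
  \<comment> \<open>The Gram determinant of \<open>V\<close> and \<open>W\<close>, which vanishes
    exactly when the three points are collinear.\<close>
  define gram where "gram = (V \<bullet> V) * (W \<bullet> W) - (V \<bullet> W) * (V \<bullet> W)"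
  have gram: "0 < gram"
    using Cauchy_Schwarz_ineq[of V W] ne by (auto simp: gram_def V_def W_def power2_eq_square)
  \<comment> \<open>The three determinants of Cramer's rule for the coordinates of
    \<open>p - x\<close> with respect to \<open>V\<close> and \<open>W\<close>, tested against
    \<open>v\<close> and \<open>w\<close>. The open set \<open>U\<close> says that these coordinates
    lie inside the triangle.\<close>
  define \<delta> where "\<delta> = (\<lambda>(p :: 'a, v, w). (V \<bullet> v) * (W \<bullet> w) - (W \<bullet> v) * (V \<bullet> w))"
  define \<sigma> where "\<sigma> = (\<lambda>(p, v, w). ((p - x) \<bullet> v) * (W \<bullet> w) - (W \<bullet> v) * ((p - x) \<bullet> w))"
  define \<tau> where "\<tau> = (\<lambda>(p, v, w). (V \<bullet> v) * ((p - x) \<bullet> w) - (V \<bullet> w) * ((p - x) \<bullet> v))"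
  define U where "U = {d. 0 < \<delta> d} \<inter> {d. 0 < \<sigma> d} \<inter> {d. 0 < \<tau> d} \<inter> {d. \<sigma> d + \<tau> d < \<delta> d}"
  have "continuous_on UNIV \<delta>" "continuous_on UNIV \<sigma>" "continuous_on UNIV \<tau>"
    unfolding \<delta>_def \<sigma>_def \<tau>_def case_prod_unfold by (intro continuous_intros)+
  then have "open U" unfolding U_def by (intro open_Int open_Collect_less continuous_intros)
  \<comment> \<open>The barycentre of the triangle, with its own edges as \<open>v\<close> and
    \<open>w\<close>, shows that \<open>U\<close> is nonempty.\<close>
  moreover have "(x + (1 / 3) *\<^sub>R (V + W), V, W) \<in> U"
  proof -
    have "\<delta> (x + (1 / 3) *\<^sub>R (V + W), V, W) = gram"
      by (simp add: \<delta>_def gram_def inner_commute)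
    moreover have "\<sigma> (x + (1 / 3) *\<^sub>R (V + W), V, W) = gram / 3"
      by (simp add: \<sigma>_def gram_def inner_simps inner_commute algebra_simps)
    moreover have "\<tau> (x + (1 / 3) *\<^sub>R (V + W), V, W) = gram / 3"
      by (simp add: \<tau>_def gram_def inner_simps inner_commute algebra_simps)
    ultimately show ?thesis using gram by (simp add: U_def)
  qed
  ultimately obtain p v w where D: "(p, v, w) \<in> D" "(p, v, w) \<in> U"
    using dense[of U] by (metis empty_iff prod_cases3)
  define d s t where "d = (V \<bullet> v) * (W \<bullet> w) - (W \<bullet> v) * (V \<bullet> w)"
    and "s = (((p - x) \<bullet> v) * (W \<bullet> w) - (W \<bullet> v) * ((p - x) \<bullet> w)) / d"
    and "t = ((V \<bullet> v) * ((p - x) \<bullet> w) - (V \<bullet> w) * ((p - x) \<bullet> v)) / d"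
  have d: "0 < d" and st: "0 < s" "0 < t" "s + t < 1"
    using D(2) by (auto simp: U_def \<delta>_def \<sigma>_def \<tau>_def d_def s_def t_def simp flip: add_divide_distrib)
  \<comment> \<open>The two equations are linear in \<open>cos \<theta>\<close> and
    \<open>sin \<theta>\<close> with determinant \<open>d\<close>, so both would vanish.\<close>
  have zero: False if "rotating_normal v w \<theta> \<bullet> V = 0" "rotating_normal v w \<theta> \<bullet> W = 0" for \<theta>
  proof -
    have "cos \<theta> * (V \<bullet> v) + sin \<theta> * (V \<bullet> w) = 0" "cos \<theta> * (W \<bullet> v) + sin \<theta> * (W \<bullet> w) = 0"
      using that by (simp_all add: rotating_normal_def inner_simps inner_commute)
    then have "cos \<theta> * d = 0" "sin \<theta> * d = 0" unfolding d_def by algebra+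
    then have "cos \<theta> = 0" "sin \<theta> = 0" using d by auto
    then show False using sin_cos_squared_add[of \<theta>] by simp
  qed
  have "rotating_normal v w \<theta> \<noteq> 0" for \<theta> using zero[of \<theta>] by auto
  then obtain \<theta> where \<theta>: "\<And>u. u \<in> L \<Longrightarrow> 0 \<le> (u - p) \<bullet> rotating_normal v w \<theta>" using side[OF D(1)] by blast
  define m where "m = rotating_normal v w \<theta>"
  have "s * (V \<bullet> v) + t * (W \<bullet> v) = (p - x) \<bullet> v" "s * (V \<bullet> w) + t * (W \<bullet> w) = (p - x) \<bullet> w"
    using d by (simp_all add: s_def t_def field_simps) (simp_all add: d_def algebra_simps)
  then have "(x + s *\<^sub>R V + t *\<^sub>R W - p) \<bullet> v = 0" "(x + s *\<^sub>R V + t *\<^sub>R W - p) \<bullet> w = 0"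
    by (simp_all add: inner_simps)
  then have "(x + s *\<^sub>R V + t *\<^sub>R W - p) \<bullet> m = 0" by (simp add: m_def rotating_normal_def inner_simps)
  \<comment> \<open>A combination of three nonnegative numbers with positive coefficients is zero,
    so all three vertices lie on the cutting hyperplane and \<open>m\<close> annihilates both
    edges.\<close>
  then have eq: "(1 - s - t) * ((x - p) \<bullet> m) + s * ((y - p) \<bullet> m) + t * ((z - p) \<bullet> m) = 0"
    by (simp add: V_def W_def inner_simps algebra_simps)
  have nn: "0 \<le> (x - p) \<bullet> m" "0 \<le> (y - p) \<bullet> m" "0 \<le> (z - p) \<bullet> m" using \<theta> xyz by (auto simp: m_def)
  have "0 \<le> (1 - s - t) * ((x - p) \<bullet> m)" "0 \<le> s * ((y - p) \<bullet> m)" "0 \<le> t * ((z - p) \<bullet> m)"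
    using nn st by auto
  then have "(1 - s - t) * ((x - p) \<bullet> m) = 0" "s * ((y - p) \<bullet> m) = 0" "t * ((z - p) \<bullet> m) = 0" using eq by linarith+
  then have "(x - p) \<bullet> m = 0" "(y - p) \<bullet> m = 0" "(z - p) \<bullet> m = 0" using st by auto
  then have "m \<bullet> V = 0" "m \<bullet> W = 0" by (auto simp: V_def W_def inner_simps inner_commute)
  then show False using zero by (simp add: m_def)
qed


lemma log_concave_divide:
  assumes "log_concave \<phi>" "0 < c"
  shows "log_concave (\<lambda>t. \<phi> t / c)"
  unfolding log_concave_def
proof (intro conjI allI ballI)
  show "0 \<le> \<phi> x / c" for x using log_concave_nonneg[OF assms(1)] assms(2) by simp
  fix x y l :: real assume "l \<in> {0..1}"
  have "c powr (1 - l) * c powr l = c" using assms(2) by (simp flip: powr_add)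
  then have "(\<phi> x / c) powr (1 - l) * (\<phi> y / c) powr l = (\<phi> x powr (1 - l) * \<phi> y powr l) / c"
    using assms log_concave_nonneg[OF assms(1)] by (simp add: powr_divide)
  also have "\<dots> \<le> \<phi> ((1 - l) * x + l * y) / c"
    using log_concaveD[OF assms(1), of l x y] \<open>l \<in> {0..1}\<close> assms(2) by (intro divide_right_mono) auto
  finally show "(\<phi> x / c) powr (1 - l) * (\<phi> y / c) powr l \<le> \<phi> ((1 - l) * x + l * y) / c" .
qed

text \<open>The distribution of the coordinate is normalised to mass 1 in order to apply the needle
  inequality. Both sides are quadratic in the measure, so the volume of \<open>K\<close>
  cancels.\<close>

lemma needle_inequality_body:
  fixes K :: "'a::euclidean_space set" and e :: 'a
  assumes K: "open K" "bounded K" "convex K" "K \<noteq> {}" and e: "norm e = 1"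
    and f: "continuous_on UNIV f1" "continuous_on UNIV f2" "continuous_on UNIV f3"
    and nonneg: "\<And>x. 0 \<le> f1 x" "\<And>x. 0 \<le> f2 x" "\<And>x. 0 \<le> f3 x"
    and between: "\<And>x y. x \<le> y \<Longrightarrow> f1 x * f2 y + f1 y * f2 x \<le> integral {x..y} f3"
  shows "ln 2 * ((LINT x:K|lborel. f1 (x \<bullet> e)) * (LINT x:K|lborel. f2 (x \<bullet> e)))
    \<le> (LINT x:K|lborel. f3 (x \<bullet> e)) * (LINT x:K|lborel. \<bar>x \<bullet> e - c\<bar>)"
proof -
  have e0: "e \<noteq> 0" using e by auto
  have Kb[measurable]: "K \<in> sets borel" using K(1) by (rule borel_open)
  note Kfin = emeasure_lborel_bounded[OF K(2)]
  define V where "V = measure lborel K"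
  have V: "0 < V" unfolding V_def by (rule measure_pos_open[OF K(1,4,2)])
  have eV: "emeasure lborel K = ennreal V" unfolding V_def using Kfin by (simp add: emeasure_eq_ennreal_measure)
  define P where "P = distr (uniform_measure lborel K) borel (\<lambda>x. x \<bullet> e)"
  have Psets: "sets P = sets borel" and Pspace: "space P = UNIV" by (auto simp: P_def)
  have Pem: "measure P T = measure (proj_measure K e) T / V" if [measurable]: "T \<in> sets borel" for T
  proof -
    have "measure P T = measure (uniform_measure lborel K) {x. x \<bullet> e \<in> T}"
      unfolding P_def by (subst measure_distr) (auto simp: vimage_def)
    also have "\<dots> = measure lborel (K \<inter> {x. x \<bullet> e \<in> T}) / V"
      unfolding V_def using V eV by (subst measure_uniform_measure) (auto simp: )
    finally show ?thesis by (simp add: measure_proj_measure Int_def)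
  qed
  have "emeasure P UNIV = 1"
  proof -
    have "emeasure P UNIV = emeasure (uniform_measure lborel K) UNIV"
      unfolding P_def by (subst emeasure_distr) auto
    also have "\<dots> = 1" using V by (simp add: eV divide_ennreal)
    finally show ?thesis .
  qed
  then have P1: "measure P UNIV = 1" and Pfin: "finite_measure P"
    by (auto simp: measure_def Pspace intro!: finite_measureI)
  obtain R where R: "\<And>x. x \<in> K \<Longrightarrow> norm x \<le> R" using K(2) by (auto simp: bounded_iff)
  interpret P: log_concave_needle P R
  proof -
    have "finite_borel_measure P"
      using Pfin Psets by (simp add: finite_borel_measure_def finite_borel_measure_axioms_def)
    moreover have "log_concave_needle_axioms P R"
    proof
      show "measure P UNIV = 1" by (rule P1)
      show "measure P {x} = 0" for x using Pem[of "{x}"] proj_measure_atomless[OF Kb e0] by simp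
      show "log_concave (\<lambda>t. measure P {..t})" "log_concave (\<lambda>t. measure P {t..})"
        using log_concave_divide[OF log_concave_proj_measure(1)[OF K(1-3) e0] V]
          log_concave_divide[OF log_concave_proj_measure(2)[OF K(1-3) e0] V] by (simp_all add: Pem)
      have "AE x in uniform_measure lborel K. x \<bullet> e \<in> {- R..R}"
      proof (rule AE_uniform_measureI)
        show "AE x in lborel. x \<in> K \<longrightarrow> x \<bullet> e \<in> {- R..R}"
        proof (rule AE_I2, rule impI)
          fix x assume "x \<in> K"
          then have "\<bar>x \<bullet> e\<bar> \<le> R" using R Cauchy_Schwarz_ineq2[of x e] e by fastforce
          then show "x \<bullet> e \<in> {- R..R}" by (auto simp: abs_le_iff)
        qed
      qed simp
      then show "AE x in P. x \<in> {- R..R}" unfolding P_def by (subst AE_distr_iff) auto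
    qed
    ultimately show "log_concave_needle P R" by (simp add: log_concave_needle_def)
  qed
  have int: "(\<integral>x. f x \<partial>P) = (LINT x:K|lborel. f (x \<bullet> e)) / V" if "continuous_on UNIV f" for f :: "real \<Rightarrow> real"
  proof -
    have [measurable]: "f \<in> borel_measurable borel" using that by (rule borel_measurable_continuous_onI)
    have "(\<integral>x. f x \<partial>P) = (\<integral>x. f (x \<bullet> e) \<partial>uniform_measure lborel K)"
      unfolding P_def by (rule integral_distr) auto
    also have "uniform_measure lborel K = density lborel (\<lambda>x. ennreal (indicator K x / V))"
      unfolding uniform_measure_def eV using V
      by (intro arg_cong[where f = "density lborel"]) (auto simp: indicator_def divide_ennreal fun_eq_iff simp flip: ennreal_1)
    also have "(\<integral>x. f (x \<bullet> e) \<partial>\<dots>) = (\<integral>x. (indicator K x / V) *\<^sub>R f (x \<bullet> e) \<partial>lborel)"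
      using V by (intro integral_density) auto
    also have "\<dots> = (LINT x:K|lborel. f (x \<bullet> e)) / V"
      unfolding set_lebesgue_integral_def by (simp flip: integral_divide_zero)
    finally show ?thesis .
  qed
  have "ln 2 * ((\<integral>x. f1 x \<partial>P) * (\<integral>x. f2 x \<partial>P)) \<le> (\<integral>x. f3 x \<partial>P) * (\<integral>x. \<bar>x - c\<bar> \<partial>P)"
    by (rule P.needle_inequality[OF f nonneg between])
  moreover have "(\<integral>x. \<bar>x - c\<bar> \<partial>P) = (LINT x:K|lborel. \<bar>x \<bullet> e - c\<bar>) / V"
    by (intro int continuous_intros)
  ultimately show ?thesis using V by (simp add: int f field_simps)
qed

text \<open>\<open>D\<close> prescribes the cuts: the step \<open>n\<close> bisects through the
  point \<open>p\<close>, with a normal from the family spanned by \<open>v\<close> and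
  \<open>w\<close>. Triples for which that family contains 0 are skipped.\<close>

lemma localization_sequence:
  fixes \<Omega> :: "'a::euclidean_space set" and D :: "nat \<Rightarrow> 'a \<times> 'a \<times> 'a" and g1 g2 :: "'a \<Rightarrow> real"
  assumes g: "continuous_on UNIV g1" "continuous_on UNIV g2" and \<Omega>: "open \<Omega>" "bounded \<Omega>" "convex \<Omega>"
    and pos: "0 < (LINT x:\<Omega>|lborel. g1 x)" "0 < (LINT x:\<Omega>|lborel. g2 x)"
  obtains K where "\<And>n. open (K n)" "\<And>n. convex (K n)" "\<And>n. K n \<subseteq> \<Omega>"
    "\<And>n. 0 < (LINT x:K n|lborel. g1 x)" "\<And>n. 0 < (LINT x:K n|lborel. g2 x)" "\<And>n. K (Suc n) \<subseteq> K n"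
    "\<And>n p v w. D n = (p, v, w) \<Longrightarrow> (\<And>t. rotating_normal v w t \<noteq> 0) \<Longrightarrow>
       \<exists>t. K (Suc n) \<subseteq> half_space p (rotating_normal v w t)"
proof -
  define P where "P = (\<lambda>K. open K \<and> convex K \<and> K \<subseteq> \<Omega> \<and> 0 < (LINT x:K|lborel. g1 x) \<and> 0 < (LINT x:K|lborel. g2 x))"
  define Q where "Q = (\<lambda>n K K'. K' \<subseteq> K \<and> (\<forall>p v w. D n = (p, v, w) \<longrightarrow> (\<forall>t. rotating_normal v w t \<noteq> 0) \<longrightarrow>
       (\<exists>t. K' \<subseteq> half_space p (rotating_normal v w t))))"
  have "\<exists>K. \<forall>n. P (K n) \<and> Q n (K n) (K (Suc n))"
  proof (rule dependent_nat_choice[where P = "\<lambda>_. P"])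
    show "\<exists>K. P K" using \<Omega> pos by (auto simp: P_def)
    fix K n assume K: "P K"
    obtain p v w where D: "D n = (p, v, w)" by (metis prod_cases3)
    show "\<exists>K'. P K' \<and> Q n K K'"
    proof (cases "\<forall>t. rotating_normal v w t \<noteq> 0")
      case False
      then show ?thesis using K D by (intro exI[of _ K]) (auto simp: Q_def)
    next
      case True
      have "bounded K" using K \<Omega>(2) bounded_subset by (auto simp: P_def)
      then obtain t where t: "0 < (LINT x:K \<inter> half_space p (rotating_normal v w t)|lborel. g1 x)"
          "0 < (LINT x:K \<inter> half_space p (rotating_normal v w t)|lborel. g2 x)"
        using bisect_by_half_space[OF g, of K v w p] K True by (auto simp: P_def)
      then have "P (K \<inter> half_space p (rotating_normal v w t))"
        using K by (auto simp: P_def open_half_space convex_half_space intro: open_Int convex_Int)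
      moreover have "Q n K (K \<inter> half_space p (rotating_normal v w t))" using D by (auto simp: Q_def)
      ultimately show ?thesis by blast
    qed
  qed
  then obtain K where "\<And>n. P (K n)" "\<And>n. Q n (K n) (K (Suc n))" by blast
  then show ?thesis using that[of K] unfolding P_def Q_def by blast
qed

text \<open>The hypothesis is equality in the Cauchy-Schwarz inequality for all pairs of
  differences. Taking \<open>e\<close> along one nonzero difference, every other difference has no
  component orthogonal to \<open>e\<close>.\<close>

lemma collinear_line:
  fixes L :: "'a::euclidean_space set"
  assumes "L \<noteq> {}"
    and col: "\<And>x y z. x \<in> L \<Longrightarrow> y \<in> L \<Longrightarrow> z \<in> L \<Longrightarrow>
      ((y - x) \<bullet> (z - x))\<^sup>2 = ((y - x) \<bullet> (y - x)) * ((z - x) \<bullet> (z - x))"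
  obtains a e where "norm e = 1" "\<And>z. z \<in> L \<Longrightarrow> z = a + ((z - a) \<bullet> e) *\<^sub>R e"
proof -
  obtain a where a: "a \<in> L" using assms(1) by blast
  show ?thesis
  proof (cases "L = {a}")
    case True
    \<comment> \<open>A single point lies on a line in any direction; a basis vector serves.\<close>
    then show ?thesis using that[of "SOME b. b \<in> Basis" a] by (simp add: norm_Basis some_in_eq)
  next
    case False
    then obtain b where b: "b \<in> L" "b \<noteq> a" using a by blast
    define e where "e = (1 / norm (b - a)) *\<^sub>R (b - a)"
    have e: "norm e = 1" using b by (simp add: e_def)
    have "z = a + ((z - a) \<bullet> e) *\<^sub>R e" if z: "z \<in> L" for z
    proof -
      have "((b - a) \<bullet> (z - a))\<^sup>2 = (norm (b - a))\<^sup>2 * ((z - a) \<bullet> (z - a))"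
        using col[OF a b(1) z] by (simp add: power2_norm_eq_inner)
      then have sq: "((z - a) \<bullet> e)\<^sup>2 = (z - a) \<bullet> (z - a)"
        using b by (simp add: e_def power_divide inner_commute)
      have ee: "e \<bullet> e = 1" using e by (simp add: norm_eq_1)
      define W where "W = z - a"
      \<comment> \<open>The squared length of the component orthogonal to \<open>e\<close>, which
        the equality \<open>sq\<close> makes zero.\<close>
      have "(W - (W \<bullet> e) *\<^sub>R e) \<bullet> (W - (W \<bullet> e) *\<^sub>R e) = W \<bullet> W - (W \<bullet> e)\<^sup>2"
        by (simp add: inner_simps ee inner_commute power2_eq_square algebra_simps)
      then have "(z - a) - ((z - a) \<bullet> e) *\<^sub>R e = 0" using sq by (simp add: W_def)
      then show ?thesis by (simp add: algebra_simps)
    qed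
    then show ?thesis using that e by blast
  qed
qed


text \<open>Cutting along a countable dense set of triples makes the intersection of the closures
  collinear. By compactness some finite stage already lies within \<open>\<delta>\<close> of that
  line, and this stage, still open with both integrals positive, is the needle.\<close>

lemma localization_needle:
  fixes \<Omega> :: "'a::euclidean_space set" and g1 g2 :: "'a \<Rightarrow> real"
  assumes g: "continuous_on UNIV g1" "continuous_on UNIV g2" and \<Omega>: "open \<Omega>" "bounded \<Omega>" "convex \<Omega>"
    and pos: "0 < (LINT x:\<Omega>|lborel. g1 x)" "0 < (LINT x:\<Omega>|lborel. g2 x)" and "0 < \<delta>"
  obtains K a e where "open K" "convex K" "K \<subseteq> \<Omega>" "norm e = 1"
    "0 < (LINT x:K|lborel. g1 x)" "0 < (LINT x:K|lborel. g2 x)"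
    "\<And>x. x \<in> K \<Longrightarrow> norm (x - (a + ((x - a) \<bullet> e) *\<^sub>R e)) < \<delta>"
proof -
  obtain D0 :: "('a \<times> 'a \<times> 'a) set" where D0: "countable D0"
    "\<And>X. open X \<Longrightarrow> X \<noteq> {} \<Longrightarrow> \<exists>d\<in>D0. d \<in> X" using countable_dense_exists by blast
  have "D0 \<noteq> {}" using D0(2)[of UNIV] by auto
  define D where "D = from_nat_into D0"
  have D: "range D = D0" using range_from_nat_into[OF \<open>D0 \<noteq> {}\<close> D0(1)] by (simp add: D_def)
  obtain K where K: "\<And>n. open (K n)" "\<And>n. convex (K n)" "\<And>n. K n \<subseteq> \<Omega>"
    "\<And>n. 0 < (LINT x:K n|lborel. g1 x)" "\<And>n. 0 < (LINT x:K n|lborel. g2 x)" "\<And>n. K (Suc n) \<subseteq> K n"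
    "\<And>n p v w. D n = (p, v, w) \<Longrightarrow> (\<And>t. rotating_normal v w t \<noteq> 0) \<Longrightarrow>
       \<exists>t. K (Suc n) \<subseteq> half_space p (rotating_normal v w t)"
    using localization_sequence[OF g \<Omega> pos, of D] by blast
  define C where "C = (\<lambda>n. closure (K n))"
  have comp: "compact (C n)" for n
    using bounded_subset[OF \<Omega>(2) K(3)] by (simp add: C_def compact_eq_bounded_closed bounded_closure)
  have Kne: "K n \<noteq> {}" for n using K(4)[of n] by (auto simp: set_lebesgue_integral_def)
  have dec: "C n \<subseteq> C m" if "m \<le> n" for m n
    unfolding C_def using lift_Suc_antimono_le[of K, OF K(6) that] by (rule closure_mono)
  define L where "L = (\<Inter>n. C n)"
  have "L \<noteq> {}" unfolding L_def
    using compact_nest[of C] comp dec Kne by (auto simp: C_def)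
  have col: "((y - x) \<bullet> (z - x))\<^sup>2 = ((y - x) \<bullet> (y - x)) * ((z - x) \<bullet> (z - x))"
    if "x \<in> L" "y \<in> L" "z \<in> L" for x y z
  proof (rule collinear_of_cuts[of D0, OF D0(2) _ that])
    fix p v w assume "(p, v, w) \<in> D0" and ind: "\<And>t. rotating_normal v w t \<noteq> 0"
    then obtain n where "D n = (p, v, w)" using D by (metis rangeE)
    then obtain t where t: "K (Suc n) \<subseteq> half_space p (rotating_normal v w t)" using K(7) ind by blast
    have "closed {x. 0 \<le> (x - p) \<bullet> rotating_normal v w t}"
      by (intro closed_Collect_le continuous_intros)
    moreover have "K (Suc n) \<subseteq> {x. 0 \<le> (x - p) \<bullet> rotating_normal v w t}" using t by (auto simp: half_space_def)
    ultimately have "C (Suc n) \<subseteq> {x. 0 \<le> (x - p) \<bullet> rotating_normal v w t}"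
      unfolding C_def by (intro closure_minimal)
    then show "\<exists>t. \<forall>x\<in>L. 0 \<le> (x - p) \<bullet> rotating_normal v w t" by (auto simp: L_def)
  qed
  obtain a e where e: "norm e = 1" "\<And>z. z \<in> L \<Longrightarrow> z = a + ((z - a) \<bullet> e) *\<^sub>R e"
    using collinear_line[OF \<open>L \<noteq> {}\<close> col] by blast
  define r where "r = (\<lambda>x. norm (x - (a + ((x - a) \<bullet> e) *\<^sub>R e)))"
  have "\<exists>n. C n \<inter> {x. \<delta> \<le> r x} = {}"
  proof (rule ccontr)
    assume "\<not> ?thesis"
    moreover have "closed {x. \<delta> \<le> r x}" unfolding r_def by (intro closed_Collect_le continuous_intros)
    ultimately have "(\<Inter>n. C n \<inter> {x. \<delta> \<le> r x}) \<noteq> {}"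
      using comp dec by (intro compact_nest conjI Int_mono compact_Int_closed) auto
    then obtain z where "z \<in> L" "\<delta> \<le> r z" by (auto simp: L_def)
    then show False using e(2) \<open>0 < \<delta>\<close> by (auto simp: r_def)
  qed
  then obtain n where n: "C n \<inter> {x. \<delta> \<le> r x} = {}" by blast
  have "r x < \<delta>" if "x \<in> K n" for x
    using n that closure_subset[of "K n"] by (force simp: C_def)
  then show ?thesis using that[of "K n" e a] K e(1) unfolding r_def by blast
qed

text \<open>Only \<open>x\<close> is confined to \<open>S\<close>, so uniform continuity is taken on
  a ball enlarged by 1, which contains every \<open>y\<close> closer than 1.\<close>

lemma uniformly_close_near_bounded:
  fixes f :: "'a::euclidean_space \<Rightarrow> real"
  assumes f: "continuous_on UNIV f" and S: "bounded S" and "0 < \<omega>"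
  obtains \<delta> where "0 < \<delta>" "\<And>x y. x \<in> S \<Longrightarrow> norm (x - y) < \<delta> \<Longrightarrow> \<bar>f x - f y\<bar> < \<omega>"
proof -
  obtain R where R: "\<And>x. x \<in> S \<Longrightarrow> norm x \<le> R" using S by (auto simp: bounded_iff)
  have "uniformly_continuous_on (cball 0 (R + 1)) f"
    by (intro compact_uniformly_continuous continuous_on_subset[OF f]) auto
  then obtain d where d: "0 < d" "\<And>x y. x \<in> cball 0 (R + 1) \<Longrightarrow> y \<in> cball 0 (R + 1) \<Longrightarrow> dist y x < d \<Longrightarrow> dist (f y) (f x) < \<omega>"
    unfolding uniformly_continuous_on_def using \<open>0 < \<omega>\<close> by meson
  show ?thesis
  proof (rule that[of "min d 1"])
    show "0 < min d 1" using d(1) by simp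
    fix x y assume "x \<in> S" "norm (x - y) < min d 1"
    moreover have "norm y \<le> norm x + norm (x - y)" by (metis norm_triangle_sub norm_minus_commute)
    ultimately show "\<bar>f x - f y\<bar> < \<omega>"
      using d(2)[of y x] R[of x] by (auto simp: dist_norm norm_minus_commute)
  qed
qed

text \<open>The product inequality is split by a multiplier \<open>A\<close> into two linear ones, which is the form that
  bisection preserves. The slack \<open>\<eta>\<close> pays for replacing the functions by their values on the needle, so
  that no limit of needles has to be taken.\<close>

theorem localization_inequality:
  fixes \<Omega> :: "'a::euclidean_space set"
  assumes \<Omega>: "open \<Omega>" "bounded \<Omega>" "convex \<Omega>"
    and f: "continuous_on UNIV f1" "continuous_on UNIV f2" "continuous_on UNIV f3"
    and nonneg: "\<And>x. 0 \<le> f1 x" "\<And>x. 0 \<le> f2 x" "\<And>x. 0 \<le> f3 x"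
    and between: "\<And>a e x y. norm e = 1 \<Longrightarrow> x \<le> y \<Longrightarrow>
      f1 (a + x *\<^sub>R e) * f2 (a + y *\<^sub>R e) + f1 (a + y *\<^sub>R e) * f2 (a + x *\<^sub>R e) \<le> integral {x..y} (\<lambda>t. f3 (a + t *\<^sub>R e))"
  shows "ln 2 * ((LINT x:\<Omega>|lborel. f1 x) * (LINT x:\<Omega>|lborel. f2 x))
    \<le> (LINT x:\<Omega>|lborel. f3 x) * (LINT x:\<Omega>|lborel. norm (x - c))"
proof (rule ccontr)
  assume contr: "\<not> ?thesis"
  have int: "set_integrable lborel S h" if "continuous_on UNIV h" "open S" "S \<subseteq> \<Omega>" for h :: "'a \<Rightarrow> real" and S
    using that bounded_subset[OF \<Omega>(2)] by (intro set_integrable_continuous_bounded) (auto intro: borel_open)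
  have nonneg_int: "0 \<le> (LINT x:S|lborel. h x)" if "\<And>x. 0 \<le> h x" for h :: "'a \<Rightarrow> real" and S :: "'a set"
    unfolding set_lebesgue_integral_def using that by (intro integral_nonneg_AE) (auto simp: indicator_def)
  have cdist: "continuous_on UNIV (\<lambda>x. norm (x - c))" by (intro continuous_intros)
  have cst: "(LINT x:S|lborel. (k::real)) = k * measure lborel S" for k and S :: "'a set"
    by (simp add: set_lebesgue_integral_def mult.commute)
  define I1 I2 I3 J V where "I1 = (LINT x:\<Omega>|lborel. f1 x)" and "I2 = (LINT x:\<Omega>|lborel. f2 x)"
    and "I3 = (LINT x:\<Omega>|lborel. f3 x)" and "J = (LINT x:\<Omega>|lborel. norm (x - c))" and "V = measure lborel \<Omega>"
  have nn: "0 \<le> I1" "0 \<le> I2" "0 \<le> I3" "0 \<le> J" "0 \<le> V"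
    unfolding I1_def I2_def I3_def J_def V_def by (auto intro!: nonneg_int nonneg)
  have lt: "I3 * J < ln 2 * (I1 * I2)" using contr by (simp add: I1_def I2_def I3_def J_def)
  then have "0 < ln 2 * (I1 * I2)" using nn by (meson le_less_trans mult_nonneg_nonneg)
  then have I12: "0 < I1" "0 < I2" using nn by (auto simp: zero_less_mult_iff)
  then have "\<Omega> \<noteq> {}" by (auto simp: I1_def set_lebesgue_integral_def)
  then have V: "0 < V" unfolding V_def using \<Omega> by (intro measure_pos_open)
  have "((\<lambda>\<eta>. (I3 + \<eta> * V) * (J + \<eta> * V)) \<longlongrightarrow> (I3 + 0 * V) * (J + 0 * V)) (at_right 0)"
    by (intro tendsto_intros)
  then have "\<forall>\<^sub>F \<eta> in at_right 0. (I3 + \<eta> * V) * (J + \<eta> * V) < ln 2 * (I1 * I2)"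
    using lt by (intro order_tendstoD(2)) auto
  then have "\<exists>\<eta>>0. (I3 + \<eta> * V) * (J + \<eta> * V) < ln 2 * (I1 * I2)"
    by (metis (mono_tags, lifting) eventually_at_right_field dense)
  then obtain \<eta> where \<eta>: "0 < \<eta>" "(I3 + \<eta> * V) * (J + \<eta> * V) < ln 2 * (I1 * I2)" by blast
  have posV: "0 < I3 + \<eta> * V" "0 < J + \<eta> * V" using \<eta>(1) V nn by (auto intro: add_nonneg_pos)
  have "(J + \<eta> * V) / (ln 2 * I2) < I1 / (I3 + \<eta> * V)"
    using \<eta>(2) posV I12 by (simp add: field_simps)
  \<comment> \<open>Any \<open>A\<close> strictly inside this gap turns the violated product
    inequality into the two strict linear inequalities \<open>A12\<close>, one for each of the
    functions to be bisected.\<close>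
  then obtain A where A: "(J + \<eta> * V) / (ln 2 * I2) < A" "A < I1 / (I3 + \<eta> * V)" using dense by blast
  have "0 < (J + \<eta> * V) / (ln 2 * I2)" using posV I12 by simp
  then have A0: "0 < A" using A(1) by linarith
  define B where "B = A * ln 2"
  have B0: "0 < B" using A0 by (simp add: B_def)
  have A12: "A * (I3 + \<eta> * V) < I1" "J + \<eta> * V < B * I2"
    using A posV I12 by (simp_all add: B_def field_simps)
  define g1 where "g1 = (\<lambda>x. f1 x - A * (f3 x + \<eta>))"
  define g2 where "g2 = (\<lambda>x. B * f2 x - (norm (x - c) + \<eta>))"
  have g: "continuous_on UNIV g1" "continuous_on UNIV g2"
    unfolding g1_def g2_def by (intro continuous_intros f)+
  have G1: "(LINT x:S|lborel. g1 x) = (LINT x:S|lborel. f1 x) - A * ((LINT x:S|lborel. f3 x) + \<eta> * measure lborel S)"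
    if "open S" "S \<subseteq> \<Omega>" for S
    unfolding g1_def using int[OF _ that] f
    by (simp add: set_integral_diff set_integral_add cst continuous_on_add continuous_on_mult_left)
  have G2: "(LINT x:S|lborel. g2 x) = B * (LINT x:S|lborel. f2 x) - ((LINT x:S|lborel. norm (x - c)) + \<eta> * measure lborel S)"
    if "open S" "S \<subseteq> \<Omega>" for S
    unfolding g2_def using int[OF _ that] f cdist
    by (simp add: set_integral_diff set_integral_add cst continuous_on_add continuous_on_mult_left)
  have pos: "0 < (LINT x:\<Omega>|lborel. g1 x)" "0 < (LINT x:\<Omega>|lborel. g2 x)"
    using G1[OF \<Omega>(1)] G2[OF \<Omega>(1)] A12 by (simp_all add: I1_def I2_def I3_def J_def V_def)
  \<comment> \<open>Small enough that on the needle the errors in \<open>f1\<close> and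
    \<open>f3\<close> are paid by the slack \<open>A * \<eta>\<close> in \<open>g1\<close>, and the
    error in \<open>f2\<close> by the slack \<open>\<eta>\<close> in \<open>g2\<close>.\<close>
  define \<omega> where "\<omega> = min (A * \<eta>) \<eta> / (1 + A + B)"
  have \<omega>: "0 < \<omega>" "\<omega> * (1 + A) \<le> A * \<eta>" "\<omega> * (1 + B) \<le> \<eta>"
  proof -
    have m: "0 < min (A * \<eta>) \<eta>" using A0 \<eta>(1) by simp
    have s: "\<omega> * (1 + A + B) = min (A * \<eta>) \<eta>" using A0 B0 by (simp add: \<omega>_def)
    show w: "0 < \<omega>" using m A0 B0 by (simp add: \<omega>_def)
    have "\<omega> * (1 + A) \<le> \<omega> * (1 + A + B)" "\<omega> * (1 + B) \<le> \<omega> * (1 + A + B)"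
      using w A0 B0 by (auto intro!: mult_left_mono)
    then show "\<omega> * (1 + A) \<le> A * \<eta>" "\<omega> * (1 + B) \<le> \<eta>" unfolding s by auto
  qed
  obtain \<delta>1 where d1: "0 < \<delta>1" "\<And>x y. x \<in> \<Omega> \<Longrightarrow> norm (x - y) < \<delta>1 \<Longrightarrow> \<bar>f1 x - f1 y\<bar> < \<omega>"
    using uniformly_close_near_bounded[OF f(1) \<Omega>(2) \<omega>(1)] by blast
  obtain \<delta>2 where d2: "0 < \<delta>2" "\<And>x y. x \<in> \<Omega> \<Longrightarrow> norm (x - y) < \<delta>2 \<Longrightarrow> \<bar>f2 x - f2 y\<bar> < \<omega>"
    using uniformly_close_near_bounded[OF f(2) \<Omega>(2) \<omega>(1)] by blast
  obtain \<delta>3 where d3: "0 < \<delta>3" "\<And>x y. x \<in> \<Omega> \<Longrightarrow> norm (x - y) < \<delta>3 \<Longrightarrow> \<bar>f3 x - f3 y\<bar> < \<omega>"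
    using uniformly_close_near_bounded[OF f(3) \<Omega>(2) \<omega>(1)] by blast
  define \<delta> where "\<delta> = min (min \<delta>1 \<delta>2) (min \<delta>3 \<omega>)"
  have \<delta>: "0 < \<delta>" using d1(1) d2(1) d3(1) \<omega>(1) by (simp add: \<delta>_def)
  obtain K e a where K: "open K" "convex K" "K \<subseteq> \<Omega>" and e: "norm e = 1"
    and Kpos: "0 < (LINT x:K|lborel. g1 x)" "0 < (LINT x:K|lborel. g2 x)"
    and thin: "\<And>x. x \<in> K \<Longrightarrow> norm (x - (a + ((x - a) \<bullet> e) *\<^sub>R e)) < \<delta>"
    by (rule localization_needle[OF g \<Omega> pos \<delta>]) (rule that)
  have bK: "bounded K" using K(3) \<Omega>(2) bounded_subset by blast
  have Kne: "K \<noteq> {}" using Kpos(1) by (auto simp: set_lebesgue_integral_def)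
  \<comment> \<open>The base point is moved along the axis until it is orthogonal to
    \<open>e\<close>. The projection of \<open>x\<close> is then
    \<open>\<pi> (x \<bullet> e)\<close>, parametrised by the coordinate that occurs in the needle
    inequality.\<close>
  define a' where "a' = a - (a \<bullet> e) *\<^sub>R e"
  define \<pi> where "\<pi> = (\<lambda>t. a' + t *\<^sub>R e)"
  have \<pi>: "a + ((x - a) \<bullet> e) *\<^sub>R e = \<pi> (x \<bullet> e)" for x
    by (simp add: \<pi>_def a'_def algebra_simps inner_simps)
  have ee: "e \<bullet> e = 1" using e by (simp add: norm_eq_1)
  have close: "norm (x - \<pi> (x \<bullet> e)) < \<delta>" if "x \<in> K" for x using thin[OF that] by (simp add: \<pi>)
  have c\<pi>: "continuous_on UNIV (\<lambda>x. \<pi> (x \<bullet> e))" "continuous_on UNIV \<pi>" unfolding \<pi>_def by (intro continuous_intros)+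
  have cf: "continuous_on UNIV (\<lambda>x. h (\<pi> (x \<bullet> e)))" "continuous_on UNIV (\<lambda>t. h (\<pi> t))"
    if "continuous_on UNIV h" for h :: "'a \<Rightarrow> real"
    by (rule continuous_on_compose2[OF that c\<pi>(1)], simp) (rule continuous_on_compose2[OF that c\<pi>(2)], simp)
  define W where "W = measure lborel K"
  have W: "0 < W" unfolding W_def by (rule measure_pos_open[OF K(1) Kne bK])
  note intK = int[OF _ K(1,3)]
  define N1 N2 N3 T where "N1 = (LINT x:K|lborel. f1 (\<pi> (x \<bullet> e)))" and "N2 = (LINT x:K|lborel. f2 (\<pi> (x \<bullet> e)))"
    and "N3 = (LINT x:K|lborel. f3 (\<pi> (x \<bullet> e)))" and "T = (LINT x:K|lborel. \<bar>x \<bullet> e - c \<bullet> e\<bar>)"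
  have cT: "continuous_on UNIV (\<lambda>x. \<bar>x \<bullet> e - c \<bullet> e\<bar>)" by (intro continuous_intros)
  have sm: "(LINT x:K|lborel. h x) \<le> (LINT x:K|lborel. k x) + \<omega> * W"
    if "continuous_on UNIV h" "continuous_on UNIV k" "\<And>x. x \<in> K \<Longrightarrow> h x \<le> k x + \<omega>" for h k :: "'a \<Rightarrow> real"
  proof -
    have "(LINT x:K|lborel. h x) \<le> (LINT x:K|lborel. k x + \<omega>)"
      by (rule set_integral_mono[OF intK[OF that(1)] intK that(3)]) (intro continuous_intros that)
    also have "\<dots> = (LINT x:K|lborel. k x) + \<omega> * W"
      using intK[OF that(2)] intK[of "\<lambda>_. \<omega>"] by (simp add: set_integral_add cst W_def)
    finally show ?thesis .
  qed
  have near1: "\<bar>f1 x - f1 (\<pi> (x \<bullet> e))\<bar> < \<omega>" and near2: "\<bar>f2 x - f2 (\<pi> (x \<bullet> e))\<bar> < \<omega>"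
    and near3: "\<bar>f3 x - f3 (\<pi> (x \<bullet> e))\<bar> < \<omega>" if "x \<in> K" for x
  proof -
    have "x \<in> \<Omega>" using that K(3) by blast
    moreover have "norm (x - \<pi> (x \<bullet> e)) < \<delta>1" "norm (x - \<pi> (x \<bullet> e)) < \<delta>2" "norm (x - \<pi> (x \<bullet> e)) < \<delta>3"
      using close[OF that] by (simp_all add: \<delta>_def)
    ultimately show "\<bar>f1 x - f1 (\<pi> (x \<bullet> e))\<bar> < \<omega>" "\<bar>f2 x - f2 (\<pi> (x \<bullet> e))\<bar> < \<omega>" "\<bar>f3 x - f3 (\<pi> (x \<bullet> e))\<bar> < \<omega>"
      using d1(2) d2(2) d3(2) by blast+
  qed
  have s1: "(LINT x:K|lborel. f1 x) \<le> N1 + \<omega> * W"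
    unfolding N1_def by (intro sm f cf) (use near1 in \<open>force simp: abs_less_iff\<close>)
  have s2: "(LINT x:K|lborel. f2 x) \<le> N2 + \<omega> * W"
    unfolding N2_def by (intro sm f cf) (use near2 in \<open>force simp: abs_less_iff\<close>)
  have s3: "N3 \<le> (LINT x:K|lborel. f3 x) + \<omega> * W"
    unfolding N3_def by (intro sm f cf) (use near3 in \<open>force simp: abs_less_iff\<close>)
  \<comment> \<open>Projection onto the direction \<open>e\<close> can only shrink the distance to
    \<open>c\<close>. This factor therefore carries no approximation error, wherever
    \<open>c\<close> lies.\<close>
  have "\<bar>x \<bullet> e - c \<bullet> e\<bar> \<le> norm (x - c)" for x
    using Cauchy_Schwarz_ineq2[of "x - c" e] e by (simp add: inner_diff_left)
  then have s4: "T \<le> (LINT x:K|lborel. norm (x - c))"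
    unfolding T_def by (intro set_integral_mono intK cT cdist) auto
  have "A * N3 < N1"
  proof -
    have "A * N3 \<le> A * ((LINT x:K|lborel. f3 x) + \<omega> * W)" using s3 A0 by (intro mult_left_mono) auto
    also have "\<dots> < N1 + \<omega> * W + A * \<omega> * W - A * \<eta> * W"
      using G1[OF K(1,3)] Kpos(1) s1 by (simp add: W_def algebra_simps)
    also have "\<dots> = N1 + (\<omega> * (1 + A) - A * \<eta>) * W" by (simp add: algebra_simps)
    also have "\<dots> \<le> N1" using \<omega>(2) W by (simp add: mult_nonpos_nonneg)
    finally show ?thesis .
  qed
  moreover have "T < B * N2"
  proof -
    have "B * (LINT x:K|lborel. f2 x) \<le> B * (N2 + \<omega> * W)" using s2 B0 by (intro mult_left_mono) auto
    then have "T < B * N2 + (B * \<omega> - \<eta>) * W"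
      using G2[OF K(1,3)] Kpos(2) s4 by (simp add: W_def algebra_simps)
    also have "\<dots> \<le> B * N2"
    proof -
      have "B * \<omega> \<le> \<eta>" using \<omega>(1,3) by (simp add: algebra_simps)
      then show ?thesis using W by (simp add: mult_nonpos_nonneg)
    qed
    finally show ?thesis .
  qed
  moreover have "0 \<le> N3" "0 \<le> T" unfolding N3_def T_def by (auto intro!: nonneg_int nonneg)
  \<comment> \<open>The product of the two linear inequalities no longer depends on the multiplier:
    \<open>B = A * ln 2\<close>, and \<open>A\<close> cancels.\<close>
  ultimately have "(A * N3) * T < N1 * (B * N2)" using A0 by (intro mult_strict_mono') auto
  then have "A * (N3 * T) < A * (ln 2 * (N1 * N2))" by (simp add: B_def mult_ac)
  then have "N3 * T < ln 2 * (N1 * N2)" using A0 by simp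
  moreover have "ln 2 * (N1 * N2) \<le> N3 * T"
    unfolding N1_def N2_def N3_def T_def
    by (rule needle_inequality_body[of K e "\<lambda>t. f1 (\<pi> t)" "\<lambda>t. f2 (\<pi> t)" "\<lambda>t. f3 (\<pi> t)"])
      (use K bK Kne e cf f nonneg between[OF e] in \<open>auto simp: \<pi>_def\<close>)
  ultimately show False by linarith
qed

section \<open>The Poincare inequality for continuously differentiable functions\<close>

text \<open>The hat function \<open>max 0 (1 - \<bar>s\<bar>)\<close>, written as a second
  difference of the absolute value, so that sums of its integer translates telescope and a primitive
  is explicit.\<close>

definition tent :: "real \<Rightarrow> real" where
  "tent s = (\<bar>s + 1\<bar> + \<bar>s - 1\<bar> - 2 * \<bar>s\<bar>) / 2"

definition clamp01 :: "real \<Rightarrow> real" where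
  "clamp01 s = max 0 (min 1 s)"

lemma clamp01_bounds: "0 \<le> clamp01 s" "clamp01 s \<le> 1" "s \<le> 0 \<Longrightarrow> clamp01 s = 0" "1 \<le> s \<Longrightarrow> clamp01 s = 1"
  by (auto simp: clamp01_def)

lemma tent_nonneg: "0 \<le> tent s"
  unfolding tent_def by (simp add: abs_if)

lemma continuous_on_tent [continuous_intros]:
  "continuous_on S f \<Longrightarrow> continuous_on S (\<lambda>x. tent (f x))"
  unfolding tent_def by (intro continuous_intros)  auto

lemma continuous_on_clamp01 [continuous_intros]:
  "continuous_on S f \<Longrightarrow> continuous_on S (\<lambda>x. clamp01 (f x))"
  unfolding clamp01_def by (intro continuous_intros)

lemma has_derivative_square_sign: "((\<lambda>s. s * \<bar>s\<bar> / 2) has_real_derivative \<bar>s\<bar>) (at s)"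
proof -
  consider "s > 0" | "s < 0" | "s = 0" by linarith
  then show ?thesis
  proof cases
    case 1
    have "((\<lambda>s. s * s / 2) has_real_derivative \<bar>s\<bar>) (at s)"
      using 1 by (auto intro!: derivative_eq_intros)
    moreover have "\<forall>\<^sub>F x in nhds s. x * x / 2 = x * \<bar>x\<bar> / 2"
      using eventually_nhds_in_open[of "{0<..}" s] 1 by (auto elim!: eventually_mono)
    ultimately show ?thesis by (subst (asm) DERIV_cong_ev[OF refl _ refl]) auto
  next
    case 2
    have "((\<lambda>s. - (s * s) / 2) has_real_derivative \<bar>s\<bar>) (at s)"
      using 2 by (auto intro!: derivative_eq_intros)
    moreover have "\<forall>\<^sub>F x in nhds s. - (x * x) / 2 = x * \<bar>x\<bar> / 2"
      using eventually_nhds_in_open[of "{..<0}" s] 2 by (auto elim!: eventually_mono)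
    ultimately show ?thesis by (subst (asm) DERIV_cong_ev[OF refl _ refl]) auto
  next
    case 3
    have "(\<lambda>h::real. \<bar>h\<bar> / 2) \<midarrow>0\<rightarrow> 0" by (auto intro!: tendsto_eq_intros)
    then have "(\<lambda>h::real. (h * \<bar>h\<bar> / 2) / h) \<midarrow>0\<rightarrow> 0"
      by (rule Lim_transform_eventually) (auto simp: eventually_at_filter)
    then show ?thesis using 3 by (simp add: DERIV_def)
  qed
qed

text \<open>The same second difference, applied to the primitive
  \<open>s * \<bar>s\<bar> / 2\<close> of the absolute value. It rises from -1/2 to 1/2 across the
  support of \<open>tent\<close>, a total increase of exactly 1.\<close>

definition tent_primitive :: "real \<Rightarrow> real" where
  "tent_primitive s = ((s + 1) * \<bar>s + 1\<bar> / 2 + (s - 1) * \<bar>s - 1\<bar> / 2 - 2 * (s * \<bar>s\<bar> / 2)) / 2"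

lemma tent_primitive_deriv: "(tent_primitive has_real_derivative tent s) (at s)"
proof -
  have "((\<lambda>x. x + 1) has_real_derivative 1) (at s)" "((\<lambda>x. x - 1) has_real_derivative 1) (at s)"
    by (auto intro!: derivative_eq_intros)
  from DERIV_chain'[OF this(1) has_derivative_square_sign] DERIV_chain'[OF this(2) has_derivative_square_sign]
  have "((\<lambda>x. (x + 1) * \<bar>x + 1\<bar> / 2) has_real_derivative \<bar>s + 1\<bar>) (at s)"
    "((\<lambda>x. (x - 1) * \<bar>x - 1\<bar> / 2) has_real_derivative \<bar>s - 1\<bar>) (at s)"
    by simp_all
  then show ?thesis
    unfolding tent_primitive_def[abs_def] tent_def
    by (intro DERIV_cdivide DERIV_add DERIV_diff DERIV_cmult has_derivative_square_sign)
qed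

lemma tent_primitive_outside: "1 \<le> s \<Longrightarrow> tent_primitive s = 1 / 2" "s \<le> - 1 \<Longrightarrow> tent_primitive s = - 1 / 2"
  unfolding tent_primitive_def by (simp_all add: abs_of_nonneg abs_of_nonpos field_simps)

text \<open>The translates form part of a partition of unity. The second differences telescope to a
  trapezoid of height at most 1.\<close>

lemma sum_tent_le_1: "(\<Sum>i\<in>{- int N..int N}. tent (s - of_int i)) \<le> 1"
proof -
  have "(\<Sum>i\<in>{- int N..int N}. tent (s - of_int i))
    = (\<bar>s + real N + 1\<bar> - \<bar>s + real N\<bar> + \<bar>s - real N - 1\<bar> - \<bar>s - real N\<bar>) / 2"
  proof (induction N)
    case 0
    then show ?case by (simp add: tent_def)
  next
    case (Suc N)
    have "{- int (Suc N)..int (Suc N)} = insert (- int (Suc N)) (insert (int (Suc N)) {- int N..int N})" by auto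
    then have "(\<Sum>i\<in>{- int (Suc N)..int (Suc N)}. tent (s - of_int i))
      = tent (s + real N + 1) + tent (s - real N - 1) + (\<Sum>i\<in>{- int N..int N}. tent (s - of_int i))"
      by (simp add: algebra_simps)
    also have "\<dots> = (\<bar>s + real (Suc N) + 1\<bar> - \<bar>s + real (Suc N)\<bar> + \<bar>s - real (Suc N) - 1\<bar> - \<bar>s - real (Suc N)\<bar>) / 2"
      unfolding Suc.IH by (simp add: tent_def add_divide_distrib diff_divide_distrib algebra_simps)
    finally show ?case .
  qed
  also have "\<dots> \<le> 1"
  proof -
    have "\<bar>s + real N + 1\<bar> \<le> \<bar>s + real N\<bar> + 1" "\<bar>s - real N - 1\<bar> \<le> \<bar>s - real N\<bar> + 1" by linarith+
    moreover have "(p - q + r - t) / 2 \<le> 1" if "p \<le> q + 1" "r \<le> t + 1" for p q r t :: real using that by simp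
    ultimately show ?thesis by blast
  qed
  finally show ?thesis .
qed

text \<open>If \<open>y < x\<close>, an integer \<open>i\<close> contributes a full 1 once it is at
  least 2 away from both ends of the interval. Two units are lost at each end and at most one to
  rounding, hence the 5.\<close>

lemma sum_clamp_lower:
  fixes x y :: real
  assumes "\<bar>x\<bar> \<le> real N" "\<bar>y\<bar> \<le> real N"
  shows "\<bar>x - y\<bar> - 5 \<le> (\<Sum>i\<in>{- int N..int N}. clamp01 (x - i - 1) * clamp01 (i - 1 - y) + clamp01 (y - i - 1) * clamp01 (i - 1 - x))"
proof -
  have *: "x - y - 5 \<le> (\<Sum>i\<in>{- int N..int N}. clamp01 (x - i - 1) * clamp01 (i - 1 - y))"
    if "\<bar>x\<bar> \<le> real N" "\<bar>y\<bar> \<le> real N" for x y :: real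
  proof -
    \<comment> \<open>The integers for which both clamped factors equal 1.\<close>
    define S where "S = {\<lceil>y + 2\<rceil>..\<lfloor>x - 2\<rfloor>}"
    have sub: "S \<subseteq> {- int N..int N}"
      using that unfolding S_def by (auto simp: le_floor_iff ceiling_le_iff abs_le_iff; linarith)
    have "x - y - 5 \<le> real (card S)"
      unfolding S_def by simp linarith
    also have "real (card S) = (\<Sum>i\<in>S. 1)" by simp
    also have "\<dots> \<le> (\<Sum>i\<in>S. clamp01 (x - i - 1) * clamp01 (i - 1 - y))"
    proof (rule sum_mono)
      fix i assume "i \<in> S"
      then have "1 \<le> x - i - 1" "1 \<le> i - 1 - y" unfolding S_def by (auto; linarith)+
      then show "1 \<le> clamp01 (x - i - 1) * clamp01 (i - 1 - y)" by (simp add: clamp01_bounds(4))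
    qed
    also have "\<dots> \<le> (\<Sum>i\<in>{- int N..int N}. clamp01 (x - i - 1) * clamp01 (i - 1 - y))"
      using sub by (intro sum_mono2) (auto simp: clamp01_bounds)
    finally show ?thesis .
  qed
  have nn: "0 \<le> (\<Sum>i\<in>{- int N..int N}. clamp01 (x - i - 1) * clamp01 (i - 1 - y))" for x y :: real
    by (intro sum_nonneg) (simp add: clamp01_bounds)
  show ?thesis
    unfolding sum.distrib using *[OF assms] *[OF assms(2,1)] nn[of x y] nn[of y x] by linarith
qed

text \<open>The hypothesis \<open>between\<close> of the localization, for the band around
  \<open>i\<close>. A product on the left is nonzero only if \<open>w\<close> crosses from above
  \<open>i + 1\<close> to below \<open>i - 1\<close> along the segment; the primitive of the tent,
  evaluated at \<open>w - i\<close>, then changes by 1, and the chain rule bounds this change by the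
  integral on the right.\<close>

lemma band_pair_le:
  fixes w :: "'a::euclidean_space \<Rightarrow> real" and Gr :: "'a \<Rightarrow> 'a"
  assumes w: "\<And>x. (w has_derivative (\<lambda>h. Gr x \<bullet> h)) (at x)" and Gr: "continuous_on UNIV Gr"
    and e: "norm e = 1" and xy: "x \<le> y"
  shows "clamp01 (w (a + x *\<^sub>R e) - i - 1) * clamp01 (i - 1 - w (a + y *\<^sub>R e))
       + clamp01 (w (a + y *\<^sub>R e) - i - 1) * clamp01 (i - 1 - w (a + x *\<^sub>R e))
     \<le> integral {x..y} (\<lambda>t. norm (Gr (a + t *\<^sub>R e)) * tent (w (a + t *\<^sub>R e) - i))"
proof -
  define l where "l = (\<lambda>t. w (a + t *\<^sub>R e))"
  define F where "F = (\<lambda>t. norm (Gr (a + t *\<^sub>R e)) * tent (l t - i))"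
  have l: "(l has_real_derivative (Gr (a + t *\<^sub>R e) \<bullet> e)) (at t)" for t
  proof -
    have "((\<lambda>t. a + t *\<^sub>R e) has_derivative (\<lambda>h. h *\<^sub>R e)) (at t)"
      by (auto intro!: derivative_eq_intros)
    from has_derivative_compose[OF this w] have "(l has_derivative (\<lambda>h. Gr (a + t *\<^sub>R e) \<bullet> (h *\<^sub>R e))) (at t)"
      by (simp add: l_def)
    then show ?thesis
      unfolding has_field_derivative_def by (rule has_derivative_eq_rhs) (simp add: fun_eq_iff)
  qed
  have cl: "continuous_on UNIV l" using l by (meson DERIV_continuous_on has_field_derivative_at_within)
  have cG: "continuous_on UNIV (\<lambda>t. Gr (a + t *\<^sub>R e))"
    by (intro continuous_on_compose2[OF Gr] continuous_intros) auto
  have cF: "continuous_on A F" for A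
    unfolding F_def by (rule continuous_on_subset[of UNIV]) (auto intro!: continuous_intros cG cl)
  have F0: "0 \<le> F t" for t by (simp add: F_def tent_nonneg)
  have prim: "\<bar>tent_primitive (l y - i) - tent_primitive (l x - i)\<bar> \<le> integral {x..y} F"
  proof -
    have "((\<lambda>t. tent (l t - i) * (Gr (a + t *\<^sub>R e) \<bullet> e)) has_integral tent_primitive (l y - i) - tent_primitive (l x - i)) {x..y}"
    proof (rule fundamental_theorem_of_calculus[OF xy])
      fix t assume "t \<in> {x..y}"
      have "((\<lambda>t. l t - i) has_real_derivative (Gr (a + t *\<^sub>R e) \<bullet> e)) (at t)"
        using DERIV_diff[OF l DERIV_const] by simp
      from DERIV_chain'[OF this tent_primitive_deriv]
      have "((\<lambda>t. tent_primitive (l t - i)) has_real_derivative tent (l t - i) * (Gr (a + t *\<^sub>R e) \<bullet> e)) (at t)"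
        by (simp add: mult.commute)
      then show "((\<lambda>t. tent_primitive (l t - i)) has_vector_derivative tent (l t - i) * (Gr (a + t *\<^sub>R e) \<bullet> e)) (at t within {x..y})"
        using has_field_derivative_at_within by (simp flip: has_real_derivative_iff_has_vector_derivative)
    qed
    moreover have "norm (integral {x..y} (\<lambda>t. tent (l t - i) * (Gr (a + t *\<^sub>R e) \<bullet> e))) \<le> integral {x..y} F"
    proof (rule integral_norm_bound_integral)
      show "(\<lambda>t. tent (l t - i) * (Gr (a + t *\<^sub>R e) \<bullet> e)) integrable_on {x..y}"
        using calculation by blast
      show "F integrable_on {x..y}" by (intro integrable_continuous_interval cF)
      show "norm (tent (l t - i) * (Gr (a + t *\<^sub>R e) \<bullet> e)) \<le> F t" if "t \<in> {x..y}" for t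
        using Cauchy_Schwarz_ineq2[of "Gr (a + t *\<^sub>R e)" e] e tent_nonneg[of "l t - i"]
        by (simp add: F_def abs_mult mult.commute[of "norm _"] mult_left_mono)
    qed
    ultimately show ?thesis by (simp add: integral_unique)
  qed
  have cross: "clamp01 p * clamp01 q \<le> 1" for p q
    using clamp01_bounds[of p] clamp01_bounds[of q] by (simp add: mult_le_one)
  \<comment> \<open>A crossing downwards, a crossing upwards, or none; at most one of the two
    products survives.\<close>
  consider "l x - i \<ge> 1" "l y - i \<le> - 1" | "l y - i \<ge> 1" "l x - i \<le> - 1"
    | "clamp01 (l x - i - 1) * clamp01 (i - 1 - l y) = 0" "clamp01 (l y - i - 1) * clamp01 (i - 1 - l x) = 0"
  proof -
    have "clamp01 (p - i - 1) * clamp01 (i - 1 - q) = 0" if "\<not> (1 \<le> p - i \<and> q - i \<le> - 1)" for p q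
    proof -
      have "p - i - 1 \<le> 0 \<or> i - 1 - q \<le> 0" using that by linarith
      then show ?thesis using clamp01_bounds(3) by auto
    qed
    then show ?thesis using that by blast
  qed
  then have "clamp01 (l x - i - 1) * clamp01 (i - 1 - l y) + clamp01 (l y - i - 1) * clamp01 (i - 1 - l x) \<le> integral {x..y} F"
  proof cases
    case 1
    then have "1 \<le> integral {x..y} F" using prim by (simp add: tent_primitive_outside)
    moreover have "clamp01 (l y - i - 1) = 0" using 1 by (intro clamp01_bounds(3)) simp
    ultimately show ?thesis using cross[of "l x - i - 1" "i - 1 - l y"] by simp
  next
    case 2
    then have "1 \<le> integral {x..y} F" using prim by (simp add: tent_primitive_outside)
    moreover have "clamp01 (l x - i - 1) = 0" using 2 by (intro clamp01_bounds(3)) simp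
    ultimately show ?thesis using cross[of "l y - i - 1" "i - 1 - l x"] by simp
  next
    case 3
    have "0 \<le> integral {x..y} F"
      using F0 cF by (intro Henstock_Kurzweil_Integration.integral_nonneg integrable_continuous_interval) auto
    then show ?thesis unfolding 3 by simp
  qed
  then show ?thesis by (simp add: l_def F_def)
qed

text \<open>The error term does not involve \<open>w\<close>, hence disappears on applying the estimate to \<open>w = n * u\<close>.\<close>

lemma poincare_unit_mesh:
  fixes \<Omega> :: "'a::euclidean_space set" and w :: "'a \<Rightarrow> real" and Gr :: "'a \<Rightarrow> 'a"
  assumes \<Omega>: "open \<Omega>" "bounded \<Omega>" "convex \<Omega>"
    and w: "\<And>x. (w has_derivative (\<lambda>h. Gr x \<bullet> h)) (at x)" and Gr: "continuous_on UNIV Gr"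
  shows "(LINT x:\<Omega>|lborel. \<bar>measure lborel \<Omega> * w x - (LINT z:\<Omega>|lborel. w z)\<bar>) - 5 * (measure lborel \<Omega>)\<^sup>2
    \<le> (2 / ln 2) * (LINT x:\<Omega>|lborel. norm (x - c)) * (LINT x:\<Omega>|lborel. norm (Gr x))"
proof -
  have int: "set_integrable lborel \<Omega> h" if "continuous_on UNIV h" for h :: "'a \<Rightarrow> real"
    using that \<Omega> by (intro set_integrable_continuous_bounded) (auto intro: borel_open)
  have cst: "(LINT x:\<Omega>|lborel. (k::real)) = k * measure lborel \<Omega>" for k
    by (simp add: set_lebesgue_integral_def mult.commute)
  have cw: "continuous_on UNIV w"
    using w by (meson has_derivative_continuous_on has_derivative_at_withinI)
  define V J m where "V = measure lborel \<Omega>" and "J = (LINT x:\<Omega>|lborel. norm (x - c))" and "m = (LINT z:\<Omega>|lborel. w z)"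
  have J: "0 \<le> J" unfolding J_def set_lebesgue_integral_def by (intro integral_nonneg_AE) (auto simp: indicator_def)
  have "compact (w ` closure \<Omega>)"
    using \<Omega>(2) by (intro compact_continuous_image continuous_on_subset[OF cw])
      (auto simp: compact_eq_bounded_closed bounded_closure)
  then obtain B where B: "\<And>x. x \<in> closure \<Omega> \<Longrightarrow> \<bar>w x\<bar> \<le> B"
    using compact_imp_bounded bounded_iff by (metis imageI real_norm_def)
  \<comment> \<open>As \<open>w\<close> is bounded on the domain, finitely many bands
    suffice.\<close>
  define N where "N = nat \<lceil>B\<rceil>"
  have N: "\<bar>w x\<bar> \<le> real N" if "x \<in> \<Omega>" for x
  proof -
    have "\<bar>w x\<bar> \<le> B" using B[of x] that closure_subset[of \<Omega>] by blast
    also have "B \<le> real N" unfolding N_def by linarith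
    finally show ?thesis .
  qed
  define I where "I = {- int N..int N}"
  define f1 f2 f3 where "f1 = (\<lambda>(i::int) x. clamp01 (w x - i - 1))" and "f2 = (\<lambda>(i::int) x. clamp01 (i - 1 - w x))"
    and "f3 = (\<lambda>(i::int) x. norm (Gr x) * tent (w x - i))"
  have cf: "continuous_on UNIV (f1 i)" "continuous_on UNIV (f2 i)" "continuous_on UNIV (f3 i)" for i
    unfolding f1_def f2_def f3_def by (intro continuous_intros cw Gr)+
  define A1 A2 where "A1 = (\<lambda>i. LINT x:\<Omega>|lborel. f1 i x)" and "A2 = (\<lambda>i. LINT x:\<Omega>|lborel. f2 i x)"
  have loc: "ln 2 * (A1 i * A2 i) \<le> (LINT x:\<Omega>|lborel. f3 i x) * J" for i
    unfolding A1_def A2_def J_def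
  proof (rule localization_inequality[OF \<Omega> cf])
    show "f1 i (a + x *\<^sub>R e) * f2 i (a + y *\<^sub>R e) + f1 i (a + y *\<^sub>R e) * f2 i (a + x *\<^sub>R e)
        \<le> integral {x..y} (\<lambda>t. f3 i (a + t *\<^sub>R e))" if "norm e = 1" "x \<le> y" for a e x y
      unfolding f1_def f2_def f3_def by (rule band_pair_le[OF w Gr that])
  qed (auto simp: f1_def f2_def f3_def clamp01_bounds tent_nonneg)
  have sumint: "(LINT x:\<Omega>|lborel. (\<Sum>i\<in>I. h i x)) = (\<Sum>i\<in>I. LINT x:\<Omega>|lborel. h i x)"
    if "\<And>i. continuous_on UNIV (h i)" for h :: "int \<Rightarrow> 'a \<Rightarrow> real"
    using int[OF that] unfolding set_lebesgue_integral_def set_integrable_def scaleR_sum_right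
    by (intro Bochner_Integration.integral_sum)
  \<comment> \<open>The bands share the gradient: their tents add up to at most 1, so summing over
    \<open>i\<close> does not enlarge the integral of \<open>norm (Gr x)\<close>.\<close>
  have upper: "ln 2 * (\<Sum>i\<in>I. A1 i * A2 i) \<le> J * (LINT x:\<Omega>|lborel. norm (Gr x))"
  proof -
    have "ln 2 * (\<Sum>i\<in>I. A1 i * A2 i) \<le> (\<Sum>i\<in>I. (LINT x:\<Omega>|lborel. f3 i x) * J)"
      unfolding sum_distrib_left by (rule sum_mono[OF loc])
    also have "\<dots> = J * (LINT x:\<Omega>|lborel. (\<Sum>i\<in>I. f3 i x))"
      by (simp add: sumint[OF cf(3)] sum_distrib_left mult.commute)
    also have "\<dots> \<le> J * (LINT x:\<Omega>|lborel. norm (Gr x))"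
    proof (intro mult_left_mono J set_integral_mono int)
      show "continuous_on UNIV (\<lambda>x. \<Sum>i\<in>I. f3 i x)" by (intro continuous_intros cf)
      show "continuous_on UNIV (\<lambda>x. norm (Gr x))" by (intro continuous_intros Gr)
      show "(\<Sum>i\<in>I. f3 i x) \<le> norm (Gr x)" for x
        using sum_tent_le_1[where s = "w x" and N = N] mult_left_mono[of _ 1 "norm (Gr x)"]
        by (simp add: f3_def I_def flip: sum_distrib_left)
    qed
    finally show ?thesis .
  qed
  \<comment> \<open>The deviation from the mean is an average over \<open>y\<close> of
    \<open>w x - w y\<close>. The pointwise count of bands is integrated over \<open>y\<close> with
    \<open>x\<close> fixed.\<close>
  have inner: "\<bar>V * w x - m\<bar> - 5 * V \<le> (\<Sum>i\<in>I. f1 i x * A2 i + A1 i * f2 i x)" if x: "x \<in> \<Omega>" for x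
  proof -
    have "\<bar>V * w x - m\<bar> = \<bar>LINT y:\<Omega>|lborel. w x - w y\<bar>"
      using int[OF cw] int[of "\<lambda>_. w x"] by (simp add: set_integral_diff cst V_def m_def mult.commute)
    also have "\<dots> \<le> (LINT y:\<Omega>|lborel. \<bar>w x - w y\<bar>)"
      by (rule set_integral_norm_bound[of lborel \<Omega> "\<lambda>y. w x - w y", simplified])
        (intro int continuous_intros cw)
    finally have "\<bar>V * w x - m\<bar> - 5 * V \<le> (LINT y:\<Omega>|lborel. \<bar>w x - w y\<bar> - 5)"
      using int[of "\<lambda>y. \<bar>w x - w y\<bar>"] int[of "\<lambda>_. 5"] cw
      by (simp add: set_integral_diff cst V_def continuous_on_diff continuous_on_rabs)
    also have "\<dots> \<le> (LINT y:\<Omega>|lborel. (\<Sum>i\<in>I. f1 i x * f2 i y + f1 i y * f2 i x))"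
    proof (intro set_integral_mono int)
      show "continuous_on UNIV (\<lambda>y. \<bar>w x - w y\<bar> - 5)" by (intro continuous_intros cw)
      show "continuous_on UNIV (\<lambda>y. \<Sum>i\<in>I. f1 i x * f2 i y + f1 i y * f2 i x)" by (intro continuous_intros cf)
      show "\<bar>w x - w y\<bar> - 5 \<le> (\<Sum>i\<in>I. f1 i x * f2 i y + f1 i y * f2 i x)" if "y \<in> \<Omega>" for y
        unfolding f1_def f2_def I_def using sum_clamp_lower[OF N[OF x] N[OF that]] by simp
    qed
    also have "\<dots> = (\<Sum>i\<in>I. LINT y:\<Omega>|lborel. f1 i x * f2 i y + f1 i y * f2 i x)"
      by (intro sumint continuous_intros cf)
    also have "\<dots> = (\<Sum>i\<in>I. f1 i x * A2 i + A1 i * f2 i x)"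
      using int[OF cf(1)] int[OF cf(2)] by (intro sum.cong refl) (simp add: set_integral_add A1_def A2_def)
    finally show ?thesis .
  qed
  have "(LINT x:\<Omega>|lborel. \<bar>V * w x - m\<bar>) - 5 * V\<^sup>2 = (LINT x:\<Omega>|lborel. \<bar>V * w x - m\<bar> - 5 * V)"
    using int[of "\<lambda>x. \<bar>V * w x - m\<bar>"] int[of "\<lambda>_. 5 * V"] cw
    by (simp add: set_integral_diff cst V_def power2_eq_square continuous_on_diff continuous_on_rabs continuous_on_mult_left)
  also have "\<dots> \<le> (LINT x:\<Omega>|lborel. (\<Sum>i\<in>I. f1 i x * A2 i + A1 i * f2 i x))"
    by (intro set_integral_mono int inner continuous_intros cw cf)
  also have "\<dots> = (\<Sum>i\<in>I. LINT x:\<Omega>|lborel. f1 i x * A2 i + A1 i * f2 i x)"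
    by (intro sumint continuous_intros cf)
  \<comment> \<open>The two orders of a pair contribute equally after integration; this is the
    factor 2 in the final constant.\<close>
  also have "\<dots> = 2 * (\<Sum>i\<in>I. A1 i * A2 i)"
    using int[OF cf(1)] int[OF cf(2)] unfolding sum_distrib_left
    by (intro sum.cong refl) (simp add: set_integral_add A1_def A2_def)
  also have "\<dots> \<le> (2 / ln 2) * J * (LINT x:\<Omega>|lborel. norm (Gr x))"
    using upper by (simp add: field_simps)
  finally show ?thesis by (simp add: V_def J_def m_def)
qed

theorem poincare_C1:
  fixes \<Omega> :: "'a::euclidean_space set" and u :: "'a \<Rightarrow> real" and Gr :: "'a \<Rightarrow> 'a"
  assumes \<Omega>: "open \<Omega>" "bounded \<Omega>" "convex \<Omega>"
    and u: "\<And>x. (u has_derivative (\<lambda>h. Gr x \<bullet> h)) (at x)" and Gr: "continuous_on UNIV Gr"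
  shows "(LINT x:\<Omega>|lborel. \<bar>measure lborel \<Omega> * u x - (LINT z:\<Omega>|lborel. u z)\<bar>)
    \<le> (2 / ln 2) * (LINT x:\<Omega>|lborel. norm (x - c)) * (LINT x:\<Omega>|lborel. norm (Gr x))"
proof -
  define L R E where "L = (LINT x:\<Omega>|lborel. \<bar>measure lborel \<Omega> * u x - (LINT z:\<Omega>|lborel. u z)\<bar>)"
    and "R = (2 / ln 2) * (LINT x:\<Omega>|lborel. norm (x - c)) * (LINT x:\<Omega>|lborel. norm (Gr x))"
    and "E = 5 * (measure lborel \<Omega>)\<^sup>2"
  have "real n * L - E \<le> real n * R" for n
  proof -
    have "((\<lambda>x. real n * u x) has_derivative (\<lambda>h. (real n *\<^sub>R Gr x) \<bullet> h)) (at x)" for x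
      using has_derivative_mult_right[OF u[of x], of "real n"] by simp
    moreover have "continuous_on UNIV (\<lambda>x. real n *\<^sub>R Gr x)" by (intro continuous_intros Gr)
    ultimately have "(LINT x:\<Omega>|lborel. \<bar>measure lborel \<Omega> * (real n * u x) - (LINT z:\<Omega>|lborel. real n * u z)\<bar>) - E
      \<le> (2 / ln 2) * (LINT x:\<Omega>|lborel. norm (x - c)) * (LINT x:\<Omega>|lborel. norm (real n *\<^sub>R Gr x))"
      unfolding E_def by (rule poincare_unit_mesh[OF \<Omega>])
    moreover have "measure lborel \<Omega> * (real n * u x) - (LINT z:\<Omega>|lborel. real n * u z)
       = real n * (measure lborel \<Omega> * u x - (LINT z:\<Omega>|lborel. u z))" for x
      by (simp add: algebra_simps)
    then have "\<bar>measure lborel \<Omega> * (real n * u x) - (LINT z:\<Omega>|lborel. real n * u z)\<bar>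
       = real n * \<bar>measure lborel \<Omega> * u x - (LINT z:\<Omega>|lborel. u z)\<bar>" for x
      by (simp add: abs_mult)
    ultimately show ?thesis by (simp add: L_def R_def mult_ac)
  qed
  then have bound: "real n * (L - R) \<le> E" for n by (simp add: algebra_simps)
  have "L - R \<le> 0"
  proof (rule ccontr)
    assume "\<not> L - R \<le> 0"
    then obtain n where "E < real n * (L - R)" using reals_Archimedean3[of "L - R"] by auto
    then show False using bound[of n] by simp
  qed
  then show ?thesis by (simp add: L_def R_def)
qed

section \<open>Smooth bumps and continuity of translation\<close>

text \<open>The standard flat function \<open>exp (- (1 / t))\<close>, with powers of
  \<open>1 / t\<close> included so that each derivative is a linear combination of members of the
  same family.\<close>

definition exp_recip :: "nat \<Rightarrow> real \<Rightarrow> real" where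
  "exp_recip k t = (if 0 < t then exp (- (1 / t)) / t ^ k else 0)"

lemma exp_recip_nonneg: "0 \<le> exp_recip k t"
  by (simp add: exp_recip_def)

text \<open>Away from 0 this is the product rule. At 0 the difference quotient tends to 0 because
  exponential decay beats every power of \<open>1 / t\<close>.\<close>

lemma exp_recip_deriv: "(exp_recip k has_real_derivative (- real k * exp_recip (Suc k) t + exp_recip (Suc (Suc k)) t)) (at t)"
proof -
  consider "0 < t" | "t < 0" | "t = 0" by linarith
  then show ?thesis
  proof cases
    case 1
    have eq: "exp_recip j x = exp (- (1 / x) - real j * ln x)" if "0 < x" for j x
      using that by (simp add: exp_recip_def exp_diff exp_of_nat_mult)
    have d: "((\<lambda>t. exp (- (1 / t) - real k * ln t)) has_real_derivative
        exp (- (1 / t) - real k * ln t) * (1 / t\<^sup>2 - real k / t)) (at t)"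
      using 1 by (auto intro!: derivative_eq_intros simp: power2_eq_square)
    have v: "exp (- (1 / t) - real k * ln t) * (1 / t\<^sup>2 - real k / t)
        = - real k * exp_recip (Suc k) t + exp_recip (Suc (Suc k)) t"
      using 1 unfolding eq[OF 1, of k, symmetric] by (simp add: exp_recip_def field_simps power2_eq_square)
    have ev: "\<forall>\<^sub>F x in nhds t. exp (- (1 / x) - real k * ln x) = exp_recip k x"
      using eventually_nhds_in_open[of "{0<..}" t] 1
      by (auto elim!: eventually_mono simp: eq)
    show ?thesis using d unfolding v DERIV_cong_ev[OF refl ev refl] .
  next
    case 2
    have "((\<lambda>t. 0) has_real_derivative (- real k * exp_recip (Suc k) t + exp_recip (Suc (Suc k)) t)) (at t)"
      using 2 by (simp add: exp_recip_def)
    moreover have "\<forall>\<^sub>F x in nhds t. 0 = exp_recip k x"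
      using eventually_nhds_in_open[of "{..<0}" t] 2 by (auto elim!: eventually_mono simp: exp_recip_def)
    ultimately show ?thesis by (subst (asm) DERIV_cong_ev[OF refl _ refl]) auto
  next
    case 3
    \<comment> \<open>The substitution \<open>s = 1 / h\<close> turns the right-hand difference
      quotient at 0 into a power divided by an exponential at infinity.\<close>
    have "((\<lambda>s::real. s ^ Suc k / exp s) \<longlongrightarrow> 0) at_top" by (rule tendsto_power_div_exp_0)
    then have "((\<lambda>h. inverse h ^ Suc k / exp (inverse h)) \<longlongrightarrow> 0) (at_right (0::real))"
      by (rule filterlim_compose) (rule filterlim_inverse_at_top_right)
    then have r: "((\<lambda>h. exp_recip k h / h) \<longlongrightarrow> 0) (at_right 0)"
      by (rule Lim_transform_eventually)
        (auto simp: eventually_at_filter exp_recip_def field_simps exp_minus)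
    have l: "((\<lambda>h. exp_recip k h / h) \<longlongrightarrow> 0) (at_left 0)"
      by (rule tendsto_eventually) (auto simp: eventually_at_filter exp_recip_def)
    have "(\<lambda>h. exp_recip k h / h) \<midarrow>0\<rightarrow> 0" using l r by (rule filterlim_split_at)
    then show ?thesis using 3 by (simp add: DERIV_def exp_recip_def)
  qed
qed

text \<open>An algebra that contains the bumps and is closed under directional derivatives.\<close>

inductive bump_algebra :: "('a::euclidean_space \<Rightarrow> real) \<Rightarrow> bool" where
  const: "bump_algebra (\<lambda>x. c)"
| linear: "bump_algebra (\<lambda>x. x \<bullet> b)"
| bump: "bump_algebra (\<lambda>x. exp_recip k (r - (x - p) \<bullet> (x - p)))"
| add: "bump_algebra f \<Longrightarrow> bump_algebra g \<Longrightarrow> bump_algebra (\<lambda>x. f x + g x)"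
| mult: "bump_algebra f \<Longrightarrow> bump_algebra g \<Longrightarrow> bump_algebra (\<lambda>x. f x * g x)"

definition bump_grad :: "nat \<Rightarrow> real \<Rightarrow> 'a::euclidean_space \<Rightarrow> 'a" where
  "bump_grad k r z = (- 2 * (- real k * exp_recip (Suc k) (r - z \<bullet> z) + exp_recip (Suc (Suc k)) (r - z \<bullet> z))) *\<^sub>R z"

lemma exp_recip_ball_derivative:
  "((\<lambda>x. exp_recip k (r - (x - p) \<bullet> (x - p))) has_derivative (\<lambda>h. bump_grad k r (x - p) \<bullet> h)) (at x)"
  for x p :: "'a::euclidean_space"
proof -
  have "((\<lambda>x. r - (x - p) \<bullet> (x - p)) has_derivative (\<lambda>h. - 2 * ((x - p) \<bullet> h))) (at x)"
    by (auto intro!: derivative_eq_intros simp: inner_commute)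
  from has_derivative_compose[OF this exp_recip_deriv[of k, unfolded has_field_derivative_def]]
  show ?thesis
    by (rule has_derivative_eq_rhs) (simp add: bump_grad_def fun_eq_iff algebra_simps)
qed

text \<open>Closure is claimed for every direction \<open>v\<close>, which permits iteration over
  lists of directions and hence gives smoothness of all orders.\<close>

lemma bump_algebra_derivative:
  assumes "bump_algebra f"
  shows "\<exists>D. (\<forall>x. (f has_derivative D x) (at x)) \<and> (\<forall>v. bump_algebra (\<lambda>x. D x v))"
  using assms
proof induction
  case (const c)
  show ?case by (intro exI[of _ "\<lambda>x h. 0"]) (auto intro: bump_algebra.const)
next
  case (linear b)
  show ?case
    by (intro exI[of _ "\<lambda>x h. h \<bullet> b"]) (auto intro!: bump_algebra.const derivative_eq_intros)
next
  case (bump k r p)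
  have "bump_algebra (\<lambda>x. bump_grad k r (x - p) \<bullet> v)" for v
  proof -
    have "bump_algebra (\<lambda>x. ((-2) * ((- real k) * exp_recip (Suc k) (r - (x - p) \<bullet> (x - p)) + exp_recip (Suc (Suc k)) (r - (x - p) \<bullet> (x - p)))) * (x \<bullet> v + (- (p \<bullet> v))))"
      by (intro bump_algebra.intros)
    then show ?thesis by (simp add: bump_grad_def inner_diff_left)
  qed
  then show ?case
    by (intro exI[of _ "\<lambda>x h. bump_grad k r (x - p) \<bullet> h"]) (simp add: exp_recip_ball_derivative)
next
  case (add f g)
  then obtain D E where "\<And>x. (f has_derivative D x) (at x)" "\<And>x. (g has_derivative E x) (at x)"
    "\<And>v. bump_algebra (\<lambda>x. D x v)" "\<And>v. bump_algebra (\<lambda>x. E x v)" by blast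
  then show ?case
    by (intro exI[of _ "\<lambda>x h. D x h + E x h"]) (auto intro: bump_algebra.intros has_derivative_add)
next
  case (mult f g)
  then obtain D E where DE: "\<And>x. (f has_derivative D x) (at x)" "\<And>x. (g has_derivative E x) (at x)"
    "\<And>v. bump_algebra (\<lambda>x. D x v)" "\<And>v. bump_algebra (\<lambda>x. E x v)" by blast
  have "bump_algebra (\<lambda>x. f x * E x v + D x v * g x)" for v
    using DE mult.hyps by (intro bump_algebra.intros)
  moreover have "((\<lambda>x. f x * g x) has_derivative (\<lambda>h. f x * E x h + D x h * g x)) (at x)" for x
    by (rule has_derivative_mult[OF DE(1,2)])
  ultimately show ?case by (intro exI[of _ "\<lambda>x h. f x * E x h + D x h * g x"]) auto
qed

lemma continuous_exp_recip: "continuous_on S f \<Longrightarrow> continuous_on S (\<lambda>x. exp_recip k (f x))"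
  by (rule continuous_on_compose2[of UNIV "exp_recip k"])
    (auto intro: DERIV_continuous_on exp_recip_deriv[THEN has_field_derivative_at_within])

lemma continuous_bump_grad: "continuous_on S (bump_grad k r)"
  unfolding bump_grad_def[abs_def] by (intro continuous_intros continuous_exp_recip)

section \<open>Continuity of translation in the space of integrable functions\<close>

lemma lborel_translate:
  fixes h :: "'a::euclidean_space \<Rightarrow> 'b::{banach, second_countable_topology}"
  assumes h: "h \<in> borel_measurable borel"
  shows "(\<integral>x. h (z + x) \<partial>lborel) = (\<integral>x. h x \<partial>lborel)"
    and "integrable lborel (\<lambda>x. h (z + x)) \<longleftrightarrow> integrable lborel h"
proof -
  have "(\<integral>x. h x \<partial>distr lborel borel ((+) z)) = (\<integral>x. h (z + x) \<partial>lborel)"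
    using h by (intro integral_distr) auto
  then show "(\<integral>x. h (z + x) \<partial>lborel) = (\<integral>x. h x \<partial>lborel)" by (simp add: lborel_distr_plus)
  have "integrable (distr lborel borel ((+) z)) h \<longleftrightarrow> integrable lborel (\<lambda>x. h (z + x))"
    using h by (intro integrable_distr_eq) auto
  then show "integrable lborel (\<lambda>x. h (z + x)) \<longleftrightarrow> integrable lborel h" by (simp add: lborel_distr_plus)
qed

text \<open>Inner regularity is invoked for a finite measure, namely Lebesgue measure restricted to
  \<open>A\<close>.\<close>

lemma compact_inner_approx:
  fixes A :: "'a::euclidean_space set"
  assumes A: "A \<in> sets borel" "emeasure lborel A < \<infinity>" and "0 < e"
  obtains K where "compact K" "K \<subseteq> A" "measure lborel (A - K) < e"
proof -
  define M where "M = density lborel (indicator A)"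
  have M: "emeasure M B = emeasure lborel (A \<inter> B)" if "B \<in> sets borel" for B
    unfolding M_def using A(1) that by (simp add: emeasure_density indicator_inter_arith[symmetric])
  have "emeasure M A = (SUP K\<in>{K. K \<subseteq> A \<and> compact K}. emeasure M K)"
    using A M[of UNIV] by (intro inner_regular) (auto simp: M_def)
  then have sup: "emeasure lborel A = (SUP K\<in>{K. K \<subseteq> A \<and> compact K}. emeasure M K)"
    using M[OF A(1)] by simp
  \<comment> \<open>A null set has no value strictly below its measure in \<open>ennreal\<close>; it
    is approximated by the empty set instead.\<close>
  consider "emeasure lborel A = 0"
    | "ennreal (measure lborel A - e) < (SUP K\<in>{K. K \<subseteq> A \<and> compact K}. emeasure M K)"
  proof (cases "emeasure lborel A = 0")
    case False
    have Am: "emeasure lborel A = ennreal (measure lborel A)" using A(2) by (simp add: emeasure_eq_ennreal_measure)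
    then have "0 < measure lborel A" using False by (metis ennreal_0 measure_nonneg order_less_le)
    then have "ennreal (measure lborel A - e) < ennreal (measure lborel A)"
      using \<open>0 < e\<close> by (intro ennreal_lessI) auto
    then show ?thesis using that(2) Am sup by simp
  qed (use that(1) in blast)
  then show ?thesis
  proof cases
    case 1
    then show ?thesis using that[of "{}"] \<open>0 < e\<close> by (simp add: measure_def)
  next
    case 2
    then obtain K where K: "K \<subseteq> A" "compact K" "ennreal (measure lborel A - e) < emeasure M K"
      by (auto simp: less_SUP_iff)
    have Kb: "K \<in> sets borel" using K(2) by (simp add: borel_compact)
    have fin: "emeasure lborel K < \<infinity>" using emeasure_bounded_finite[OF compact_imp_bounded[OF K(2)]] .
    have "ennreal (measure lborel A - e) < ennreal (measure lborel K)"
      using K(3) M[OF Kb] K(1) fin by (simp add: Int_absorb1 emeasure_eq_ennreal_measure)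
    then have "measure lborel A - e < measure lborel K" by (meson ennreal_leI not_less)
    moreover have "measure lborel (A - K) = measure lborel A - measure lborel K"
      using A Kb fin K(1) by (intro measure_Diff) auto
    ultimately show ?thesis using that K by simp
  qed
qed

definition translation_continuous :: "('a::euclidean_space \<Rightarrow> real) \<Rightarrow> bool" where
  "translation_continuous f \<longleftrightarrow> (\<forall>e>0. \<exists>d>0. \<forall>z. norm z < d \<longrightarrow> (\<integral>x. \<bar>f (z + x) - f x\<bar> \<partial>lborel) < e)"


lemma translation_diff_integrable:
  fixes f :: "'a::euclidean_space \<Rightarrow> real"
  assumes "integrable lborel f"
  shows "integrable lborel (\<lambda>x. \<bar>f (z + x) - f x\<bar>)" "integrable lborel (\<lambda>x. f (z + x))"
proof -
  have "f \<in> borel_measurable borel" using borel_measurable_integrable[OF assms] by simp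
  then show "integrable lborel (\<lambda>x. f (z + x))" using lborel_translate(2)[of f z] assms by blast
  then show "integrable lborel (\<lambda>x. \<bar>f (z + x) - f x\<bar>)" using assms by simp
qed

text \<open>The error of approximation enters once at \<open>x\<close> and once at
  \<open>z + x\<close>; translation invariance makes the two contributions equal.\<close>

lemma translation_diff_approx:
  fixes f g :: "'a::euclidean_space \<Rightarrow> real"
  assumes f: "integrable lborel f" and g: "integrable lborel g"
  shows "(\<integral>x. \<bar>f (z + x) - f x\<bar> \<partial>lborel) \<le> (\<integral>x. \<bar>g (z + x) - g x\<bar> \<partial>lborel) + 2 * (\<integral>x. \<bar>f x - g x\<bar> \<partial>lborel)"
proof -
  have fg: "integrable lborel (\<lambda>x. \<bar>f x - g x\<bar>)" using f g by simp
  then have m: "(\<lambda>x. \<bar>f x - g x\<bar>) \<in> borel_measurable borel" by (auto dest: borel_measurable_integrable)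
  have t: "integrable lborel (\<lambda>x. \<bar>f (z + x) - g (z + x)\<bar>)"
    "(\<integral>x. \<bar>f (z + x) - g (z + x)\<bar> \<partial>lborel) = (\<integral>x. \<bar>f x - g x\<bar> \<partial>lborel)"
    using lborel_translate[OF m, of z] fg by auto
  have "(\<integral>x. \<bar>f (z + x) - f x\<bar> \<partial>lborel)
     \<le> (\<integral>x. \<bar>g (z + x) - g x\<bar> + (\<bar>f (z + x) - g (z + x)\<bar> + \<bar>f x - g x\<bar>) \<partial>lborel)"
    by (intro integral_mono Bochner_Integration.integrable_add translation_diff_integrable f g t fg) linarith
  also have "\<dots> = (\<integral>x. \<bar>g (z + x) - g x\<bar> \<partial>lborel) + 2 * (\<integral>x. \<bar>f x - g x\<bar> \<partial>lborel)"
    using translation_diff_integrable[OF g] t fg by simp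
  finally show ?thesis .
qed

text \<open>Choose an open \<open>T\<close> around \<open>K\<close> of almost the same measure. A
  translation shorter than the distance from \<open>K\<close> to the complement of \<open>T\<close>
  keeps \<open>K\<close> inside \<open>T\<close>, so the indicators differ only on
  \<open>T - K\<close> and on a translate of it.\<close>

lemma translation_continuous_compact:
  fixes K :: "'a::euclidean_space set"
  assumes K: "compact K"
  shows "translation_continuous (indicat_real K)"
  unfolding translation_continuous_def
proof (intro allI impI)
  fix e :: real assume e: "0 < e"
  have Kb[measurable]: "K \<in> sets borel" using K by (simp add: borel_compact)
  have Kl: "K \<in> sets lebesgue" using Kb by simp
  obtain T where T: "open T" "K \<subseteq> T" "T - K \<in> lmeasurable" "emeasure lebesgue (T - K) < ennreal (e / 2)"
    using sets_lebesgue_outer_open[OF Kl, of "e / 2"] e by auto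
  have Tb[measurable]: "T \<in> sets borel" using T(1) by (rule borel_open)
  have "emeasure lborel (T - K) = emeasure lebesgue (T - K)" by simp
  then have TKe: "emeasure lborel (T - K) < ennreal (e / 2)" using T(4) by simp
  then have TKm: "measure lborel (T - K) < e / 2"
  proof -
    have "emeasure lborel (T - K) \<noteq> \<top>" using TKe by auto
    then have "ennreal (measure lborel (T - K)) < ennreal (e / 2)"
      using TKe by (simp add: emeasure_eq_ennreal_measure)
    then show ?thesis by (simp add: ennreal_less_iff)
  qed
  have TK: "integrable lborel (indicat_real (T - K))"
    using TKe by (intro integrable_real_indicator) (auto intro: less_trans)
  have Ki: "integrable lborel (indicat_real K)"
    using emeasure_bounded_finite[OF compact_imp_bounded[OF K]] by (intro integrable_real_indicator) auto
  obtain d where d: "0 < d" "(\<Union>x\<in>K. ball x d) \<subseteq> T"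
    using compact_subset_open_imp_ball_epsilon_subset[OF K T(1,2)] by blast
  have "(\<integral>x. \<bar>indicat_real K (z + x) - indicat_real K x\<bar> \<partial>lborel) < e" if z: "norm z < d" for z
  proof -
    have sub: "x \<in> T" if "z + x \<in> K" for x
    proof -
      have "x \<in> ball (z + x) d" using z by (simp add: dist_norm)
      then show ?thesis using d(2) that by blast
    qed
    have sub2: "z + x \<in> T" if "x \<in> K" for x
    proof -
      have "z + x \<in> ball x d" using z by (simp add: dist_norm norm_minus_commute)
      then show ?thesis using d(2) that by blast
    qed
    have m: "indicat_real (T - K) \<in> borel_measurable borel" by measurable
    have T2: "integrable lborel (\<lambda>x. indicat_real (T - K) (z + x))" using lborel_translate(2)[OF m, of z] TK by blast
    have "(\<integral>x. \<bar>indicat_real K (z + x) - indicat_real K x\<bar> \<partial>lborel)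
      \<le> (\<integral>x. indicat_real (T - K) x + indicat_real (T - K) (z + x) \<partial>lborel)"
      by (intro integral_mono translation_diff_integrable Ki Bochner_Integration.integrable_add TK T2)
        (use sub sub2 in \<open>auto simp: indicator_def\<close>)
    also have "\<dots> = 2 * measure lborel (T - K)"
      using lborel_translate(1)[OF m, of z] TK T2 by (subst Bochner_Integration.integral_add) simp_all
    finally show ?thesis using TKm by simp
  qed
  then show "\<exists>d>0. \<forall>z. norm z < d \<longrightarrow> (\<integral>x. \<bar>indicat_real K (z + x) - indicat_real K x\<bar> \<partial>lborel) < e"
    using d(1) by blast
qed

lemma translation_continuous_approx:
  fixes f :: "'a::euclidean_space \<Rightarrow> real"
  assumes f: "integrable lborel f"
    and g: "\<And>e. 0 < e \<Longrightarrow> \<exists>g. integrable lborel g \<and> translation_continuous g \<and> (\<integral>x. \<bar>f x - g x\<bar> \<partial>lborel) < e"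
  shows "translation_continuous f"
  unfolding translation_continuous_def
proof (intro allI impI)
  fix e :: real assume e: "0 < e"
  obtain h where h: "integrable lborel h" "translation_continuous h" "(\<integral>x. \<bar>f x - h x\<bar> \<partial>lborel) < e / 4"
    using g[of "e / 4"] e by auto
  obtain d where d: "0 < d" "\<And>z. norm z < d \<Longrightarrow> (\<integral>x. \<bar>h (z + x) - h x\<bar> \<partial>lborel) < e / 2"
    using h(2) e unfolding translation_continuous_def by (meson half_gt_zero)
  have "(\<integral>x. \<bar>f (z + x) - f x\<bar> \<partial>lborel) < e" if "norm z < d" for z
    using translation_diff_approx[OF f h(1), of z] d(2)[OF that] h(3) by linarith
  then show "\<exists>d>0. \<forall>z. norm z < d \<longrightarrow> (\<integral>x. \<bar>f (z + x) - f x\<bar> \<partial>lborel) < e" using d(1) by blast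
qed

lemma translation_continuous_cmult:
  assumes "translation_continuous f"
  shows "translation_continuous (\<lambda>x. c * f x)"
proof (cases "c = 0")
  case True
  then show ?thesis by (auto simp: translation_continuous_def intro: exI[of _ 1])
next
  case False
  show ?thesis
    unfolding translation_continuous_def
  proof (intro allI impI)
    fix e :: real assume "0 < e"
    then have "0 < e / \<bar>c\<bar>" using False by simp
    then obtain d where d: "0 < d" "\<And>z. norm z < d \<Longrightarrow> (\<integral>x. \<bar>f (z + x) - f x\<bar> \<partial>lborel) < e / \<bar>c\<bar>"
      using assms unfolding translation_continuous_def by meson
    have "(\<integral>x. \<bar>c * f (z + x) - c * f x\<bar> \<partial>lborel) = \<bar>c\<bar> * (\<integral>x. \<bar>f (z + x) - f x\<bar> \<partial>lborel)" for z
      by (simp add: abs_mult flip: right_diff_distrib)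
    then have "(\<integral>x. \<bar>c * f (z + x) - c * f x\<bar> \<partial>lborel) < e" if "norm z < d" for z
      using d(2)[OF that] False by (simp add: pos_less_divide_eq mult.commute[of _ "\<bar>c\<bar>"])
    then show "\<exists>d>0. \<forall>z. norm z < d \<longrightarrow> (\<integral>x. \<bar>c * f (z + x) - c * f x\<bar> \<partial>lborel) < e" using d(1) by blast
  qed
qed

lemma translation_continuous_add:
  assumes f: "integrable lborel f" "translation_continuous f" and g: "integrable lborel g" "translation_continuous g"
  shows "translation_continuous (\<lambda>x. f x + g x)"
  unfolding translation_continuous_def
proof (intro allI impI)
  fix e :: real assume "0 < e"
  then have e: "0 < e / 2" by simp
  obtain d1 where d1: "0 < d1" "\<And>z. norm z < d1 \<Longrightarrow> (\<integral>x. \<bar>f (z + x) - f x\<bar> \<partial>lborel) < e / 2"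
    using f(2) e unfolding translation_continuous_def by meson
  obtain d2 where d2: "0 < d2" "\<And>z. norm z < d2 \<Longrightarrow> (\<integral>x. \<bar>g (z + x) - g x\<bar> \<partial>lborel) < e / 2"
    using g(2) e unfolding translation_continuous_def by meson
  have "(\<integral>x. \<bar>f (z + x) + g (z + x) - (f x + g x)\<bar> \<partial>lborel) < e" if "norm z < min d1 d2" for z
  proof -
    have "(\<integral>x. \<bar>f (z + x) + g (z + x) - (f x + g x)\<bar> \<partial>lborel)
       \<le> (\<integral>x. \<bar>f (z + x) - f x\<bar> + \<bar>g (z + x) - g x\<bar> \<partial>lborel)"
      using translation_diff_integrable[OF f(1)] translation_diff_integrable[OF g(1)] f(1) g(1)
      by (intro integral_mono) auto
    also have "\<dots> = (\<integral>x. \<bar>f (z + x) - f x\<bar> \<partial>lborel) + (\<integral>x. \<bar>g (z + x) - g x\<bar> \<partial>lborel)"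
      using translation_diff_integrable[OF f(1)] translation_diff_integrable[OF g(1)] by simp
    finally show ?thesis using d1(2)[of z] d2(2)[of z] that by simp
  qed
  then show "\<exists>d>0. \<forall>z. norm z < d \<longrightarrow> (\<integral>x. \<bar>f (z + x) + g (z + x) - (f x + g x)\<bar> \<partial>lborel) < e"
    using d1(1) d2(1) by (intro exI[of _ "min d1 d2"]) auto
qed

text \<open>The class contains indicators of compact sets and is closed under scaling, sums and
  approximation in the integral norm. Inner regularity supplies indicators of Borel sets of finite
  measure, and induction over integrable functions the rest.\<close>

theorem translation_continuous_integrable:
  fixes f :: "'a::euclidean_space \<Rightarrow> real"
  assumes "integrable lborel f"
  shows "translation_continuous f"
  using assms
proof (induction rule: integrable_induct)
  case (base A c)
  then have A: "A \<in> sets borel" "emeasure lborel A < \<infinity>" by auto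
  have Ai: "integrable lborel (indicat_real A)" using A by (intro integrable_real_indicator) auto
  have "translation_continuous (indicat_real A)"
  proof (rule translation_continuous_approx[OF Ai])
    fix e :: real assume "0 < e"
    obtain K where K: "compact K" "K \<subseteq> A" "measure lborel (A - K) < e"
      by (rule compact_inner_approx[OF A \<open>0 < e\<close>])
    have "integrable lborel (indicat_real K)"
      using K emeasure_bounded_finite[OF compact_imp_bounded[OF K(1)]]
      by (intro integrable_real_indicator) (auto simp: borel_compact)
    moreover have "(\<integral>x. \<bar>indicat_real A x - indicat_real K x\<bar> \<partial>lborel) = measure lborel (A - K)"
    proof -
      have "(\<integral>x. \<bar>indicat_real A x - indicat_real K x\<bar> \<partial>lborel) = (\<integral>x. indicat_real (A - K) x \<partial>lborel)"
        using K(2) by (intro Bochner_Integration.integral_cong) (auto simp: indicator_def)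
      then show ?thesis by simp
    qed
    ultimately show "\<exists>g. integrable lborel g \<and> translation_continuous g \<and> (\<integral>x. \<bar>indicat_real A x - g x\<bar> \<partial>lborel) < e"
      using translation_continuous_compact[OF K(1)] K(3) by auto
  qed
  then show ?case using translation_continuous_cmult[of "indicat_real A" c] by (simp add: mult.commute)
next
  case (add f g)
  then show ?case by (intro translation_continuous_add)
next
  case (lim f s)
  show ?case
  proof (rule translation_continuous_approx[OF lim(4)])
    fix e :: real assume "0 < e"
    \<comment> \<open>The induction rule provides approximants bounded by twice \<bar>f\<bar>, so
      three times \<bar>f\<bar> dominates the differences.\<close>
    have "(\<lambda>i. \<integral>x. \<bar>f x - s i x\<bar> \<partial>lborel) \<longlonglongrightarrow> (\<integral>x. 0 \<partial>(lborel :: 'a measure))"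
    proof (rule integral_dominated_convergence[where w = "\<lambda>x. 3 * \<bar>f x\<bar>"])
      show "integrable lborel (\<lambda>x. 3 * \<bar>f x\<bar>)" using lim(4) by simp
      show "AE x in lborel. (\<lambda>i. \<bar>f x - s i x\<bar>) \<longlonglongrightarrow> 0"
      proof (rule AE_I2)
        fix x :: 'a assume "x \<in> space lborel"
        then have "(\<lambda>i. s i x) \<longlonglongrightarrow> f x" by (rule lim(2))
        then have "(\<lambda>i. \<bar>f x - s i x\<bar>) \<longlonglongrightarrow> \<bar>f x - f x\<bar>" by (intro tendsto_intros)
        then show "(\<lambda>i. \<bar>f x - s i x\<bar>) \<longlonglongrightarrow> 0" by simp
      qed
      show "AE x in lborel. norm \<bar>f x - s i x\<bar> \<le> 3 * \<bar>f x\<bar>" for i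
      proof (rule AE_I2)
        fix x :: 'a assume "x \<in> space lborel"
        then have "norm (s i x) \<le> 2 * norm (f x)" by (rule lim(3))
        then show "norm \<bar>f x - s i x\<bar> \<le> 3 * \<bar>f x\<bar>" by simp
      qed
    qed (use lim(1,4) borel_measurable_integrable in auto)
    then have "\<forall>\<^sub>F i in sequentially. (\<integral>x. \<bar>f x - s i x\<bar> \<partial>lborel) < e"
      using \<open>0 < e\<close> by (intro order_tendstoD(2)) auto
    then obtain i where "(\<integral>x. \<bar>f x - s i x\<bar> \<partial>lborel) < e" by (auto simp: eventually_sequentially)
    then show "\<exists>g. integrable lborel g \<and> translation_continuous g \<and> (\<integral>x. \<bar>f x - g x\<bar> \<partial>lborel) < e"
      using lim(1,5) by blast
  qed
qed

section \<open>Mollification\<close>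

lemma bump_algebra_iter_deriv:
  assumes "bump_algebra f"
  shows "bump_algebra (iter_deriv ds f)"
  using assms
proof (induction ds)
  case (Cons v ds)
  then have "bump_algebra (iter_deriv ds f)" by simp
  then obtain D where D: "\<And>x. (iter_deriv ds f has_derivative D x) (at x)" "\<And>v. bump_algebra (\<lambda>x. D x v)"
    using bump_algebra_derivative by blast
  then have "iter_deriv (v # ds) f = (\<lambda>x. D x v)"
    by (simp add: fun_eq_iff frechet_derivative_at[OF D(1), symmetric])
  then show ?case using D(2) by simp
qed simp

lemma bump_algebra_smooth:
  assumes "bump_algebra f"
  shows "smooth_fun f"
  unfolding smooth_fun_def differentiable_on_def
proof (intro allI impI ballI)
  fix ds :: "'a list" and x
  obtain D where "(iter_deriv ds f has_derivative D x) (at x)"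
    using bump_algebra_derivative[OF bump_algebra_iter_deriv[OF assms]] by blast
  then show "iter_deriv ds f differentiable (at x)" by (rule differentiableI)
qed

definition bump :: "real \<Rightarrow> 'a::euclidean_space \<Rightarrow> real" where
  "bump \<epsilon> z = exp_recip 0 (\<epsilon>\<^sup>2 - z \<bullet> z)"

lemma bump_nonneg: "0 \<le> bump \<epsilon> z"
  by (simp add: bump_def exp_recip_nonneg)

lemma bump_pos_iff:
  assumes "0 < \<epsilon>"
  shows "0 < bump \<epsilon> z \<longleftrightarrow> norm z < \<epsilon>"
proof -
  have "norm z < \<epsilon> \<longleftrightarrow> (norm z)\<^sup>2 < \<epsilon>\<^sup>2"
    using assms by (auto intro: power_strict_mono dest: power2_less_imp_less)
  then show ?thesis by (simp add: bump_def exp_recip_def power2_norm_eq_inner)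
qed

lemma bump_eq_0: "0 < \<epsilon> \<Longrightarrow> \<epsilon> \<le> norm z \<Longrightarrow> bump \<epsilon> z = 0"
  using bump_pos_iff[of \<epsilon> z] bump_nonneg[of \<epsilon> z] by simp

lemma continuous_bump: "continuous_on S (bump \<epsilon>)"
  unfolding bump_def[abs_def] by (intro continuous_exp_recip continuous_intros)

lemma bump_has_derivative: "(bump \<epsilon> has_derivative (\<lambda>h. bump_grad 0 (\<epsilon>\<^sup>2) z \<bullet> h)) (at z)"
  using exp_recip_ball_derivative[of 0 "\<epsilon>\<^sup>2" 0 z] by (simp add: bump_def[abs_def])

lemma bump_grad_eq_0: 
  assumes "0 < \<epsilon>" "\<epsilon> \<le> norm z"
  shows "bump_grad k (\<epsilon>\<^sup>2) z = 0"
proof -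
  have "\<epsilon>\<^sup>2 \<le> (norm z)\<^sup>2" using assms by (intro power_mono) auto
  then show ?thesis by (simp add: bump_grad_def exp_recip_def power2_norm_eq_inner)
qed

lemma integrable_of_ball_support:
  fixes f :: "'a::euclidean_space \<Rightarrow> 'b::euclidean_space"
  assumes "continuous_on UNIV f" "\<And>z. \<epsilon> \<le> norm z \<Longrightarrow> f z = 0"
  shows "integrable lborel f"
proof -
  have "integrable lborel (\<lambda>x. indicator (cball 0 \<epsilon>) x *\<^sub>R f x)"
    by (intro borel_integrable_compact continuous_on_subset[OF assms(1)]) auto
  moreover have "indicator (cball 0 \<epsilon>) x *\<^sub>R f x = f x" for x
    using assms(2)[of x] by (auto simp: indicator_def)
  ultimately show ?thesis by simp
qed

lemma bounded_of_ball_support: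
  fixes f :: "'a::euclidean_space \<Rightarrow> 'b::euclidean_space"
  assumes "continuous_on UNIV f" "\<And>z. \<epsilon> \<le> norm z \<Longrightarrow> f z = 0"
  obtains B where "\<And>z. norm (f z) \<le> B"
proof -
  have "compact (f ` cball 0 \<epsilon>)" by (intro compact_continuous_image continuous_on_subset[OF assms(1)]) auto
  then obtain B where B: "\<And>z. z \<in> cball 0 \<epsilon> \<Longrightarrow> norm (f z) \<le> B" using compact_imp_bounded bounded_iff by (metis imageI)
  have "norm (f z) \<le> max B 0" for z
    using B[of z] assms(2)[of z] by (cases "norm z \<le> \<epsilon>") auto
  then show ?thesis using that by blast
qed

lemma uniformly_continuous_of_ball_support:
  fixes f :: "'a::euclidean_space \<Rightarrow> 'b::euclidean_space"
  assumes f: "continuous_on UNIV f" "\<And>z. \<epsilon> \<le> norm z \<Longrightarrow> f z = 0"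
  shows "uniformly_continuous_on UNIV f"
  unfolding uniformly_continuous_on_def
proof (intro allI impI)
  fix e :: real assume "0 < e"
  have "uniformly_continuous_on (cball 0 (\<epsilon> + 1)) f"
    by (intro compact_uniformly_continuous continuous_on_subset[OF f(1)]) auto
  then obtain d where d: "0 < d" "\<And>x y. x \<in> cball 0 (\<epsilon> + 1) \<Longrightarrow> y \<in> cball 0 (\<epsilon> + 1) \<Longrightarrow> dist y x < d \<Longrightarrow> dist (f y) (f x) < e"
    unfolding uniformly_continuous_on_def using \<open>0 < e\<close> by meson
  have "dist (f y) (f x) < e" if xy: "dist y x < min d 1" for x y
  proof (cases "norm x \<le> \<epsilon> + 1 \<and> norm y \<le> \<epsilon> + 1")
    case True
    then show ?thesis using d(2)[of x y] xy by simp
  next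
    case False
    have "norm x \<le> norm y + dist y x" "norm y \<le> norm x + dist y x"
      using norm_triangle_sub[of x y] norm_triangle_sub[of y x] by (simp_all add: dist_norm norm_minus_commute add.commute)
    then have "\<epsilon> \<le> norm x" "\<epsilon> \<le> norm y" using False xy by auto
    then show ?thesis using f(2) \<open>0 < e\<close> by simp
  qed
  then show "\<exists>d>0. \<forall>x\<in>UNIV. \<forall>x'\<in>UNIV. dist x' x < d \<longrightarrow> dist (f x') (f x) < e"
    using d(1) by (intro exI[of _ "min d 1"]) auto
qed

text \<open>The mean value inequality on a ball around \<open>z\<close>, applied to the function
  minus its linear part: the gradient of the difference is \<open>G y - G z\<close>, which is
  uniformly small.\<close>

lemma first_order_uniform:
  fixes \<rho> :: "'a::euclidean_space \<Rightarrow> real" and G :: "'a \<Rightarrow> 'a"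
  assumes \<rho>: "\<And>z. (\<rho> has_derivative (\<lambda>h. G z \<bullet> h)) (at z)" and G: "uniformly_continuous_on UNIV G" and "0 < e"
  obtains d where "0 < d" "\<And>z h. norm h < d \<Longrightarrow> \<bar>\<rho> (z + h) - \<rho> z - G z \<bullet> h\<bar> \<le> e * norm h"
proof -
  obtain d where d: "0 < d" "\<And>x y. dist y x < d \<Longrightarrow> dist (G y) (G x) < e"
    using G \<open>0 < e\<close> unfolding uniformly_continuous_on_def by (metis UNIV_I)
  have "\<bar>\<rho> (z + h) - \<rho> z - G z \<bullet> h\<bar> \<le> e * norm h" if h: "norm h < d" for z h
  proof -
    define F where "F = (\<lambda>y. \<rho> y - G z \<bullet> y)"
    have "norm (F (z + h) - F z) \<le> e * norm (z + h - z)"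
    proof (rule differentiable_bound[of "ball z d" F "\<lambda>y k. (G y - G z) \<bullet> k"])
      fix y assume y: "y \<in> ball z d"
      have "(F has_derivative (\<lambda>k. G y \<bullet> k - G z \<bullet> k)) (at y)"
        unfolding F_def by (intro derivative_intros \<rho>)
      then show "(F has_derivative (\<lambda>k. (G y - G z) \<bullet> k)) (at y within ball z d)"
        by (simp add: inner_diff_left has_derivative_at_withinI)
      show "onorm (\<lambda>k. (G y - G z) \<bullet> k) \<le> e"
      proof (rule onorm_bound)
        show "norm ((G y - G z) \<bullet> k) \<le> e * norm k" for k
        proof -
          have "norm (G y - G z) \<le> e" using d(2)[of y z] y by (simp add: dist_norm dist_commute less_imp_le norm_minus_commute)
          then show ?thesis using Cauchy_Schwarz_ineq2[of "G y - G z" k] by (smt (verit) mult_right_mono norm_ge_zero real_norm_def)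
        qed
      qed (use \<open>0 < e\<close> in simp)
    qed (use h d(1) in \<open>auto simp: dist_norm\<close>)
    then show ?thesis by (simp add: F_def inner_add_right algebra_simps)
  qed
  then show ?thesis using that d(1) by blast
qed

lemma norm_integral_le:
  fixes h :: "'a \<Rightarrow> 'b::{banach, second_countable_topology}"
  assumes "integrable M h" "integrable M w" "\<And>x. norm (h x) \<le> w x"
  shows "norm (\<integral>x. h x \<partial>M) \<le> (\<integral>x. w x \<partial>M)"
proof -
  have "norm (\<integral>x. h x \<partial>M) \<le> (\<integral>x. norm (h x) \<partial>M)" by (rule integral_norm_bound)
  also have "\<dots> \<le> (\<integral>x. w x \<partial>M)" by (intro integral_mono integrable_norm assms)
  finally show ?thesis .
qed

lemma integrable_mult_bounded:
  fixes f :: "'a \<Rightarrow> real" and k :: "'a \<Rightarrow> 'b::{banach, second_countable_topology}"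
  assumes f: "integrable M f" and k: "k \<in> borel_measurable M" "\<And>z. norm (k z) \<le> B"
  shows "integrable M (\<lambda>y. f y *\<^sub>R k y)"
proof (rule Bochner_Integration.integrable_bound[of _ "\<lambda>y. B * \<bar>f y\<bar>"])
  show "integrable M (\<lambda>y. B * \<bar>f y\<bar>)" using f by simp
  show "(\<lambda>y. f y *\<^sub>R k y) \<in> borel_measurable M"
    using borel_measurable_integrable[OF f] k(1) by (intro borel_measurable_scaleR)
  have "norm (f y *\<^sub>R k y) \<le> norm (B * \<bar>f y\<bar>)" for y
  proof -
    have "norm (f y *\<^sub>R k y) \<le> \<bar>f y\<bar> * B" using k(2)[of y] by (simp add: mult_left_mono)
    also have "\<dots> \<le> norm (B * \<bar>f y\<bar>)" by (simp add: mult.commute abs_mult mult_right_mono)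
    finally show ?thesis .
  qed
  then show "AE y in M. norm (f y *\<^sub>R k y) \<le> norm (B * \<bar>f y\<bar>)" by simp
qed

text \<open>All derivatives fall on the kernel. Its first-order remainder is small uniformly in the
  base point, so integrating against \<bar>f\<bar> preserves the bound for a merely integrable
  \<open>f\<close>.\<close>

lemma convolution_C1:
  fixes f \<rho> :: "'a::euclidean_space \<Rightarrow> real" and G :: "'a \<Rightarrow> 'a"
  assumes f: "integrable lborel f" and \<rho>: "\<And>z. (\<rho> has_derivative (\<lambda>h. G z \<bullet> h)) (at z)"
    and G: "uniformly_continuous_on UNIV G" and bounds: "\<And>z. \<bar>\<rho> z\<bar> \<le> B" "\<And>z. norm (G z) \<le> B"
  shows "((\<lambda>x. \<integral>y. f y * \<rho> (x - y) \<partial>lborel) has_derivative (\<lambda>h. (\<integral>y. f y *\<^sub>R G (x - y) \<partial>lborel) \<bullet> h)) (at x)"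
    and "continuous_on UNIV (\<lambda>x. \<integral>y. f y *\<^sub>R G (x - y) \<partial>lborel)"
proof -
  have c\<rho>: "continuous_on UNIV \<rho>"
    using \<rho> by (meson has_derivative_continuous_on has_derivative_at_withinI)
  have cG: "continuous_on UNIV G" using G by (rule uniformly_continuous_imp_continuous)
  have i\<rho>: "integrable lborel (\<lambda>y. f y * \<rho> (x - y))" for x
  proof -
    have "continuous_on UNIV (\<lambda>y. \<rho> (x - y))" by (rule continuous_on_compose2[OF c\<rho>]) (auto intro!: continuous_intros)
    then have "integrable lborel (\<lambda>y. f y *\<^sub>R \<rho> (x - y))"
      using bounds(1) by (intro integrable_mult_bounded[OF f, of _ B]) (auto intro: borel_measurable_continuous_onI)
    then show ?thesis by simp
  qed
  have iG: "integrable lborel (\<lambda>y. f y *\<^sub>R G (x - y))" for x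
  proof -
    have "continuous_on UNIV (\<lambda>y. G (x - y))" by (rule continuous_on_compose2[OF cG]) (auto intro!: continuous_intros)
    then show ?thesis
      using bounds(2) by (intro integrable_mult_bounded[OF f, of _ B]) (auto intro: borel_measurable_continuous_onI)
  qed
  define I where "I = (\<integral>y. \<bar>f y\<bar> \<partial>lborel)"
  have I: "0 \<le> I" by (simp add: I_def)
  show "continuous_on UNIV (\<lambda>x. \<integral>y. f y *\<^sub>R G (x - y) \<partial>lborel)"
    unfolding continuous_on_iff
  proof (intro ballI allI impI)
    fix x :: 'a and e :: real assume "0 < e"
    define e' where "e' = e / (I + 1)"
    have e': "0 < e'" using \<open>0 < e\<close> I by (simp add: e'_def)
    obtain d where d: "0 < d" "\<And>x y. dist y x < d \<Longrightarrow> dist (G y) (G x) < e'"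
      using G e' unfolding uniformly_continuous_on_def by (metis UNIV_I)
    have "dist (\<integral>y. f y *\<^sub>R G (x' - y) \<partial>lborel) (\<integral>y. f y *\<^sub>R G (x - y) \<partial>lborel) < e" if x': "dist x' x < d" for x'
    proof -
      have "dist (\<integral>y. f y *\<^sub>R G (x' - y) \<partial>lborel) (\<integral>y. f y *\<^sub>R G (x - y) \<partial>lborel)
        = norm (\<integral>y. f y *\<^sub>R (G (x' - y) - G (x - y)) \<partial>lborel)"
        using iG by (simp add: dist_norm scaleR_diff_right)
      also have "\<dots> \<le> (\<integral>y. \<bar>f y\<bar> * e' \<partial>lborel)"
      proof (rule norm_integral_le)
        show "integrable lborel (\<lambda>y. f y *\<^sub>R (G (x' - y) - G (x - y)))" using iG by (simp add: scaleR_diff_right)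
        show "integrable lborel (\<lambda>y. \<bar>f y\<bar> * e')" using f by simp
        show "norm (f y *\<^sub>R (G (x' - y) - G (x - y))) \<le> \<bar>f y\<bar> * e'" for y
          using d(2)[of "x' - y" "x - y"] x' by (simp add: dist_norm mult_left_mono less_imp_le)
      qed
      also have "\<dots> = I * e'" by (simp add: I_def)
      also have "\<dots> < e" using \<open>0 < e\<close> I by (simp add: e'_def field_simps)
      finally show ?thesis .
    qed
    then show "\<exists>d>0. \<forall>x'\<in>UNIV. dist x' x < d \<longrightarrow> dist (\<integral>y. f y *\<^sub>R G (x' - y) \<partial>lborel) (\<integral>y. f y *\<^sub>R G (x - y) \<partial>lborel) < e"
      using d(1) by blast
  qed
  show "((\<lambda>x. \<integral>y. f y * \<rho> (x - y) \<partial>lborel) has_derivative (\<lambda>h. (\<integral>y. f y *\<^sub>R G (x - y) \<partial>lborel) \<bullet> h)) (at x)"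
    unfolding has_derivative_at_alt
  proof (intro conjI allI impI)
    show "bounded_linear (\<lambda>h. (\<integral>y. f y *\<^sub>R G (x - y) \<partial>lborel) \<bullet> h)" by (rule bounded_linear_inner_right)
    fix e :: real assume "0 < e"
    define e' where "e' = e / (I + 1)"
    have e': "0 < e'" using \<open>0 < e\<close> I by (simp add: e'_def)
    obtain d where d: "0 < d" "\<And>z h. norm h < d \<Longrightarrow> \<bar>\<rho> (z + h) - \<rho> z - G z \<bullet> h\<bar> \<le> e' * norm h"
      by (rule first_order_uniform[OF \<rho> G e']) (rule that)
    have "norm ((\<integral>y. f y * \<rho> (x' - y) \<partial>lborel) - (\<integral>y. f y * \<rho> (x - y) \<partial>lborel) - (\<integral>y. f y *\<^sub>R G (x - y) \<partial>lborel) \<bullet> (x' - x))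
      \<le> e * norm (x' - x)" if x': "norm (x' - x) < d" for x'
    proof -
      define h where "h = x' - x"
      have iGh: "integrable lborel (\<lambda>y. f y * (G (x - y) \<bullet> h))"
        using integrable_inner_left[of h, OF iG[of x]] by (simp)
      have "(\<integral>y. f y *\<^sub>R G (x - y) \<partial>lborel) \<bullet> h = (\<integral>y. f y * (G (x - y) \<bullet> h) \<partial>lborel)"
        using integral_inner_left[of h, OF iG[of x]] by simp
      then have "(\<integral>y. f y * \<rho> (x' - y) \<partial>lborel) - (\<integral>y. f y * \<rho> (x - y) \<partial>lborel) - (\<integral>y. f y *\<^sub>R G (x - y) \<partial>lborel) \<bullet> h
        = (\<integral>y. f y * (\<rho> (x' - y) - \<rho> (x - y) - G (x - y) \<bullet> h) \<partial>lborel)"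
        using i\<rho> iGh by (simp add: right_diff_distrib)
      also have "norm \<dots> \<le> (\<integral>y. \<bar>f y\<bar> * (e' * norm h) \<partial>lborel)"
      proof (rule norm_integral_le)
        show "integrable lborel (\<lambda>y. f y * (\<rho> (x' - y) - \<rho> (x - y) - G (x - y) \<bullet> h))"
          using i\<rho> iGh by (simp add: right_diff_distrib)
        show "integrable lborel (\<lambda>y. \<bar>f y\<bar> * (e' * norm h))" using f by simp
        show "norm (f y * (\<rho> (x' - y) - \<rho> (x - y) - G (x - y) \<bullet> h)) \<le> \<bar>f y\<bar> * (e' * norm h)" for y
        proof -
          have "x - y + h = x' - y" by (simp add: h_def)
          then have "\<bar>\<rho> (x' - y) - \<rho> (x - y) - G (x - y) \<bullet> h\<bar> \<le> e' * norm h"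
            using d(2)[of h "x - y"] x' by (simp add: h_def)
          then show ?thesis by (simp add: abs_mult mult_left_mono)
        qed
      qed
      also have "\<dots> = I * e' * norm h" by (simp add: I_def)
      also have "\<dots> \<le> e * norm h"
        using \<open>0 < e\<close> I by (intro mult_right_mono) (simp_all add: e'_def field_simps)
      finally show ?thesis by (simp add: h_def)
    qed
    then show "\<exists>d>0. \<forall>y. norm (y - x) < d \<longrightarrow>
        norm ((\<integral>ya. f ya * \<rho> (y - ya) \<partial>lborel) - (\<integral>y. f y * \<rho> (x - y) \<partial>lborel) - (\<integral>y. f y *\<^sub>R G (x - y) \<partial>lborel) \<bullet> (y - x))
        \<le> e * norm (y - x)"
      using d(1) by blast
  qed
qed


text \<open>The mass depends on the dimension, which only the type records; hence the type
  argument.\<close>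

definition bump_mass :: "real \<Rightarrow> 'a::euclidean_space itself \<Rightarrow> real" where
  "bump_mass \<epsilon> _ = (\<integral>z. bump \<epsilon> (z :: 'a) \<partial>lborel)"

definition mollifier :: "real \<Rightarrow> 'a::euclidean_space \<Rightarrow> real" where
  "mollifier \<epsilon> z = bump \<epsilon> z / bump_mass \<epsilon> TYPE('a)"

definition mollifier_grad :: "real \<Rightarrow> 'a::euclidean_space \<Rightarrow> 'a" where
  "mollifier_grad \<epsilon> z = (1 / bump_mass \<epsilon> TYPE('a)) *\<^sub>R bump_grad 0 (\<epsilon>\<^sup>2) z"

lemma bump_integrable: "0 < \<epsilon> \<Longrightarrow> integrable lborel (bump \<epsilon>)"
  by (rule integrable_of_ball_support[OF continuous_bump, of \<epsilon>]) (rule bump_eq_0)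

lemma bump_mass_pos:
  assumes "0 < \<epsilon>"
  shows "0 < bump_mass \<epsilon> TYPE('a::euclidean_space)"
proof -
  have "bump_mass \<epsilon> TYPE('a) \<noteq> 0"
  proof
    assume "bump_mass \<epsilon> TYPE('a) = 0"
    then have "AE z in lborel. bump \<epsilon> (z :: 'a) = 0"
      using integral_nonneg_eq_0_iff_AE[OF bump_integrable[OF assms, where 'a = 'a]] by (simp add: bump_mass_def bump_nonneg)
    then have "AE z in lborel. (z :: 'a) \<notin> ball 0 \<epsilon>"
      by eventually_elim (use bump_pos_iff[OF assms] in force)
    then have "emeasure lborel (ball (0 :: 'a) \<epsilon>) = 0" by (subst (asm) AE_iff_measurable[OF _ refl]) (auto simp: ball_def)
    then show False using measure_pos_open[of "ball (0 :: 'a) \<epsilon>"] assms by (simp add: measure_def)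
  qed
  moreover have "0 \<le> bump_mass \<epsilon> TYPE('a)" by (simp add: bump_mass_def bump_nonneg)
  ultimately show ?thesis by simp
qed

lemma mollifier_nonneg: "0 < \<epsilon> \<Longrightarrow> 0 \<le> mollifier \<epsilon> z"
  for z :: "'a::euclidean_space"
  using bump_mass_pos[of \<epsilon>, where 'a = 'a] by (simp add: mollifier_def bump_nonneg)

lemma mollifier_eq_0: "0 < \<epsilon> \<Longrightarrow> \<epsilon> \<le> norm z \<Longrightarrow> mollifier \<epsilon> z = 0"
  by (simp add: mollifier_def bump_eq_0)

lemma mollifier_grad_eq_0: "0 < \<epsilon> \<Longrightarrow> \<epsilon> \<le> norm z \<Longrightarrow> mollifier_grad \<epsilon> z = 0"
  by (simp add: mollifier_grad_def bump_grad_eq_0)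

lemma mollifier_even: "mollifier \<epsilon> (x - y) = mollifier \<epsilon> (y - x)"
  by (simp add: mollifier_def bump_def inner_diff_left inner_diff_right inner_commute algebra_simps)

lemma mollifier_grad_odd: "mollifier_grad \<epsilon> (x - y) = - mollifier_grad \<epsilon> (y - x)"
proof -
  have "(x - y) \<bullet> (x - y) = (y - x) \<bullet> (y - x)"
    by (simp add: inner_diff_left inner_diff_right inner_commute algebra_simps)
  moreover have "x - y = - (y - x)" by simp
  ultimately show ?thesis
    unfolding mollifier_grad_def bump_grad_def by (metis scaleR_minus_right)
qed

lemma continuous_mollifier: "continuous_on S (mollifier \<epsilon>)"
  unfolding mollifier_def[abs_def] divide_inverse by (intro continuous_intros continuous_bump)

lemma continuous_mollifier_grad: "continuous_on S (mollifier_grad \<epsilon>)"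
  unfolding mollifier_grad_def[abs_def] by (intro continuous_intros continuous_bump_grad)

lemma mollifier_has_derivative: "(mollifier \<epsilon> has_derivative (\<lambda>h. mollifier_grad \<epsilon> z \<bullet> h)) (at z)"
  for z :: "'a::euclidean_space"
proof -
  have "((\<lambda>z::'a. (1 / bump_mass \<epsilon> TYPE('a)) * bump \<epsilon> z) has_derivative
      (\<lambda>h. (1 / bump_mass \<epsilon> TYPE('a)) * (bump_grad 0 (\<epsilon>\<^sup>2) z \<bullet> h))) (at z)"
    by (rule has_derivative_mult_right[OF bump_has_derivative])
  then show ?thesis by (simp add: mollifier_def[abs_def] mollifier_grad_def)
qed

lemma mollifier_integral:
  assumes "0 < \<epsilon>"
  shows "integrable lborel (mollifier \<epsilon> :: 'a::euclidean_space \<Rightarrow> real)" "(\<integral>z. mollifier \<epsilon> (z :: 'a) \<partial>lborel) = 1"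
  using bump_integrable[OF assms, where 'a = 'a] bump_mass_pos[OF assms, where 'a = 'a]
  by (auto simp: mollifier_def[abs_def] bump_mass_def)

text \<open>This makes the translated kernel, as a function of \<open>y\<close>, admissible in the
  definition of the weak gradient. The closed ball is what contains the closure of the
  support.\<close>

lemma mollifier_test_fun:
  fixes x :: "'a::euclidean_space"
  assumes \<epsilon>: "0 < \<epsilon>" and x: "cball x \<epsilon> \<subseteq> \<Omega>"
  shows "test_fun \<Omega> (\<lambda>y. mollifier \<epsilon> (y - x))"
  unfolding test_fun_def
proof (intro conjI)
  have "bump_algebra (\<lambda>y. (1 / bump_mass \<epsilon> TYPE('a)) * exp_recip 0 (\<epsilon>\<^sup>2 - (y - x) \<bullet> (y - x)))"
    by (intro bump_algebra.intros)
  then show "smooth_fun (\<lambda>y. mollifier \<epsilon> (y - x))"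
    using bump_algebra_smooth by (force simp: mollifier_def bump_def)
  have "{y. mollifier \<epsilon> (y - x) \<noteq> 0} \<subseteq> cball x \<epsilon>"
    using mollifier_eq_0[OF \<epsilon>] by (force simp: dist_norm norm_minus_commute)
  then have sub: "closure {y. mollifier \<epsilon> (y - x) \<noteq> 0} \<subseteq> cball x \<epsilon>" by (intro closure_minimal) auto
  then show "compact (closure {y. mollifier \<epsilon> (y - x) \<noteq> 0})"
    by (meson bounded_cball bounded_subset closed_closure compact_eq_bounded_closed)
  show "closure {y. mollifier \<epsilon> (y - x) \<noteq> 0} \<subseteq> \<Omega>" using sub x by blast
qed

lemma measurable_lebesgue_continuous:
  fixes h :: "'a::euclidean_space \<Rightarrow> 'b::euclidean_space"
  shows "continuous_on UNIV h \<Longrightarrow> h \<in> borel_measurable lebesgue"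
  by (rule measurable_completion) (simp add: borel_measurable_continuous_onI)

text \<open>Testing the weak gradient with the kernel centred at \<open>x\<close> moves the
  derivative from the kernel onto \<open>g\<close>. The minus sign of integration by parts cancels
  against the oddness of the gradient of the kernel.\<close>

lemma weak_gradient_mollified:
  fixes \<Omega> :: "'a::euclidean_space set"
  assumes wg: "weak_gradient_W11 \<Omega> u g" and \<epsilon>: "0 < \<epsilon>" and x: "cball x \<epsilon> \<subseteq> \<Omega>"
  shows "(\<integral>y. (indicator \<Omega> y *\<^sub>R u y) *\<^sub>R mollifier_grad \<epsilon> (x - y) \<partial>lebesgue)
    = (\<integral>y. mollifier \<epsilon> (x - y) *\<^sub>R (indicator \<Omega> y *\<^sub>R g y) \<partial>lebesgue)" (is "?L = ?R")
    and "integrable lebesgue (\<lambda>y. mollifier \<epsilon> (x - y) *\<^sub>R (indicator \<Omega> y *\<^sub>R g y))"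
proof -
  have ui: "integrable lebesgue (\<lambda>y. indicator \<Omega> y *\<^sub>R u y)" and gi: "integrable lebesgue (\<lambda>y. indicator \<Omega> y *\<^sub>R g y)"
    using wg by (auto simp: weak_gradient_W11_def set_integrable_def)
  obtain B where B: "\<And>z::'a. norm (mollifier \<epsilon> z) \<le> B"
    using bounded_of_ball_support[OF continuous_mollifier, of \<epsilon>] mollifier_eq_0[OF \<epsilon>] by metis
  obtain B' where B': "\<And>z::'a. norm (mollifier_grad \<epsilon> z) \<le> B'"
    using bounded_of_ball_support[OF continuous_mollifier_grad, of \<epsilon>] mollifier_grad_eq_0[OF \<epsilon>] by metis
  have cm: "continuous_on UNIV (\<lambda>y. mollifier \<epsilon> (x - y))" "continuous_on UNIV (\<lambda>y. mollifier_grad \<epsilon> (x - y))"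
    by (rule continuous_on_compose2[OF continuous_mollifier], auto intro!: continuous_intros)
      (rule continuous_on_compose2[OF continuous_mollifier_grad], auto intro!: continuous_intros)
  have Li: "integrable lebesgue (\<lambda>y. (indicator \<Omega> y *\<^sub>R u y) *\<^sub>R mollifier_grad \<epsilon> (x - y))"
    by (rule integrable_mult_bounded[OF ui measurable_lebesgue_continuous[OF cm(2)] B'])
  show Ri: "integrable lebesgue (\<lambda>y. mollifier \<epsilon> (x - y) *\<^sub>R (indicator \<Omega> y *\<^sub>R g y))"
  proof (rule Bochner_Integration.integrable_bound)
    show "integrable lebesgue (\<lambda>y. B * norm (indicator \<Omega> y *\<^sub>R g y))"
      by (intro integrable_mult_right integrable_norm gi)
    show "(\<lambda>y. mollifier \<epsilon> (x - y) *\<^sub>R (indicator \<Omega> y *\<^sub>R g y)) \<in> borel_measurable lebesgue"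
      by (rule borel_measurable_scaleR[OF measurable_lebesgue_continuous[OF cm(1)] borel_measurable_integrable[OF gi]])
    have "norm (mollifier \<epsilon> (x - y) *\<^sub>R (indicator \<Omega> y *\<^sub>R g y)) \<le> norm (B * norm (indicator \<Omega> y *\<^sub>R g y))" for y
    proof -
      have "norm (mollifier \<epsilon> (x - y) *\<^sub>R (indicator \<Omega> y *\<^sub>R g y)) \<le> B * norm (indicator \<Omega> y *\<^sub>R g y)"
        using B[of "x - y"] unfolding norm_scaleR[of "mollifier \<epsilon> (x - y)"] by (intro mult_right_mono) auto
      then show ?thesis by simp
    qed
    then show "AE y in lebesgue. norm (mollifier \<epsilon> (x - y) *\<^sub>R (indicator \<Omega> y *\<^sub>R g y)) \<le> norm (B * norm (indicator \<Omega> y *\<^sub>R g y))"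
      by simp
  qed
  show "?L = ?R"
  proof (rule euclidean_eqI)
    fix i :: 'a assume i: "i \<in> Basis"
    have fd: "frechet_derivative (\<lambda>y. mollifier \<epsilon> (y - x)) (at y) i = mollifier_grad \<epsilon> (y - x) \<bullet> i" for y
    proof -
      have "((\<lambda>y. y - x) has_derivative (\<lambda>h. h)) (at y)" by (auto intro!: derivative_eq_intros)
      from has_derivative_compose[OF this mollifier_has_derivative]
      have "((\<lambda>y. mollifier \<epsilon> (y - x)) has_derivative (\<lambda>h. mollifier_grad \<epsilon> (y - x) \<bullet> h)) (at y)" .
      from frechet_derivative_at[OF this, symmetric] show ?thesis by simp
    qed
    have "(LINT y:\<Omega>|lebesgue. u y * (mollifier_grad \<epsilon> (y - x) \<bullet> i)) = - (LINT y:\<Omega>|lebesgue. (g y \<bullet> i) * mollifier \<epsilon> (y - x))"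
      using wg mollifier_test_fun[OF \<epsilon> x] i unfolding weak_gradient_W11_def fd[symmetric] by blast
    then have eq: "(\<integral>y. indicator \<Omega> y *\<^sub>R (u y * (mollifier_grad \<epsilon> (y - x) \<bullet> i)) \<partial>lebesgue)
        = - (\<integral>y. indicator \<Omega> y *\<^sub>R ((g y \<bullet> i) * mollifier \<epsilon> (y - x)) \<partial>lebesgue)"
      by (simp add: set_lebesgue_integral_def)
    have "?L \<bullet> i = (\<integral>y. ((indicator \<Omega> y *\<^sub>R u y) *\<^sub>R mollifier_grad \<epsilon> (x - y)) \<bullet> i \<partial>lebesgue)"
      using integral_inner_left[of i, OF Li] by simp
    also have "\<dots> = (\<integral>y. - (indicator \<Omega> y *\<^sub>R (u y * (mollifier_grad \<epsilon> (y - x) \<bullet> i))) \<partial>lebesgue)"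
      by (intro Bochner_Integration.integral_cong refl) (simp add: mollifier_grad_odd[of \<epsilon> x])
    also have "\<dots> = (\<integral>y. indicator \<Omega> y *\<^sub>R ((g y \<bullet> i) * mollifier \<epsilon> (y - x)) \<partial>lebesgue)"
      unfolding Bochner_Integration.integral_minus eq by simp
    also have "\<dots> = (\<integral>y. (mollifier \<epsilon> (x - y) *\<^sub>R (indicator \<Omega> y *\<^sub>R g y)) \<bullet> i \<partial>lebesgue)"
      by (intro Bochner_Integration.integral_cong refl) (simp add: mollifier_even[of \<epsilon> x])
    also have "\<dots> = ?R \<bullet> i"
      using integral_inner_left[of i, OF Ri] by simp
    finally show "?L \<bullet> i = ?R \<bullet> i" .
  qed
qed

lemma nn_integral_translate:
  fixes h :: "'a::euclidean_space \<Rightarrow> ennreal"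
  assumes "h \<in> borel_measurable borel"
  shows "(\<integral>\<^sup>+x. h (z + x) \<partial>lborel) = (\<integral>\<^sup>+x. h x \<partial>lborel)"
proof -
  have "(\<integral>\<^sup>+x. h x \<partial>distr lborel borel ((+) z)) = (\<integral>\<^sup>+x. h (z + x) \<partial>lborel)"
    using assms by (intro nn_integral_distr) auto
  then show ?thesis by (simp add: lborel_distr_plus)
qed

lemma nn_integral_mollifier:
  fixes y :: "'a::euclidean_space"
  assumes "0 < \<epsilon>"
  shows "(\<integral>\<^sup>+x. ennreal (mollifier \<epsilon> (x - y)) \<partial>lborel) = 1"
proof -
  have m: "mollifier \<epsilon> \<in> borel_measurable (borel :: 'a measure)"
    by (rule borel_measurable_continuous_onI[OF continuous_mollifier])
  have "(\<integral>\<^sup>+x. ennreal (mollifier \<epsilon> (- y + x)) \<partial>lborel) = (\<integral>\<^sup>+x. ennreal (mollifier \<epsilon> (x :: 'a)) \<partial>lborel)"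
    using m by (intro nn_integral_translate) measurable
  also have "\<dots> = ennreal (\<integral>x. mollifier \<epsilon> (x :: 'a) \<partial>lborel)"
    using mollifier_integral(1)[OF assms] mollifier_nonneg[OF assms] by (intro nn_integral_eq_integral) auto
  also have "\<dots> = 1" using mollifier_integral(2)[OF assms, where 'a = 'a] by simp
  finally show ?thesis by simp
qed

lemma mollifier_bounded:
  assumes "0 < \<epsilon>"
  obtains B where "\<And>z::'a::euclidean_space. \<bar>mollifier \<epsilon> z\<bar> \<le> B" "\<And>z::'a. norm (mollifier_grad \<epsilon> z) \<le> B"
proof -
  obtain B1 where B1: "\<And>z::'a. norm (mollifier \<epsilon> z) \<le> B1"
    using bounded_of_ball_support[OF continuous_mollifier, of \<epsilon>] mollifier_eq_0[OF assms] by metis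
  obtain B2 where B2: "\<And>z::'a. norm (mollifier_grad \<epsilon> z) \<le> B2"
    using bounded_of_ball_support[OF continuous_mollifier_grad, of \<epsilon>] mollifier_grad_eq_0[OF assms] by metis
  show ?thesis
  proof (rule that[of "max B1 B2"])
    show "\<bar>mollifier \<epsilon> z\<bar> \<le> max B1 B2" for z :: 'a using B1[of z] by simp
    show "norm (mollifier_grad \<epsilon> z) \<le> max B1 B2" for z :: 'a using B2[of z] by simp
  qed
qed

lemma mollifier_mult_integrable:
  fixes f :: "'a::euclidean_space \<Rightarrow> real"
  assumes "0 < \<epsilon>" "integrable lborel f"
  shows "integrable lborel (\<lambda>y. f y * mollifier \<epsilon> (x - y))" "integrable lborel (\<lambda>y. f y * mollifier \<epsilon> y)"
proof -
  obtain B where B: "\<And>z::'a. \<bar>mollifier \<epsilon> z\<bar> \<le> B" using mollifier_bounded[OF assms(1)] by metis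
  have "continuous_on UNIV (\<lambda>y. mollifier \<epsilon> (x - y))"
    by (rule continuous_on_compose2[OF continuous_mollifier]) (auto intro!: continuous_intros)
  then have "integrable lborel (\<lambda>y. f y *\<^sub>R mollifier \<epsilon> (x - y))"
    using B by (intro integrable_mult_bounded[OF assms(2), of _ B]) (auto intro: borel_measurable_continuous_onI)
  then show "integrable lborel (\<lambda>y. f y * mollifier \<epsilon> (x - y))" by simp
  have "integrable lborel (\<lambda>y. f y *\<^sub>R mollifier \<epsilon> y)"
    using B by (intro integrable_mult_bounded[OF assms(2), of _ B]) (auto intro: borel_measurable_continuous_onI continuous_mollifier)
  then show "integrable lborel (\<lambda>y. f y * mollifier \<epsilon> y)" by simp
qed

text \<open>On \<open>S\<close> the gradient of the mollified function is the mollification of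
  \<open>g\<close>, because the balls of radius \<open>\<epsilon>\<close> stay inside the domain.
  Taking norms inside the integral and exchanging the order of integration, the unit mass of the
  kernel gives a bound without any loss of constant. \<open>f\<close> and \<open>\<gamma>\<close>
  are Borel representatives.\<close>

lemma mollified_gradient_L1:
  fixes \<Omega> S :: "'a::euclidean_space set"
  assumes wg: "weak_gradient_W11 \<Omega> u g" and \<epsilon>: "0 < \<epsilon>"
    and f: "integrable lborel f" "AE y in lborel. indicator \<Omega> y *\<^sub>R u y = f y"
    and \<gamma>: "integrable lborel \<gamma>" "AE y in lborel. indicator \<Omega> y *\<^sub>R norm (g y) = \<gamma> y" "\<And>y. 0 \<le> \<gamma> y"
    and S: "open S" "bounded S" "\<And>x. x \<in> S \<Longrightarrow> cball x \<epsilon> \<subseteq> \<Omega>"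
  shows "(LINT x:S|lborel. norm (\<integral>y. f y *\<^sub>R mollifier_grad \<epsilon> (x - y) \<partial>lborel)) \<le> (\<integral>y. \<gamma> y \<partial>lborel)"
proof -
  define Gr where "Gr = (\<lambda>x. \<integral>y. f y *\<^sub>R mollifier_grad \<epsilon> (x - y) \<partial>lborel)"
  obtain B where B: "\<And>z::'a. \<bar>mollifier \<epsilon> z\<bar> \<le> B" "\<And>z::'a. norm (mollifier_grad \<epsilon> z) \<le> B"
    using mollifier_bounded[OF \<epsilon>] by metis
  have uc: "uniformly_continuous_on UNIV (mollifier_grad \<epsilon> :: 'a \<Rightarrow> 'a)"
    using uniformly_continuous_of_ball_support[OF continuous_mollifier_grad] mollifier_grad_eq_0[OF \<epsilon>] by metis
  have cGr: "continuous_on UNIV Gr"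
    unfolding Gr_def by (rule convolution_C1(2)[OF f(1) mollifier_has_derivative uc B])
  have fm[measurable]: "f \<in> borel_measurable borel" and \<gamma>m[measurable]: "\<gamma> \<in> borel_measurable borel"
    using f(1) \<gamma>(1) by (auto dest: borel_measurable_integrable)
  have mm[measurable]: "mollifier \<epsilon> \<in> borel_measurable (borel :: 'a measure)"
    by (rule borel_measurable_continuous_onI[OF continuous_mollifier])
  have mg[measurable]: "mollifier_grad \<epsilon> \<in> borel_measurable (borel :: 'a measure)"
    by (rule borel_measurable_continuous_onI[OF continuous_mollifier_grad])
  have m0: "0 \<le> mollifier \<epsilon> z" for z :: 'a by (rule mollifier_nonneg[OF \<epsilon>])
  have Sm[measurable]: "S \<in> sets borel" using S(1) by (rule borel_open)
  have pointwise: "norm (Gr x) \<le> (\<integral>y. \<gamma> y * mollifier \<epsilon> (x - y) \<partial>lborel)" if x: "x \<in> S" for x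
  proof -
    have "Gr x = (\<integral>y. f y *\<^sub>R mollifier_grad \<epsilon> (x - y) \<partial>lebesgue)"
      unfolding Gr_def by (rule integral_completion[symmetric]) measurable
    also have "\<dots> = (\<integral>y. (indicator \<Omega> y *\<^sub>R u y) *\<^sub>R mollifier_grad \<epsilon> (x - y) \<partial>lebesgue)"
    proof (rule integral_cong_AE)
      show "(\<lambda>y. f y *\<^sub>R mollifier_grad \<epsilon> (x - y)) \<in> borel_measurable lebesgue"
        by (rule measurable_completion) measurable
      have "integrable lebesgue (\<lambda>y. indicator \<Omega> y *\<^sub>R u y)" using wg by (simp add: weak_gradient_W11_def set_integrable_def)
      moreover have "(\<lambda>y. mollifier_grad \<epsilon> (x - y)) \<in> borel_measurable lebesgue"
        by (rule measurable_completion) measurable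
      ultimately show "(\<lambda>y. (indicator \<Omega> y *\<^sub>R u y) *\<^sub>R mollifier_grad \<epsilon> (x - y)) \<in> borel_measurable lebesgue"
        by (intro borel_measurable_scaleR[OF borel_measurable_integrable])
      show "AE y in lebesgue. f y *\<^sub>R mollifier_grad \<epsilon> (x - y) = (indicator \<Omega> y *\<^sub>R u y) *\<^sub>R mollifier_grad \<epsilon> (x - y)"
        using AE_completion[OF f(2)] by eventually_elim simp
    qed
    also have "\<dots> = (\<integral>y. mollifier \<epsilon> (x - y) *\<^sub>R (indicator \<Omega> y *\<^sub>R g y) \<partial>lebesgue)"
      by (rule weak_gradient_mollified(1)[OF wg \<epsilon> S(3)[OF x]])
    finally have "norm (Gr x) \<le> (\<integral>y. norm (mollifier \<epsilon> (x - y) *\<^sub>R (indicator \<Omega> y *\<^sub>R g y)) \<partial>lebesgue)"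
      using integral_norm_bound by metis
    also have "\<dots> = (\<integral>y. \<gamma> y * mollifier \<epsilon> (x - y) \<partial>lebesgue)"
    proof (rule integral_cong_AE)
      show "(\<lambda>y. norm (mollifier \<epsilon> (x - y) *\<^sub>R (indicator \<Omega> y *\<^sub>R g y))) \<in> borel_measurable lebesgue"
        by (intro borel_measurable_integrable integrable_norm weak_gradient_mollified(2)[OF wg \<epsilon> S(3)[OF x]])
      show "(\<lambda>y. \<gamma> y * mollifier \<epsilon> (x - y)) \<in> borel_measurable lebesgue"
        by (rule measurable_completion) measurable
      show "AE y in lebesgue. norm (mollifier \<epsilon> (x - y) *\<^sub>R (indicator \<Omega> y *\<^sub>R g y)) = \<gamma> y * mollifier \<epsilon> (x - y)"
        using AE_completion[OF \<gamma>(2)]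
      proof eventually_elim
        case (elim y)
        then show ?case using m0[of "x - y"] by (simp add: mult_ac flip: elim)
      qed
    qed
    also have "\<dots> = (\<integral>y. \<gamma> y * mollifier \<epsilon> (x - y) \<partial>lborel)"
      by (rule integral_completion) measurable
    finally show ?thesis .
  qed
  have Si: "set_integrable lborel S (\<lambda>x. norm (Gr x))"
    by (intro set_integrable_continuous_bounded S(2) Sm continuous_intros cGr)
  have "ennreal (LINT x:S|lborel. norm (Gr x)) = (\<integral>\<^sup>+x. ennreal (indicator S x *\<^sub>R norm (Gr x)) \<partial>lborel)"
    using Si unfolding set_integrable_def set_lebesgue_integral_def
    by (intro nn_integral_eq_integral[symmetric]) auto
  also have "\<dots> \<le> (\<integral>\<^sup>+x. \<integral>\<^sup>+y. ennreal (\<gamma> y * mollifier \<epsilon> (x - y)) \<partial>lborel \<partial>lborel)"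
  proof (rule nn_integral_mono)
    fix x :: 'a
    have "(\<integral>\<^sup>+y. ennreal (\<gamma> y * mollifier \<epsilon> (x - y)) \<partial>lborel) = ennreal (\<integral>y. \<gamma> y * mollifier \<epsilon> (x - y) \<partial>lborel)"
      using \<gamma>(3) m0
      by (intro nn_integral_eq_integral mollifier_mult_integrable \<epsilon> \<gamma>) auto
    then show "ennreal (indicator S x *\<^sub>R norm (Gr x)) \<le> (\<integral>\<^sup>+y. ennreal (\<gamma> y * mollifier \<epsilon> (x - y)) \<partial>lborel)"
      using pointwise[of x] by (cases "x \<in> S") (auto intro: ennreal_leI)
  qed
  also have "\<dots> = (\<integral>\<^sup>+y. \<integral>\<^sup>+x. ennreal (\<gamma> y * mollifier \<epsilon> (x - y)) \<partial>lborel \<partial>lborel)"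
    by (rule lborel_pair.Fubini') measurable
  also have "\<dots> = (\<integral>\<^sup>+y. ennreal (\<gamma> y) \<partial>lborel)"
  proof (rule nn_integral_cong)
    fix y :: 'a
    have "(\<integral>\<^sup>+x. ennreal (\<gamma> y * mollifier \<epsilon> (x - y)) \<partial>lborel) = (\<integral>\<^sup>+x. ennreal (\<gamma> y) * ennreal (mollifier \<epsilon> (x - y)) \<partial>lborel)"
      using \<gamma>(3) m0 by (simp add: ennreal_mult)
    also have "\<dots> = ennreal (\<gamma> y)"
      by (subst nn_integral_cmult) (measurable, simp add: nn_integral_mollifier[OF \<epsilon>])
    finally show "(\<integral>\<^sup>+x. ennreal (\<gamma> y * mollifier \<epsilon> (x - y)) \<partial>lborel) = ennreal (\<gamma> y)" .
  qed
  also have "\<dots> = ennreal (\<integral>y. \<gamma> y \<partial>lborel)"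
    using \<gamma> by (intro nn_integral_eq_integral) auto
  finally show ?thesis
    unfolding Gr_def by (subst (asm) ennreal_le_iff) (auto intro!: integral_nonneg_AE \<gamma>(3))
qed

text \<open>The mollified function minus \<open>f\<close> is an average of the differences
  \<open>f (x + z) - f x\<close>, weighted by a kernel of mass 1. After exchanging integrals, only
  translations shorter than \<open>\<epsilon>\<close> carry weight, and each contributes at most
  \<open>\<delta>\<close>.\<close>

lemma mollified_L1_close:
  fixes f :: "'a::euclidean_space \<Rightarrow> real"
  assumes \<epsilon>: "0 < \<epsilon>" and f: "integrable lborel f"
    and tr: "\<And>z. norm z < \<epsilon> \<Longrightarrow> (\<integral>x. \<bar>f (z + x) - f x\<bar> \<partial>lborel) \<le> \<delta>"
    and U: "continuous_on UNIV (\<lambda>x. \<integral>y. f y * mollifier \<epsilon> (x - y) \<partial>lborel)" and S: "open S" "bounded S"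
  shows "(LINT x:S|lborel. \<bar>(\<integral>y. f y * mollifier \<epsilon> (x - y) \<partial>lborel) - f x\<bar>) \<le> \<delta>"
proof -
  define U where "U = (\<lambda>x. \<integral>y. f y * mollifier \<epsilon> (x - y) \<partial>lborel)"
  have fm[measurable]: "f \<in> borel_measurable borel"
    using f by (auto dest: borel_measurable_integrable)
  have mm[measurable]: "mollifier \<epsilon> \<in> borel_measurable (borel :: 'a measure)"
    by (rule borel_measurable_continuous_onI[OF continuous_mollifier])
  have m0: "0 \<le> mollifier \<epsilon> z" for z :: 'a by (rule mollifier_nonneg[OF \<epsilon>])
  have Sm[measurable]: "S \<in> sets borel" using S(1) by (rule borel_open)
  have "\<delta> \<ge> 0" using tr[of 0] \<epsilon> by simp
  note fz = translation_diff_integrable[OF f]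
  have fd: "integrable lborel (\<lambda>z. \<bar>f (x + z) - f x\<bar> * mollifier \<epsilon> z)"
    "U x - f x = (\<integral>z. (f (x + z) - f x) * mollifier \<epsilon> z \<partial>lborel)" for x
  proof -
    have m1: "integrable lborel (\<lambda>z. f (x + z) * mollifier \<epsilon> z)"
      by (rule mollifier_mult_integrable(2)[OF \<epsilon> fz(2)])
    have m2: "integrable lborel (\<lambda>z :: 'a. f x * mollifier \<epsilon> z)"
      using mollifier_integral(1)[OF \<epsilon>, where 'a = 'a] by simp
    have m3: "integrable lborel (\<lambda>z. (f (x + z) - f x) * mollifier \<epsilon> z)"
      using m1 m2 by (simp add: left_diff_distrib)
    have "\<bar>(f (x + z) - f x) * mollifier \<epsilon> z\<bar> = \<bar>f (x + z) - f x\<bar> * mollifier \<epsilon> z" for z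
      using m0[of z] by (simp add: abs_mult)
    then show "integrable lborel (\<lambda>z. \<bar>f (x + z) - f x\<bar> * mollifier \<epsilon> z)"
      using integrable_abs[OF m3] by simp
    have "U x = (\<integral>y. f y * mollifier \<epsilon> (y - x) \<partial>lborel)"
      unfolding U_def using mollifier_even[of \<epsilon> x] by simp
    also have "\<dots> = (\<integral>z. f (x + z) * mollifier \<epsilon> (x + z - x) \<partial>lborel)"
      by (rule lborel_translate(1)[symmetric]) measurable
    finally have "U x = (\<integral>z. f (x + z) * mollifier \<epsilon> z \<partial>lborel)" by simp
    moreover have "f x = (\<integral>z. f x * mollifier \<epsilon> (z :: 'a) \<partial>lborel)"
      using mollifier_integral(2)[OF \<epsilon>, where 'a = 'a] by simp
    ultimately show "U x - f x = (\<integral>z. (f (x + z) - f x) * mollifier \<epsilon> z \<partial>lborel)"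
      using m1 m2 by (simp add: left_diff_distrib)
  qed
  have pointwise: "\<bar>U x - f x\<bar> \<le> (\<integral>z. \<bar>f (x + z) - f x\<bar> * mollifier \<epsilon> z \<partial>lborel)" for x
  proof -
    have "\<bar>U x - f x\<bar> \<le> (\<integral>z. \<bar>(f (x + z) - f x) * mollifier \<epsilon> z\<bar> \<partial>lborel)"
      unfolding fd(2) using integral_norm_bound[of lborel "\<lambda>z. (f (x + z) - f x) * mollifier \<epsilon> z"] by simp
    then show ?thesis using m0 by (simp add: abs_mult)
  qed
  have Si: "set_integrable lborel S (\<lambda>x. \<bar>U x - f x\<bar>)"
  proof -
    have "set_integrable lborel S U" unfolding U_def by (rule set_integrable_continuous_bounded[OF U Sm S(2)])
    moreover have "set_integrable lborel S f"
      unfolding set_integrable_def using f Sm by (intro integrable_mult_indicator) auto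
    ultimately show ?thesis by (intro set_integrable_abs set_integral_diff(1))
  qed
  have "ennreal (LINT x:S|lborel. \<bar>U x - f x\<bar>) = (\<integral>\<^sup>+x. ennreal (indicator S x *\<^sub>R \<bar>U x - f x\<bar>) \<partial>lborel)"
    using Si unfolding set_integrable_def set_lebesgue_integral_def
    by (intro nn_integral_eq_integral[symmetric]) auto
  also have "\<dots> \<le> (\<integral>\<^sup>+x. \<integral>\<^sup>+z. ennreal (\<bar>f (x + z) - f x\<bar> * mollifier \<epsilon> z) \<partial>lborel \<partial>lborel)"
  proof (rule nn_integral_mono)
    fix x :: 'a
    have "(\<integral>\<^sup>+z. ennreal (\<bar>f (x + z) - f x\<bar> * mollifier \<epsilon> z) \<partial>lborel) = ennreal (\<integral>z. \<bar>f (x + z) - f x\<bar> * mollifier \<epsilon> z \<partial>lborel)"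
      using m0 by (intro nn_integral_eq_integral fd) auto
    then show "ennreal (indicator S x *\<^sub>R \<bar>U x - f x\<bar>) \<le> (\<integral>\<^sup>+z. ennreal (\<bar>f (x + z) - f x\<bar> * mollifier \<epsilon> z) \<partial>lborel)"
      using pointwise[of x] by (cases "x \<in> S") (auto intro: ennreal_leI)
  qed
  also have "\<dots> = (\<integral>\<^sup>+z. \<integral>\<^sup>+x. ennreal (\<bar>f (x + z) - f x\<bar> * mollifier \<epsilon> z) \<partial>lborel \<partial>lborel)"
    by (rule lborel_pair.Fubini') measurable
  also have "\<dots> \<le> (\<integral>\<^sup>+z. ennreal \<delta> * ennreal (mollifier \<epsilon> (z - 0)) \<partial>(lborel :: 'a measure))"
  proof (rule nn_integral_mono)
    fix z :: 'a
    have "(\<integral>\<^sup>+x. ennreal (\<bar>f (x + z) - f x\<bar> * mollifier \<epsilon> z) \<partial>lborel) = (\<integral>\<^sup>+x. ennreal (\<bar>f (z + x) - f x\<bar>) * ennreal (mollifier \<epsilon> z) \<partial>lborel)"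
      using m0 by (simp add: ennreal_mult add.commute)
    also have "\<dots> = (\<integral>\<^sup>+x. ennreal (\<bar>f (z + x) - f x\<bar>) \<partial>lborel) * ennreal (mollifier \<epsilon> z)"
      by (rule nn_integral_multc) measurable
    also have "(\<integral>\<^sup>+x. ennreal (\<bar>f (z + x) - f x\<bar>) \<partial>lborel) = ennreal (\<integral>x. \<bar>f (z + x) - f x\<bar> \<partial>lborel)"
      by (intro nn_integral_eq_integral fz) auto
    also have "\<dots> * ennreal (mollifier \<epsilon> z) \<le> ennreal \<delta> * ennreal (mollifier \<epsilon> z)"
      using tr[of z] mollifier_eq_0[OF \<epsilon>, of z] by (cases "norm z < \<epsilon>") (auto intro!: mult_right_mono ennreal_leI)
    finally show "(\<integral>\<^sup>+x. ennreal (\<bar>f (x + z) - f x\<bar> * mollifier \<epsilon> z) \<partial>lborel) \<le> ennreal \<delta> * ennreal (mollifier \<epsilon> (z - 0))" by simp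
  qed
  also have "\<dots> = ennreal \<delta>"
    by (subst nn_integral_cmult) (measurable, simp only: nn_integral_mollifier[OF \<epsilon>] mult_1_right)
  finally show ?thesis unfolding U_def using \<open>\<delta> \<ge> 0\<close> by (simp add: ennreal_le_iff)
qed

section \<open>Proof of the theorem\<close>

text \<open>Exactly the points at which the mollifier of radius \<open>r\<close> is a test function
  on the domain.\<close>

definition inner_parallel :: "'a::euclidean_space set \<Rightarrow> real \<Rightarrow> 'a set" where
  "inner_parallel \<Omega> r = {x. cball x r \<subseteq> \<Omega>}"

lemma inner_parallel_subset: "0 \<le> r \<Longrightarrow> inner_parallel \<Omega> r \<subseteq> \<Omega>"
  by (auto simp: inner_parallel_def)

lemma inner_parallel_antimono: "r \<le> s \<Longrightarrow> inner_parallel \<Omega> s \<subseteq> inner_parallel \<Omega> r"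
  unfolding inner_parallel_def using subset_cball by blast

text \<open>A compact ball inside an open set keeps a positive distance from the complement, so it
  may be shifted slightly.\<close>

lemma open_inner_parallel:
  fixes \<Omega> :: "'a::euclidean_space set"
  assumes "open \<Omega>" "0 \<le> r"
  shows "open (inner_parallel \<Omega> r)"
  unfolding open_dist
proof
  fix x assume "x \<in> inner_parallel \<Omega> r"
  then have "cball x r \<subseteq> \<Omega>" by (simp add: inner_parallel_def)
  then obtain d where d: "0 < d" "(\<Union>y\<in>cball x r. ball y d) \<subseteq> \<Omega>"
    using compact_subset_open_imp_ball_epsilon_subset[OF compact_cball assms(1)] by metis
  have "x' \<in> inner_parallel \<Omega> r" if "dist x' x < d" for x'
    unfolding inner_parallel_def
  proof (intro CollectI subsetI)
    fix z assume "z \<in> cball x' r"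
    then have "z + (x - x') \<in> cball x r" by (simp add: dist_norm algebra_simps)
    moreover have "z \<in> ball (z + (x - x')) d" using that by (simp add: dist_norm norm_minus_commute)
    ultimately show "z \<in> \<Omega>" using d(2) by blast
  qed
  then show "\<exists>e>0. \<forall>y. dist y x < e \<longrightarrow> y \<in> inner_parallel \<Omega> r" using d(1) by blast
qed

text \<open>A point of the ball around a combination of \<open>x\<close> and \<open>y\<close> is the
  same combination of \<open>x\<close> and \<open>y\<close>, both displaced by one vector of length
  at most \<open>r\<close>.\<close>

lemma convex_inner_parallel:
  assumes "convex \<Omega>"
  shows "convex (inner_parallel \<Omega> r)"
  unfolding convex_alt inner_parallel_def
proof (intro ballI allI impI CollectI subsetI)
  fix x y :: 'a and t and z
  assume x: "x \<in> {x. cball x r \<subseteq> \<Omega>}" and y: "y \<in> {x. cball x r \<subseteq> \<Omega>}" and t: "0 \<le> t \<and> t \<le> 1"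
    and z: "z \<in> cball ((1 - t) *\<^sub>R x + t *\<^sub>R y) r"
  define v where "v = z - ((1 - t) *\<^sub>R x + t *\<^sub>R y)"
  have "norm v \<le> r" using z by (simp add: v_def dist_norm norm_minus_commute)
  then have "x + v \<in> \<Omega>" "y + v \<in> \<Omega>" using x y by (auto simp: dist_norm subset_iff)
  then have "(1 - t) *\<^sub>R (x + v) + t *\<^sub>R (y + v) \<in> \<Omega>" using assms t by (simp add: convex_alt)
  moreover have "(1 - t) *\<^sub>R (x + v) + t *\<^sub>R (y + v) = z" by (simp add: v_def algebra_simps)
  ultimately show "z \<in> \<Omega>" by simp
qed

lemma inner_parallel_Un:
  fixes \<Omega> :: "'a::euclidean_space set"
  assumes "open \<Omega>"
  shows "(\<Union>n. inner_parallel \<Omega> (inverse (real (Suc n)))) = \<Omega>"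
proof (intro equalityI subsetI)
  fix x assume "x \<in> \<Omega>"
  then obtain e where e: "0 < e" "cball x e \<subseteq> \<Omega>" using assms open_contains_cball by blast
  obtain n where "inverse (real (Suc n)) < e" using reals_Archimedean[OF e(1)] by blast
  then have "x \<in> inner_parallel \<Omega> (inverse (real (Suc n)))"
    using e(2) subset_cball[of "inverse (real (Suc n))" e x] by (auto simp: inner_parallel_def)
  then show "x \<in> (\<Union>n. inner_parallel \<Omega> (inverse (real (Suc n))))" by blast
next
  fix x assume "x \<in> (\<Union>n. inner_parallel \<Omega> (inverse (real (Suc n))))"
  then obtain n where "x \<in> inner_parallel \<Omega> (inverse (real (Suc n)))" by blast
  then show "x \<in> \<Omega>" using inner_parallel_subset[of "inverse (real (Suc n))" \<Omega>] by auto
qed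

text \<open>Replacing the function costs one copy of the distance and replacing its mean another,
  each multiplied by the volume.\<close>

lemma deviation_perturb:
  fixes S :: "'a::euclidean_space set" and f h :: "'a \<Rightarrow> real"
  assumes S: "open S" "bounded S" and f: "set_integrable lborel S f" and h: "set_integrable lborel S h"
  shows "(LINT x:S|lborel. \<bar>measure lborel S * f x - (LINT z:S|lborel. f z)\<bar>)
    \<le> (LINT x:S|lborel. \<bar>measure lborel S * h x - (LINT z:S|lborel. h z)\<bar>)
      + 2 * measure lborel S * (LINT x:S|lborel. \<bar>h x - f x\<bar>)"
proof -
  define V where "V = measure lborel S"
  have V: "0 \<le> V" by (simp add: V_def)
  have cst: "(LINT x:S|lborel. (k::real)) = k * V" for k
    by (simp add: set_lebesgue_integral_def V_def mult.commute)
  have csti: "set_integrable lborel S (\<lambda>_. k)" for k :: real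
    using S by (intro set_integrable_continuous_bounded) (auto intro: borel_open)
  define D where "D = (LINT x:S|lborel. \<bar>h x - f x\<bar>)"
  have hf: "set_integrable lborel S (\<lambda>x. \<bar>h x - f x\<bar>)"
    by (intro set_integrable_abs set_integral_diff(1) f h)
  have m: "\<bar>(LINT z:S|lborel. h z) - (LINT z:S|lborel. f z)\<bar> \<le> D"
  proof -
    have "(LINT z:S|lborel. h z) - (LINT z:S|lborel. f z) = (LINT z:S|lborel. h z - f z)"
      using f h by (simp add: set_integral_diff(2))
    then show ?thesis unfolding D_def
      using set_integral_norm_bound[of lborel S "\<lambda>z. h z - f z"] set_integral_diff(1)[OF h f] by simp
  qed
  have i: "set_integrable lborel S (\<lambda>x. \<bar>V * k x - c\<bar>)" if "set_integrable lborel S k" for k :: "'a \<Rightarrow> real" and c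
    using that csti by (intro set_integrable_abs set_integral_diff(1)) (auto intro: set_integrable_mult_right)
  have "(LINT x:S|lborel. \<bar>V * f x - (LINT z:S|lborel. f z)\<bar>)
    \<le> (LINT x:S|lborel. \<bar>V * h x - (LINT z:S|lborel. h z)\<bar> + (V * \<bar>h x - f x\<bar> + D))"
  proof (intro set_integral_mono set_integral_add(1) i f h csti set_integrable_mult_right)
    show "set_integrable lborel S (\<lambda>x. \<bar>h x - f x\<bar>)" by (rule hf)
    fix x
    have "\<bar>V * h x - V * f x\<bar> = V * \<bar>h x - f x\<bar>" using V by (simp add: abs_mult flip: right_diff_distrib)
    then show "\<bar>V * f x - (LINT z:S|lborel. f z)\<bar> \<le> \<bar>V * h x - (LINT z:S|lborel. h z)\<bar> + (V * \<bar>h x - f x\<bar> + D)"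
      using m by linarith
  qed
  also have "\<dots> = (LINT x:S|lborel. \<bar>V * h x - (LINT z:S|lborel. h z)\<bar>) + (V * D + D * V)"
    using i[OF h] hf csti by (simp add: set_integral_add cst D_def set_integrable_mult_right)
  finally show ?thesis by (simp add: V_def D_def)
qed

lemma set_integral_incseq_tendsto:
  fixes f :: "'a::euclidean_space \<Rightarrow> real"
  assumes A: "\<And>n. A n \<in> sets lborel" "incseq A" "(\<Union>n. A n) = \<Omega>" and f: "set_integrable lborel \<Omega> f"
  shows "(\<lambda>n. LINT x:A n|lborel. f x) \<longlonglongrightarrow> (LINT x:\<Omega>|lborel. f x)"
  using set_integral_cont_up[of A lborel f] A f by simp

text \<open>The smooth inequality is applied on the convex sets \<open>A n\<close> exhausting the
  domain, to \<open>f\<close> mollified at the radius that \<open>A n\<close> allows. For the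
  gradients an upper bound by the full integral of \<open>\<gamma>\<close> is enough; only the
  functions themselves have to converge. The centre \<open>c\<close> stays the same on all
  \<open>A n\<close>.\<close>

theorem poincare_lborel:
  fixes \<Omega> :: "'a::euclidean_space set"
  assumes \<Omega>: "open \<Omega>" "bounded \<Omega>" "convex \<Omega>" and wg: "weak_gradient_W11 \<Omega> u g"
    and f: "integrable lborel f" "AE y in lborel. indicator \<Omega> y *\<^sub>R u y = f y"
    and \<gamma>: "integrable lborel \<gamma>" "AE y in lborel. indicator \<Omega> y *\<^sub>R norm (g y) = \<gamma> y" "\<And>y. 0 \<le> \<gamma> y"
  shows "(LINT x:\<Omega>|lborel. \<bar>measure lborel \<Omega> * f x - (LINT z:\<Omega>|lborel. f z)\<bar>)
    \<le> (2 / ln 2) * (LINT x:\<Omega>|lborel. norm (x - c)) * (\<integral>y. \<gamma> y \<partial>lborel)"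
proof -
  define V J N \<kappa> where "V = measure lborel \<Omega>" and "J = (LINT x:\<Omega>|lborel. norm (x - c))"
    and "N = (\<integral>y. \<gamma> y \<partial>lborel)" and "\<kappa> = 2 / ln (2 :: real)"
  have \<kappa>: "0 < \<kappa>" by (simp add: \<kappa>_def)
  have N: "0 \<le> N" using \<gamma>(3) by (simp add: N_def)
  have \<Omega>b: "\<Omega> \<in> sets lborel" using \<Omega>(1) by (simp add: borel_open)
  define r where "r = (\<lambda>n. inverse (real (Suc n)))"
  have r: "0 < r n" for n by (simp add: r_def)
  define A where "A = (\<lambda>n. inner_parallel \<Omega> (r n))"
  have Ao: "open (A n)" for n unfolding A_def using \<Omega>(1) r by (intro open_inner_parallel) (auto simp: less_imp_le)
  have Asub: "A n \<subseteq> \<Omega>" for n unfolding A_def using r by (intro inner_parallel_subset) (auto simp: less_imp_le)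
  have Ab: "bounded (A n)" for n using Asub \<Omega>(2) bounded_subset by blast
  have Ac: "convex (A n)" for n unfolding A_def by (rule convex_inner_parallel[OF \<Omega>(3)])
  have Am: "A n \<in> sets lborel" for n using Ao by (simp add: borel_open)
  have Ainc: "incseq A" unfolding A_def r_def incseq_def by (auto intro!: inner_parallel_antimono simp: le_imp_inverse_le)
  have AU: "(\<Union>n. A n) = \<Omega>" unfolding A_def r_def by (rule inner_parallel_Un[OF \<Omega>(1)])
  have Acb: "cball x (r n) \<subseteq> \<Omega>" if "x \<in> A n" for x n using that by (simp add: A_def inner_parallel_def)
  have fi: "set_integrable lborel S f" if "S \<in> sets lborel" for S
    unfolding set_integrable_def using f(1) that by (intro integrable_mult_indicator)
  have mono_set: "(LINT x:A n|lborel. h x) \<le> (LINT x:\<Omega>|lborel. h x)"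
    if "set_integrable lborel \<Omega> h" "\<And>x. 0 \<le> h x" for h :: "'a \<Rightarrow> real" and n
  proof -
    have "set_integrable lborel (A n) h" by (rule set_integrable_subset[OF that(1) Am Asub])
    then show ?thesis
      using that Asub[of n] unfolding set_lebesgue_integral_def set_integrable_def
      by (intro integral_mono) (auto simp: indicator_def)
  qed
  define L where "L = (\<lambda>S. LINT x:S|lborel. \<bar>measure lborel S * f x - (LINT z:S|lborel. f z)\<bar>)"
  have mV: "measure lborel (A n) \<le> V" for n
    unfolding V_def using Asub \<Omega>(1,2) Am by (intro measure_mono_fmeasurable bounded_open_fmeasurable) auto
  \<comment> \<open>The mollification error is absorbed into \<open>\<delta>\<close> once the radius
    is below the modulus of continuity of translation. The deviation of \<open>f\<close> itself then
    remains, and only its domain still varies.\<close>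
  have bound: "\<exists>n0. \<forall>n\<ge>n0. L (A n) \<le> \<kappa> * J * N + 2 * V * \<delta>" if \<delta>: "0 < \<delta>" for \<delta>
  proof -
    obtain d where d: "0 < d" "\<And>z. norm z < d \<Longrightarrow> (\<integral>x. \<bar>f (z + x) - f x\<bar> \<partial>lborel) < \<delta>"
      using translation_continuous_integrable[OF f(1)] \<delta> unfolding translation_continuous_def by meson
    obtain n0 where n0: "r n0 < d" using reals_Archimedean[OF d(1)] by (auto simp: r_def)
    have "L (A n) \<le> \<kappa> * J * N + 2 * V * \<delta>" if n: "n0 \<le> n" for n
    proof -
      have "r n \<le> r n0" unfolding r_def using n by (intro le_imp_inverse_le) auto
      then have rn: "r n < d" using n0 by simp
      obtain B where B: "\<And>z::'a. \<bar>mollifier (r n) z\<bar> \<le> B" "\<And>z::'a. norm (mollifier_grad (r n) z) \<le> B"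
        using mollifier_bounded[OF r[of n]] by metis
      have uc: "uniformly_continuous_on UNIV (mollifier_grad (r n) :: 'a \<Rightarrow> 'a)"
        using uniformly_continuous_of_ball_support[OF continuous_mollifier_grad] mollifier_grad_eq_0[OF r[of n]] by metis
      define U where "U = (\<lambda>x. \<integral>y. f y * mollifier (r n) (x - y) \<partial>lborel)"
      define Gr where "Gr = (\<lambda>x. \<integral>y. f y *\<^sub>R mollifier_grad (r n) (x - y) \<partial>lborel)"
      have U: "(U has_derivative (\<lambda>h. Gr x \<bullet> h)) (at x)" for x
        unfolding U_def Gr_def by (rule convolution_C1(1)[OF f(1) mollifier_has_derivative uc B])
      have cGr: "continuous_on UNIV Gr"
        unfolding Gr_def by (rule convolution_C1(2)[OF f(1) mollifier_has_derivative uc B])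
      have cU: "continuous_on UNIV U"
        using U by (meson has_derivative_continuous_on has_derivative_at_withinI)
      have Ui: "set_integrable lborel (A n) U"
        using Am Ab by (intro set_integrable_continuous_bounded cU) auto
      have nn: "0 \<le> (LINT x:A n|lborel. norm (x - c))" "0 \<le> (LINT x:A n|lborel. norm (Gr x))"
        unfolding set_lebesgue_integral_def by (auto intro!: integral_nonneg_AE simp: indicator_def)
      have "(LINT x:A n|lborel. \<bar>measure lborel (A n) * U x - (LINT z:A n|lborel. U z)\<bar>)
          \<le> \<kappa> * (LINT x:A n|lborel. norm (x - c)) * (LINT x:A n|lborel. norm (Gr x))"
        unfolding \<kappa>_def by (rule poincare_C1[OF Ao Ab Ac U cGr])
      also have "\<dots> \<le> \<kappa> * J * N"
      proof (rule mult_mono)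
        have "(LINT x:A n|lborel. norm (x - c)) \<le> J"
          unfolding J_def using \<Omega>b \<Omega>(2)
          by (intro mono_set set_integrable_continuous_bounded continuous_intros) auto
        then show "\<kappa> * (LINT x:A n|lborel. norm (x - c)) \<le> \<kappa> * J" using \<kappa> by simp
        show "(LINT x:A n|lborel. norm (Gr x)) \<le> N"
          unfolding Gr_def N_def by (rule mollified_gradient_L1[OF wg r f \<gamma> Ao Ab Acb])
        show "0 \<le> \<kappa> * J" using \<kappa> by (simp add: J_def set_lebesgue_integral_def integral_nonneg_AE)
      qed (rule nn)
      finally have 1: "(LINT x:A n|lborel. \<bar>measure lborel (A n) * U x - (LINT z:A n|lborel. U z)\<bar>) \<le> \<kappa> * J * N" .
      have "(LINT x:A n|lborel. \<bar>U x - f x\<bar>) \<le> \<delta>"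
        unfolding U_def
      proof (rule mollified_L1_close[OF r f(1) _ _ Ao Ab])
        show "(\<integral>x. \<bar>f (z + x) - f x\<bar> \<partial>lborel) \<le> \<delta>" if "norm z < r n" for z
          using d(2)[of z] that rn by simp
        show "continuous_on UNIV (\<lambda>x. \<integral>y. f y * mollifier (r n) (x - y) \<partial>lborel)" using cU by (simp add: U_def)
      qed
      then have 2: "2 * measure lborel (A n) * (LINT x:A n|lborel. \<bar>U x - f x\<bar>) \<le> 2 * V * \<delta>"
        using mV[of n] \<delta> by (intro mult_mono) (auto simp: set_lebesgue_integral_def V_def intro!: integral_nonneg_AE)
      show ?thesis unfolding L_def
        using deviation_perturb[OF Ao Ab fi[OF Am] Ui] 1 2 by fastforce
    qed
    then show ?thesis by blast
  qed
  have lim: "(\<lambda>n. L (A n)) \<longlonglongrightarrow> L \<Omega>"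
  proof -
    define m where "m = (\<lambda>n. LINT z:A n|lborel. f z)"
    define I where "I = (LINT z:\<Omega>|lborel. \<bar>f z\<bar>)"
    have mlim: "m \<longlonglongrightarrow> (LINT z:\<Omega>|lborel. f z)"
      unfolding m_def by (rule set_integral_incseq_tendsto[OF Am Ainc AU fi[OF \<Omega>b]])
    have "(\<lambda>n. measure lborel (A n)) \<longlonglongrightarrow> measure lborel (\<Union>n. A n)"
      using Am Ainc emeasure_lborel_bounded[OF \<Omega>(2)] by (intro Lim_measure_incseq) (auto simp: AU)
    then have Vlim: "(\<lambda>n. measure lborel (A n)) \<longlonglongrightarrow> V" by (simp add: AU V_def)
    have mI: "\<bar>m n\<bar> \<le> I" for n
    proof -
      have "\<bar>m n\<bar> \<le> (LINT z:A n|lborel. \<bar>f z\<bar>)"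
        unfolding m_def using set_integral_norm_bound[OF fi[OF Am]] by simp
      also have "\<dots> \<le> I" unfolding I_def by (intro mono_set set_integrable_abs fi \<Omega>b) auto
      finally show ?thesis .
    qed
    have fm: "f \<in> borel_measurable lborel" using f(1) by (rule borel_measurable_integrable)
    \<comment> \<open>Volume, mean and domain of integration all vary with \<open>n\<close>. The
      domination uses that the volumes are at most \<open>V\<close> and the integrals
      \<open>m n\<close> at most \<open>I\<close> in absolute value.\<close>
    have "(\<lambda>n. \<integral>x. indicat_real (A n) x *\<^sub>R \<bar>measure lborel (A n) * f x - m n\<bar> \<partial>lborel)
        \<longlonglongrightarrow> (\<integral>x. indicat_real \<Omega> x *\<^sub>R \<bar>V * f x - (LINT z:\<Omega>|lborel. f z)\<bar> \<partial>lborel)"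
    proof (rule integral_dominated_convergence[where w = "\<lambda>x. V * \<bar>f x\<bar> + I * indicator \<Omega> x"])
      show "integrable lborel (\<lambda>x. V * \<bar>f x\<bar> + I * indicator \<Omega> x)"
        using f(1) \<Omega>b emeasure_lborel_bounded[OF \<Omega>(2)]
        by (intro Bochner_Integration.integrable_add integrable_mult_right integrable_abs integrable_real_indicator) auto
      show "AE x in lborel. (\<lambda>n. indicat_real (A n) x *\<^sub>R \<bar>measure lborel (A n) * f x - m n\<bar>)
          \<longlonglongrightarrow> indicat_real \<Omega> x *\<^sub>R \<bar>V * f x - (LINT z:\<Omega>|lborel. f z)\<bar>"
      proof (rule AE_I2)
        fix x :: 'a
        have "(\<lambda>n. indicat_real (A n) x) \<longlonglongrightarrow> indicat_real (\<Union>n. A n) x"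
          using Ainc by (rule LIMSEQ_indicator_incseq)
        then show "(\<lambda>n. indicat_real (A n) x *\<^sub>R \<bar>measure lborel (A n) * f x - m n\<bar>)
          \<longlonglongrightarrow> indicat_real \<Omega> x *\<^sub>R \<bar>V * f x - (LINT z:\<Omega>|lborel. f z)\<bar>"
          unfolding AU by (intro tendsto_intros Vlim mlim)
      qed
      show "AE x in lborel. norm (indicat_real (A n) x *\<^sub>R \<bar>measure lborel (A n) * f x - m n\<bar>) \<le> V * \<bar>f x\<bar> + I * indicator \<Omega> x" for n
      proof (rule AE_I2)
        fix x :: 'a
        have V0: "0 \<le> V * \<bar>f x\<bar>" by (simp add: V_def)
        have I0: "0 \<le> I" using mI[of 0] by linarith
        show "norm (indicat_real (A n) x *\<^sub>R \<bar>measure lborel (A n) * f x - m n\<bar>) \<le> V * \<bar>f x\<bar> + I * indicator \<Omega> x"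
        proof (cases "x \<in> A n")
          case True
          then have "x \<in> \<Omega>" using Asub by blast
          moreover have "\<bar>measure lborel (A n) * f x - m n\<bar> \<le> \<bar>measure lborel (A n) * f x\<bar> + \<bar>m n\<bar>" by linarith
          moreover have "\<bar>measure lborel (A n) * f x\<bar> \<le> V * \<bar>f x\<bar>"
            using mV[of n] by (simp add: abs_mult mult_right_mono)
          ultimately show ?thesis using True mI[of n] by simp
        next
          case False
          then show ?thesis using V0 I0 by (simp add: indicator_def)
        qed
      qed
    qed (use fm Am \<Omega>b in \<open>auto intro!: borel_measurable_scaleR borel_measurable_indicator\<close>)
    then show ?thesis by (simp only: L_def m_def V_def set_lebesgue_integral_def)
  qed
  have "L \<Omega> \<le> \<kappa> * J * N + e" if e: "0 < e" for e
  proof -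
    define \<delta> where "\<delta> = e / (2 * V + 1)"
    have V0: "0 \<le> V" by (simp add: V_def)
    have \<delta>: "0 < \<delta>" "2 * V * \<delta> \<le> e" using e V0 by (auto simp: \<delta>_def field_simps)
    have "L \<Omega> \<le> \<kappa> * J * N + 2 * V * \<delta>" using bound[OF \<delta>(1)] by (intro LIMSEQ_le_const2[OF lim])
    then show ?thesis using \<delta>(2) by linarith
  qed
  then have "L \<Omega> \<le> \<kappa> * J * N" using field_le_epsilon by blast
  then show ?thesis by (simp add: L_def J_def N_def \<kappa>_def)
qed

lemma set_integral_lebesgue_lborel:
  fixes h :: "'a::euclidean_space \<Rightarrow> 'b::euclidean_space"
  assumes "h \<in> borel_measurable lborel" "S \<in> sets lborel"
  shows "(LINT x:S|lebesgue. h x) = (LINT x:S|lborel. h x)"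
  unfolding set_lebesgue_integral_def using assms
  by (intro integral_completion) (auto intro!: borel_measurable_scaleR borel_measurable_indicator)

text \<open>What is left is the passage from \<open>lebesgue\<close> to \<open>lborel\<close> by
  Borel representatives that agree almost everywhere, division by the volume, and the choice of the
  centroid as centre. The factor \<open>V\<close> from \<open>mean_dist\<close> cancels the one from
  the deviation.\<close>

theorem theorem1:
  fixes \<Omega> :: "'a::euclidean_space set" and u :: "'a \<Rightarrow> real" and g :: "'a \<Rightarrow> 'a"
  assumes "open \<Omega>" "\<Omega> \<noteq> {}" "bounded \<Omega>" "convex \<Omega>"
    and "u \<in> W11 \<Omega>" and "weak_gradient_W11 \<Omega> u g"
  shows "(LINT x:\<Omega>|lebesgue. \<bar>u x - (1 / measure lebesgue \<Omega>) * (LINT z:\<Omega>|lebesgue. u z)\<bar>)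
           \<le> (2 / ln 2) * mean_dist \<Omega> * (LINT x:\<Omega>|lebesgue. norm (g x))"
proof -
  have \<Omega>b: "\<Omega> \<in> sets lborel" using assms(1) by (simp add: borel_open)
  have ui: "integrable lebesgue (\<lambda>y. indicator \<Omega> y *\<^sub>R u y)" and gi: "integrable lebesgue (\<lambda>y. indicator \<Omega> y *\<^sub>R g y)"
    using assms(6) by (auto simp: weak_gradient_W11_def set_integrable_def)
  have "integrable lebesgue (\<lambda>y. norm (indicator \<Omega> y *\<^sub>R g y))" by (rule integrable_norm[OF gi])
  then have ngi: "integrable lebesgue (\<lambda>y. indicator \<Omega> y *\<^sub>R norm (g y))" by simp
  obtain f where f: "f \<in> borel_measurable lborel" "AE y in lborel. indicator \<Omega> y *\<^sub>R u y = f y"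
    using completion_ex_borel_measurable_real[OF borel_measurable_integrable[OF ui]] by blast
  obtain \<gamma>' where \<gamma>': "\<gamma>' \<in> borel_measurable lborel" "AE y in lborel. indicator \<Omega> y *\<^sub>R norm (g y) = \<gamma>' y"
    using completion_ex_borel_measurable_real[OF borel_measurable_integrable[OF ngi]] by blast
  \<comment> \<open>The representative is nonnegative almost everywhere only; the absolute value
    makes it so everywhere without changing it outside a null set.\<close>
  define \<gamma> where "\<gamma> = (\<lambda>y. \<bar>\<gamma>' y\<bar>)"
  have \<gamma>: "\<gamma> \<in> borel_measurable lborel" "AE y in lborel. indicator \<Omega> y *\<^sub>R norm (g y) = \<gamma> y" "\<And>y. 0 \<le> \<gamma> y"
  proof -
    show "\<gamma> \<in> borel_measurable lborel" unfolding \<gamma>_def using \<gamma>'(1) by measurable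
    show "AE y in lborel. indicator \<Omega> y *\<^sub>R norm (g y) = \<gamma> y"
      using \<gamma>'(2)
    proof eventually_elim
      case (elim y)
      have "0 \<le> indicat_real \<Omega> y *\<^sub>R norm (g y)" by simp
      then show ?case unfolding \<gamma>_def elim by simp
    qed
    show "0 \<le> \<gamma> y" for y by (simp add: \<gamma>_def)
  qed
  have fl: "f \<in> borel_measurable lebesgue" "\<gamma> \<in> borel_measurable lebesgue"
    using f(1) \<gamma>(1) by (auto intro: measurable_completion)
  have fi: "integrable lborel f"
    using integrable_cong_AE_imp[OF ui fl(1)] AE_completion[OF f(2)] f(1) integrable_completion[of f lborel] by auto
  have \<gamma>i: "integrable lborel \<gamma>"
    using integrable_cong_AE_imp[OF ngi fl(2)] AE_completion[OF \<gamma>(2)] \<gamma>(1) integrable_completion[of \<gamma> lborel] by auto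
  define V where "V = measure lborel \<Omega>"
  have V: "0 < V" unfolding V_def using assms by (intro measure_pos_open)
  have Vl: "measure lebesgue \<Omega> = V" unfolding V_def using \<Omega>b by simp
  have mean: "(LINT z:\<Omega>|lebesgue. u z) = (LINT z:\<Omega>|lborel. f z)"
  proof -
    have "(LINT z:\<Omega>|lebesgue. u z) = (\<integral>z. indicator \<Omega> z *\<^sub>R f z \<partial>lebesgue)"
      unfolding set_lebesgue_integral_def
    proof (rule integral_cong_AE)
      show "(\<lambda>z. indicator \<Omega> z *\<^sub>R f z) \<in> borel_measurable lebesgue"
        using fl(1) \<Omega>b by (intro borel_measurable_scaleR borel_measurable_indicator) auto
      show "AE z in lebesgue. indicator \<Omega> z *\<^sub>R u z = indicator \<Omega> z *\<^sub>R f z"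
        using AE_completion[OF f(2)] by eventually_elim (auto simp: indicator_def)
    qed (rule borel_measurable_integrable[OF ui])
    also have "\<dots> = (LINT z:\<Omega>|lborel. f z)"
      using set_integral_lebesgue_lborel[OF f(1) \<Omega>b] by (simp add: set_lebesgue_integral_def)
    finally show ?thesis .
  qed
  define m where "m = (LINT z:\<Omega>|lborel. f z)"
  have "(LINT x:\<Omega>|lebesgue. \<bar>u x - (1 / V) * m\<bar>) = (\<integral>x. indicator \<Omega> x *\<^sub>R \<bar>f x - (1 / V) * m\<bar> \<partial>lebesgue)"
    unfolding set_lebesgue_integral_def
  proof (rule integral_cong_AE)
    show "(\<lambda>x. indicator \<Omega> x *\<^sub>R \<bar>f x - (1 / V) * m\<bar>) \<in> borel_measurable lebesgue"
      using fl(1) \<Omega>b by (intro borel_measurable_scaleR borel_measurable_indicator) auto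
    have ind: "indicat_real \<Omega> \<in> borel_measurable lebesgue" using \<Omega>b by (intro borel_measurable_indicator) auto
    have "(\<lambda>x. indicator \<Omega> x *\<^sub>R \<bar>u x - (1 / V) * m\<bar>) = (\<lambda>x. \<bar>indicator \<Omega> x *\<^sub>R u x - indicator \<Omega> x * ((1 / V) * m)\<bar>)"
      by (auto simp: indicator_def)
    then show "(\<lambda>x. indicator \<Omega> x *\<^sub>R \<bar>u x - (1 / V) * m\<bar>) \<in> borel_measurable lebesgue"
      using borel_measurable_integrable[OF ui] ind by simp
    show "AE x in lebesgue. indicator \<Omega> x *\<^sub>R \<bar>u x - (1 / V) * m\<bar> = indicator \<Omega> x *\<^sub>R \<bar>f x - (1 / V) * m\<bar>"
      using AE_completion[OF f(2)] by eventually_elim (auto simp: indicator_def)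
  qed
  also have "\<dots> = (LINT x:\<Omega>|lborel. \<bar>f x - (1 / V) * m\<bar>)"
    using set_integral_lebesgue_lborel[of "\<lambda>x. \<bar>f x - (1 / V) * m\<bar>" \<Omega>] f(1) \<Omega>b
    by (simp add: set_lebesgue_integral_def)
  also have "\<dots> = (1 / V) * (LINT x:\<Omega>|lborel. \<bar>V * f x - m\<bar>)"
  proof -
    have "\<bar>f x - (1 / V) * m\<bar> = (1 / V) * \<bar>V * f x - m\<bar>" for x
    proof -
      have "f x - (1 / V) * m = (1 / V) * (V * f x - m)" using V by (simp add: field_simps)
      then show ?thesis using V by (simp add: abs_mult)
    qed
    then show ?thesis by (simp only: set_integral_mult_right)
  qed
  also have "\<dots> \<le> (1 / V) * ((2 / ln 2) * (LINT x:\<Omega>|lborel. norm (x - centroid \<Omega>)) * (\<integral>y. \<gamma> y \<partial>lborel))"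
    unfolding V_def m_def using V
    by (intro mult_left_mono poincare_lborel[OF assms(1,3,4,6) fi f(2) \<gamma>i \<gamma>(2,3)]) (simp add: V_def)
  also have "(LINT x:\<Omega>|lborel. norm (x - centroid \<Omega>)) = V * mean_dist \<Omega>"
  proof -
    have "(\<lambda>x. norm (x - centroid \<Omega>)) \<in> borel_measurable lborel" by measurable
    then show ?thesis
      using V set_integral_lebesgue_lborel[OF _ \<Omega>b, of "\<lambda>x. norm (x - centroid \<Omega>)"] by (simp add: mean_dist_def Vl)
  qed
  also have "(\<integral>y. \<gamma> y \<partial>lborel) = (LINT x:\<Omega>|lebesgue. norm (g x))"
  proof -
    have "(LINT x:\<Omega>|lebesgue. norm (g x)) = (\<integral>y. \<gamma> y \<partial>lebesgue)"
      unfolding set_lebesgue_integral_def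
      by (rule integral_cong_AE[OF borel_measurable_integrable[OF ngi] fl(2) AE_completion[OF \<gamma>(2)]])
    then show ?thesis using integral_completion[OF \<gamma>(1)] by simp
  qed
  finally show ?thesis using V unfolding Vl mean m_def[symmetric] by (simp add: mult_ac)
qed

end
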